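(* Let $\mathbb{B}=(\mathbb{B}_\alpha,\|\cdot\|_\alpha)$ and $\mathbb{E}=(\mathbb{E}_\alpha,|||\cdot|||_\alpha)$, $\alpha\in[\alpha_*,\alpha^*]$, be two scales of Banach spaces with $\mathbb{B}_\alpha\subset\mathbb{E}_\alpha$ continuously embedded and $|||\cdot|||_\alpha\le\|\cdot\|_\alpha$ for all $\alpha$. Let $T>0$, $x\in\mathbb{B}_{\alpha_*}$, and suppose that conditions A1, A2, A3, A4, B1, B2, B3 (listed in the context) are satisfied, either for ($\beta=0$, $r\in(0,\infty]$) or for ($\beta\in(0,\tfrac12)$, $r\in(0,\infty]$). Let $\alpha_0\in[\alpha_*,\alpha^* )$, let $\lambda>0$ with $\frac{\alpha^*-\alpha_0}{\lambda}\le T$, and let $u:[0,\frac{\alpha^*-\alpha_0}{\lambda})\to\mathbb{B}_{\alpha^*}$. Then $u$ is a classical $\mathbb{B}$-valued solution to $$\frac{\mathrm{d}u(t)}{\mathrm{d}t}=A(t)u(t)+B(u(t),t),\qquad u(0)=x,$$ on $[0,\frac{\alpha^*-\alpha_0}{\lambda})$ if and only if $u$ is a solution to $$u(t)=U(t,0)x+\int_0^tU(t,s)B(u(s),s)\,\mathrm{d}s$$ on $[0,\frac{\alpha^*-\alpha_0}{\lambda})$ in the scale $(\mathbb{B}_\alpha)_{\alpha\in[\alpha_0,\alpha^*]}$.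
   Context: Scale: $\mathbb{B}=(\mathbb{B}_\alpha,\|\cdot\|_\alpha)_{\alpha_*\le\alpha\le\alpha^*}$ are Banach spaces with $\mathbb{B}_{\alpha'}\subset\mathbb{B}_\alpha$ and $\|\cdot\|_\alpha\le\|\cdot\|_{\alpha'}$ for $\alpha'<\alpha$; $i_{\alpha'\alpha}$ is the embedding. $B_r^\alpha(x)=\{y\in\mathbb{B}_\alpha:\|y-x\|_\alpha\le r\}$ for $r\in(0,\infty)$, $B_\infty^\alpha(x)=\mathbb{B}_\alpha$. A nonlinear operator $L$ in the scale (relative to $r\in(0,\infty]$ and $x\in\mathbb{B}_{\alpha_*}$) is a collection of maps $L_{\alpha'\alpha}:B_r^{\alpha'}(x)\to\mathbb{B}_\alpha$, $\alpha_*\le\alpha'<\alpha\le\alpha^*$, with $L_{\alpha'\alpha''}y=i_{\alpha\alpha''}L_{\alpha'\alpha}y=L_{\alpha\alpha''}i_{\alpha'\alpha}y$ for $\alpha'<\alpha<\alpha''$ and $y\in B_r^{\alpha'}(x)$. It is a bounded linear operator in the scale if $r=\infty$ and every $L_{\alpha'\alpha}$ is a bounded linear operator $\mathbb{B}_{\alpha'}\to\mathbb{B}_\alpha$. Compositions are $(LK)_{\alpha'\alpha}=L_{\delta\alpha}K_{\alpha'\delta}$ for any $\delta\in(\alpha',\alpha)$ (independent of $\delta$). Subscripts are omitted; $\|\cdot\|_{\alpha'\alpha}$ is the operator norm in $L(\mathbb{B}_{\alpha'},\mathbb{B}_\alpha)$. Conditions ($x\in\mathbb{B}_{\alpha_*}$,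 $T>0$ fixed): A1. $(U(t,s))_{0\le s\le t<T}$ are bounded linear operators in the scale with $U(t,t)=1$ (the embedding), $U(t,q)U(q,s)=U(t,s)$ for $s\le q\le t$, and $(t,s)\mapsto U(t,s)\in L(\mathbb{B}_{\alpha'},\mathbb{B}_\alpha)$ strongly continuous for all $\alpha'<\alpha$. A2. There are $C_1>0$, $\beta\in[0,\frac12)$ with $\|U(t,s)\|_{\alpha'\alpha}\le\frac{C_1}{(\alpha-\alpha')^\beta}$ for all $\alpha'<\alpha$, $0\le s\le t<T$. A3. For each $\alpha\in(\alpha_*,\alpha^*]$ there is $C(x,\alpha)>0$ with $\|U(t,0)x-U(s,0)x\|_\alpha\le C(x,\alpha)|t-s|$ for $0\le s,t\le\frac{\alpha-\alpha_*}{\alpha^*-\alpha_*}T$. A4. There is a family of linear operators $(A(t))_{t\in[0,T)}$ (compatible with the embeddings of the scales) such that for all $\alpha'<\alpha$ the map $[0,T)\ni t\mapsto A(t)\in L(\mathbb{B}_{\alpha'},\mathbb{E}_\alpha)$ is strongly continuous. The $U(t,s)$ also act as bounded linear operators in the scale $\mathbb{E}$ (extending those on $\mathbb{B}$), and $(t,s)\mapsto U(t,s)y\in\mathbb{E}_\alpha$ is continuous for any $y\in\mathbb{E}_{\alpha'}$ and $\alpha'<\alpha$. Moreover, for $y\in\mathbb{B}_{\alpha'}$ and $\alpha'<\alpha$ the function $(t,s)\mapsto U(t,s)y$ is differentiable in $\mathbb{E}_\alpha$ with $\frac{\partial U(t,s)}{\partial t}y=A(t)U(t,s)y$ and $\frac{\partial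 U(t,s)}{\partial s}y=-U(t,s)A(s)y$ for $0\le s\le t<T$ (one-sided derivatives when $s=t$). B1. For some $r\in(0,\infty]$, $(B(\cdot,t))_{t\in[0,T)}$ is a family of nonlinear operators in the scale (relative to $r$, $x$) such that $B_r^{\alpha'}(x)\times[0,T)\ni(u,t)\mapsto B(u,t)\in\mathbb{B}_\alpha$ is jointly continuous for all $\alpha'<\alpha$. B2. There is $C_2>0$ with $\|B(u,t)-B(v,t)\|_\alpha\le\frac{C_2}{(\alpha-\alpha')^{1-\beta}}\|u-v\|_{\alpha'}$ for all $\alpha'<\alpha$, $t\in[0,T)$, $u,v\in B_r^{\alpha'}(x)$ (same $\beta$ as in A2). B3. There is $C_3>0$ with $\|B(x,t)\|_\alpha\le\frac{C_3}{\alpha-\alpha_*}$ for all $t\in[0,T)$, $\alpha\in(\alpha_*,\alpha^*]$. Solution of the integral equation: put $T(\alpha)=\frac{\alpha-\alpha_0}{\lambda}$. A solution on $[0,\frac{\alpha^*-\alpha_0}{\lambda})$ in the scale $(\mathbb{B}_\alpha)_{\alpha\in[\alpha_0,\alpha^*]}$ is a function $u:[0,T(\alpha^* ))\to\mathbb{B}_{\alpha^*}$ such that for all $\alpha\in(\alpha_0,\alpha^*]$: (i) $u|_{[0,T(\alpha))}\in C([0,T(\alpha));\mathbb{B}_\alpha)$ and $u(t)\in B_r^\alpha(x)$ for $t\in[0,T(\alpha))$; (ii) for each $t\in[0,T(\alpha))$ there are $\alpha'<\alpha''$ in $[\alpha_0,\alpha)$ with $t<T(\alpha')$ such that $u(t)=U_{\alpha_*\alpha}(t,0)x+\int_0^tU_{\alpha''\alpha}(t,s)B_{\alpha'\alpha''}(u(s),s)\,\mathrm{d}s$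 in $\mathbb{B}_\alpha$ (independent of the choice of $\alpha',\alpha''$). Classical $\mathbb{B}$-valued solution on $[0,\frac{\alpha^*-\alpha_0}{\lambda})$: a function $u:[0,T(\alpha^* ))\to\mathbb{B}_{\alpha^*}$ such that for all $\alpha\in(\alpha_0,\alpha^*]$ the restriction $u|_{[0,T(\alpha))}$ lies in $C^1([0,T(\alpha));\mathbb{E}_\alpha)\cap C([0,T(\alpha));\mathbb{B}_\alpha)$, $u(t)\in B_r^\alpha(x)$ for all $t\in[0,T(\alpha))$, $u(0)=x$, and $\frac{\mathrm{d}u(t)}{\mathrm{d}t}=A(t)u(t)+B(u(t),t)$ holds in $\mathbb{E}_\alpha$ for all $t\in[0,T(\alpha))$ (here $u(t)\in\mathbb{B}_{\alpha'}$ for some $\alpha'<\alpha$ with $t<T(\alpha')$, so the right-hand side is in $\mathbb{E}_\alpha$). *)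

theory Defs
  imports "HOL-Analysis.Analysis"
begin

section \<open>Banach spaces inside an ambient vector space\<close>

text \<open>
  The members of a scale are different Banach spaces that are contained in one another. They are
  represented as linear subspaces of one real vector space \<open>'a\<close> (for instance the
  largest space involved), each with a norm of its own; all embeddings are then inclusions. Only the
  values of the norm on the subspace carry meaning.
\<close>

record 'a nspace =
  pts :: "'a set"
  nrm :: "'a \<Rightarrow> real"

text \<open>
  The library's metric space locale requires symmetry and nonnegativity of the metric also
  outside the carrier; hence the totalisation by 0.
\<close>

definition ndist :: "'a::real_vector nspace \<Rightarrow> 'a \<Rightarrow> 'a \<Rightarrow> real" where
  "ndist X y z = (if y \<in> pts X \<and> z \<in> pts X then nrm X (y - z) else 0)"

definition ntop :: "'a::real_vector nspace \<Rightarrow> 'a topology" where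
  "ntop X = Metric_space.mtopology (pts X) (ndist X)"

definition normed_subspace :: "'a::real_vector nspace \<Rightarrow> bool" where
  "normed_subspace X \<longleftrightarrow>
     subspace (pts X) \<and>
     (\<forall>y\<in>pts X. 0 \<le> nrm X y \<and> (nrm X y = 0 \<longleftrightarrow> y = 0)) \<and>
     (\<forall>y\<in>pts X. \<forall>z\<in>pts X. nrm X (y + z) \<le> nrm X y + nrm X z) \<and>
     (\<forall>c. \<forall>y\<in>pts X. nrm X (c *\<^sub>R y) = \<bar>c\<bar> * nrm X y)"

definition banach_subspace :: "'a::real_vector nspace \<Rightarrow> bool" where
  "banach_subspace X \<longleftrightarrow>
     normed_subspace X \<and> Metric_space.mcomplete (pts X) (ndist X)"

lemma Metric_space_ndist:
  assumes "normed_subspace X"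
  shows "Metric_space (pts X) (ndist X)"
proof
  have sub: "subspace (pts X)"
    and pos: "\<And>y. y \<in> pts X \<Longrightarrow> 0 \<le> nrm X y \<and> (nrm X y = 0 \<longleftrightarrow> y = 0)"
    and tri: "\<And>y z. y \<in> pts X \<Longrightarrow> z \<in> pts X \<Longrightarrow> nrm X (y + z) \<le> nrm X y + nrm X z"
    and hom: "\<And>c y. y \<in> pts X \<Longrightarrow> nrm X (c *\<^sub>R y) = \<bar>c\<bar> * nrm X y"
    using assms by (auto simp: normed_subspace_def)
  note diff = subspace_diff[OF sub]
  fix x y z
  show "0 \<le> ndist X x y"
    using pos diff by (simp add: ndist_def)
  show "ndist X x y = ndist X y x"
    using hom[of "x - y" "-1"] diff by (auto simp: ndist_def)
  show "ndist X x y = 0 \<longleftrightarrow> x = y" if "x \<in> pts X" "y \<in> pts X"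
    using that pos diff by (simp add: ndist_def)
  show "ndist X x z \<le> ndist X x y + ndist X y z"
    if "x \<in> pts X" "y \<in> pts X" "z \<in> pts X"
    using that tri[of "x - y" "y - z"] diff by (simp add: ndist_def)
qed

definition nball :: "'a::real_vector nspace \<Rightarrow> 'a \<Rightarrow> ereal \<Rightarrow> 'a set" where
  "nball X x r = {y \<in> pts X. ereal (nrm X (y - x)) \<le> r}"

definition bounded_linear_btw ::
    "'a::real_vector nspace \<Rightarrow> 'a nspace \<Rightarrow> ('a \<Rightarrow> 'a) \<Rightarrow> bool" where
  "bounded_linear_btw X Y f \<longleftrightarrow>
     (\<forall>y\<in>pts X. f y \<in> pts Y) \<and>
     (\<forall>y\<in>pts X. \<forall>z\<in>pts X. f (y + z) = f y + f z) \<and>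
     (\<forall>c. \<forall>y\<in>pts X. f (c *\<^sub>R y) = c *\<^sub>R f y) \<and>
     (\<exists>K. \<forall>y\<in>pts X. nrm Y (f y) \<le> K * nrm X y)"

definition opnorm :: "'a::real_vector nspace \<Rightarrow> 'a nspace \<Rightarrow> ('a \<Rightarrow> 'a) \<Rightarrow> real" where
  "opnorm X Y f = (SUP y\<in>{y \<in> pts X. nrm X y \<le> 1}. nrm Y (f y))"

text \<open>Derivative of \<open>f\<close> at \<open>t\<close>, relative to the set \<open>S\<close>, in the norm of \<open>X\<close>.\<close>

definition has_deriv_in ::
    "'a::real_vector nspace \<Rightarrow> (real \<Rightarrow> 'a) \<Rightarrow> 'a \<Rightarrow> real \<Rightarrow> real set \<Rightarrow> bool" where
  "has_deriv_in X f d t S \<longleftrightarrow>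
     limitin (ntop X) (\<lambda>s. (f s - f t) /\<^sub>R (s - t)) d (at t within S)"

text \<open>
  Integral over a compact interval in the norm of \<open>X\<close>: the definition of
  \<^const>\<open>has_integral\<close>, with the topology of \<open>X\<close>. It is used for continuous integrands only.
\<close>

definition has_integral_in ::
    "'a::real_vector nspace \<Rightarrow> (real \<Rightarrow> 'a) \<Rightarrow> 'a \<Rightarrow> real \<Rightarrow> real \<Rightarrow> bool" where
  "has_integral_in X f I a b \<longleftrightarrow>
     limitin (ntop X) (\<lambda>p. \<Sum>(s,K)\<in>p. measure lborel K *\<^sub>R f s) I (division_filter (cbox a b))"

lemma ntop_UNIV: "ntop \<lparr>pts = UNIV, nrm = norm\<rparr> = (euclidean :: 'a::real_normed_vector topology)"
proof -
  have "ndist \<lparr>pts = UNIV, nrm = norm\<rparr> = (dist :: 'a \<Rightarrow> 'a \<Rightarrow> real)"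
    by (intro ext) (simp add: ndist_def dist_norm)
  then show ?thesis by (simp add: ntop_def mtopology_is_euclidean)
qed

lemma has_integral_in_UNIV:
  "has_integral_in \<lparr>pts = UNIV, nrm = norm\<rparr> f I a b \<longleftrightarrow> (f has_integral I) {a..b}"
  using has_integral_cbox[of f I a b] by (simp add: has_integral_in_def ntop_UNIV)


section \<open>Scales of Banach spaces and operators in scales\<close>

text \<open>
  \<open>lo\<close> and \<open>hi\<close> are the end points of the index interval of a scale.
  An operator in a scale carries two indices, \<open>L \<alpha>' \<alpha>\<close> being a map from (a ball of)
  the space with index \<open>\<alpha>'\<close> into the space with index \<open>\<alpha>\<close>. Its values outside
  that domain are irrelevant.
\<close>

definition banach_scale :: "real \<Rightarrow> real \<Rightarrow> (real \<Rightarrow> 'a::real_vector nspace) \<Rightarrow> bool" where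
  "banach_scale lo hi X \<longleftrightarrow>
     (\<forall>\<alpha>\<in>{lo..hi}. banach_subspace (X \<alpha>)) \<and>
     (\<forall>\<alpha>' \<alpha>. lo \<le> \<alpha>' \<and> \<alpha>' < \<alpha> \<and> \<alpha> \<le> hi \<longrightarrow>
        pts (X \<alpha>') \<subseteq> pts (X \<alpha>) \<and> (\<forall>y\<in>pts (X \<alpha>'). nrm (X \<alpha>) y \<le> nrm (X \<alpha>') y))"

definition scale_embedded ::
    "real \<Rightarrow> real \<Rightarrow> (real \<Rightarrow> 'a::real_vector nspace) \<Rightarrow> (real \<Rightarrow> 'a nspace) \<Rightarrow> bool" where
  "scale_embedded lo hi X Y \<longleftrightarrow>
     (\<forall>\<alpha>\<in>{lo..hi}. pts (X \<alpha>) \<subseteq> pts (Y \<alpha>) \<and> (\<forall>y\<in>pts (X \<alpha>). nrm (Y \<alpha>) y \<le> nrm (X \<alpha>) y))"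

definition nonlinear_op_in_scale ::
    "real \<Rightarrow> real \<Rightarrow> (real \<Rightarrow> 'a::real_vector nspace) \<Rightarrow> ereal \<Rightarrow> 'a \<Rightarrow> (real \<Rightarrow> real \<Rightarrow> 'a \<Rightarrow> 'a) \<Rightarrow> bool"
  where
  "nonlinear_op_in_scale lo hi X r x L \<longleftrightarrow>
     (\<forall>\<alpha>' \<alpha>. lo \<le> \<alpha>' \<and> \<alpha>' < \<alpha> \<and> \<alpha> \<le> hi \<longrightarrow>
        (\<forall>y\<in>nball (X \<alpha>') x r. L \<alpha>' \<alpha> y \<in> pts (X \<alpha>))) \<and>
     (\<forall>\<alpha>' \<alpha> \<alpha>''. lo \<le> \<alpha>' \<and> \<alpha>' < \<alpha> \<and> \<alpha> < \<alpha>'' \<and> \<alpha>'' \<le> hi \<longrightarrow>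
        (\<forall>y\<in>nball (X \<alpha>') x r. L \<alpha>' \<alpha>'' y = L \<alpha>' \<alpha> y \<and> L \<alpha>' \<alpha> y = L \<alpha> \<alpha>'' y))"

text \<open>For \<open>r = \<infinity>\<close> the centre of the ball is immaterial; it is taken to be 0.\<close>

definition bounded_linear_op_in_scale ::
    "real \<Rightarrow> real \<Rightarrow> (real \<Rightarrow> 'a::real_vector nspace) \<Rightarrow> (real \<Rightarrow> real \<Rightarrow> 'a \<Rightarrow> 'a) \<Rightarrow> bool" where
  "bounded_linear_op_in_scale lo hi X L \<longleftrightarrow>
     nonlinear_op_in_scale lo hi X \<infinity> 0 L \<and>
     (\<forall>\<alpha>' \<alpha>. lo \<le> \<alpha>' \<and> \<alpha>' < \<alpha> \<and> \<alpha> \<le> hi \<longrightarrow> bounded_linear_btw (X \<alpha>') (X \<alpha>) (L \<alpha>' \<alpha>))"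


section \<open>Conditions\<close>

definition time_triangle :: "real \<Rightarrow> (real \<times> real) set" where
  "time_triangle T = {(t, s). 0 \<le> s \<and> s \<le> t \<and> t < T}"

definition cond_A1 ::
    "real \<Rightarrow> real \<Rightarrow> (real \<Rightarrow> 'a::real_vector nspace) \<Rightarrow> real \<Rightarrow>
     (real \<Rightarrow> real \<Rightarrow> real \<Rightarrow> real \<Rightarrow> 'a \<Rightarrow> 'a) \<Rightarrow> bool" where
  "cond_A1 lo hi X T U \<longleftrightarrow>
     (\<forall>(t, s)\<in>time_triangle T. bounded_linear_op_in_scale lo hi X (U t s)) \<and>
     (\<forall>t \<alpha>' \<alpha>. 0 \<le> t \<and> t < T \<and> lo \<le> \<alpha>' \<and> \<alpha>' < \<alpha> \<and> \<alpha> \<le> hi \<longrightarrow>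
        (\<forall>y\<in>pts (X \<alpha>'). U t t \<alpha>' \<alpha> y = y)) \<and>
     (\<forall>s q t \<alpha>' \<delta> \<alpha>. 0 \<le> s \<and> s \<le> q \<and> q \<le> t \<and> t < T \<and>
        lo \<le> \<alpha>' \<and> \<alpha>' < \<delta> \<and> \<delta> < \<alpha> \<and> \<alpha> \<le> hi \<longrightarrow>
        (\<forall>y\<in>pts (X \<alpha>'). U t q \<delta> \<alpha> (U q s \<alpha>' \<delta> y) = U t s \<alpha>' \<alpha> y)) \<and>
     (\<forall>\<alpha>' \<alpha>. lo \<le> \<alpha>' \<and> \<alpha>' < \<alpha> \<and> \<alpha> \<le> hi \<longrightarrow>
        (\<forall>y\<in>pts (X \<alpha>').
           continuous_map (top_of_set (time_triangle T)) (ntop (X \<alpha>)) (\<lambda>(t, s). U t s \<alpha>' \<alpha> y)))"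

definition cond_A2 ::
    "real \<Rightarrow> real \<Rightarrow> (real \<Rightarrow> 'a::real_vector nspace) \<Rightarrow> real \<Rightarrow>
     (real \<Rightarrow> real \<Rightarrow> real \<Rightarrow> real \<Rightarrow> 'a \<Rightarrow> 'a) \<Rightarrow> real \<Rightarrow> bool" where
  "cond_A2 lo hi X T U \<beta> \<longleftrightarrow>
     0 \<le> \<beta> \<and> \<beta> < 1/2 \<and>
     (\<exists>C\<^sub>1>0. \<forall>\<alpha>' \<alpha>. lo \<le> \<alpha>' \<and> \<alpha>' < \<alpha> \<and> \<alpha> \<le> hi \<longrightarrow>
        (\<forall>(t, s)\<in>time_triangle T.
           opnorm (X \<alpha>') (X \<alpha>) (U t s \<alpha>' \<alpha>) \<le> C\<^sub>1 / (\<alpha> - \<alpha>') powr \<beta>))"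

text \<open>The times are also restricted to \<open>{0..<T}\<close>, which matters only for \<open>\<alpha> = hi\<close>.\<close>

definition cond_A3 ::
    "real \<Rightarrow> real \<Rightarrow> (real \<Rightarrow> 'a::real_vector nspace) \<Rightarrow> real \<Rightarrow> 'a \<Rightarrow>
     (real \<Rightarrow> real \<Rightarrow> real \<Rightarrow> real \<Rightarrow> 'a \<Rightarrow> 'a) \<Rightarrow> bool" where
  "cond_A3 lo hi X T x U \<longleftrightarrow>
     (\<forall>\<alpha>. lo < \<alpha> \<and> \<alpha> \<le> hi \<longrightarrow>
        (\<exists>C>0. \<forall>t\<in>{0..(\<alpha> - lo) / (hi - lo) * T} \<inter> {0..<T}.
               \<forall>s\<in>{0..(\<alpha> - lo) / (hi - lo) * T} \<inter> {0..<T}.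
           nrm (X \<alpha>) (U t 0 lo \<alpha> x - U s 0 lo \<alpha> x) \<le> C * \<bar>t - s\<bar>))"

text \<open>
  Here the spaces \<open>Y \<alpha>\<close> form the larger scale. That the operators \<open>U t s\<close> on this
  scale extend those on the scale \<open>X\<close> is expressed by using the same map
  \<open>U t s \<alpha>' \<alpha>\<close> on \<open>pts (Y \<alpha>')\<close> and on its subset \<open>pts (X \<alpha>')\<close>.
  Differentiability means the existence of the two partial derivatives along the time triangle;
  on the diagonal these are one-sided. The index \<open>\<delta>\<close> is the intermediate index of the
  compositions \<open>A(t) U(t,s)\<close> and \<open>U(t,s) A(s)\<close>.
\<close>

definition cond_A4 ::
    "real \<Rightarrow> real \<Rightarrow> (real \<Rightarrow> 'a::real_vector nspace) \<Rightarrow> (real \<Rightarrow> 'a nspace) \<Rightarrow> real \<Rightarrow>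
     (real \<Rightarrow> real \<Rightarrow> real \<Rightarrow> real \<Rightarrow> 'a \<Rightarrow> 'a) \<Rightarrow> (real \<Rightarrow> real \<Rightarrow> real \<Rightarrow> 'a \<Rightarrow> 'a) \<Rightarrow> bool" where
  "cond_A4 lo hi X Y T U A \<longleftrightarrow>
     (\<forall>\<alpha>' \<alpha>. lo \<le> \<alpha>' \<and> \<alpha>' < \<alpha> \<and> \<alpha> \<le> hi \<longrightarrow>
        (\<forall>t\<in>{0..<T}. bounded_linear_btw (X \<alpha>') (Y \<alpha>) (A t \<alpha>' \<alpha>)) \<and>
        (\<forall>y\<in>pts (X \<alpha>').
           continuous_map (top_of_set {0..<T}) (ntop (Y \<alpha>)) (\<lambda>t. A t \<alpha>' \<alpha> y))) \<and>
     (\<forall>\<alpha>' \<alpha> \<alpha>''. lo \<le> \<alpha>' \<and> \<alpha>' < \<alpha> \<and> \<alpha> < \<alpha>'' \<and> \<alpha>'' \<le> hi \<longrightarrow>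
        (\<forall>t\<in>{0..<T}. \<forall>y\<in>pts (X \<alpha>').
           A t \<alpha>' \<alpha>'' y = A t \<alpha>' \<alpha> y \<and> A t \<alpha>' \<alpha> y = A t \<alpha> \<alpha>'' y)) \<and>
     (\<forall>(t, s)\<in>time_triangle T. bounded_linear_op_in_scale lo hi Y (U t s)) \<and>
     (\<forall>\<alpha>' \<alpha>. lo \<le> \<alpha>' \<and> \<alpha>' < \<alpha> \<and> \<alpha> \<le> hi \<longrightarrow>
        (\<forall>y\<in>pts (Y \<alpha>').
           continuous_map (top_of_set (time_triangle T)) (ntop (Y \<alpha>)) (\<lambda>(t, s). U t s \<alpha>' \<alpha> y))) \<and>
     (\<forall>\<alpha>' \<delta> \<alpha>. lo \<le> \<alpha>' \<and> \<alpha>' < \<delta> \<and> \<delta> < \<alpha> \<and> \<alpha> \<le> hi \<longrightarrow>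
        (\<forall>y\<in>pts (X \<alpha>'). \<forall>(t, s)\<in>time_triangle T.
           has_deriv_in (Y \<alpha>) (\<lambda>t. U t s \<alpha>' \<alpha> y) (A t \<delta> \<alpha> (U t s \<alpha>' \<delta> y)) t {s..<T} \<and>
           has_deriv_in (Y \<alpha>) (\<lambda>s. U t s \<alpha>' \<alpha> y) (- U t s \<delta> \<alpha> (A s \<alpha>' \<delta> y)) s {0..t}))"

text \<open>Note the argument order: the time comes first, \<open>B t \<alpha>' \<alpha> u\<close> is \<open>B(u,t)\<close>.\<close>

definition cond_B1 ::
    "real \<Rightarrow> real \<Rightarrow> (real \<Rightarrow> 'a::real_vector nspace) \<Rightarrow> real \<Rightarrow> 'a \<Rightarrow> ereal \<Rightarrow>
     (real \<Rightarrow> real \<Rightarrow> real \<Rightarrow> 'a \<Rightarrow> 'a) \<Rightarrow> bool" where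
  "cond_B1 lo hi X T x r B \<longleftrightarrow>
     0 < r \<and>
     (\<forall>t\<in>{0..<T}. nonlinear_op_in_scale lo hi X r x (B t)) \<and>
     (\<forall>\<alpha>' \<alpha>. lo \<le> \<alpha>' \<and> \<alpha>' < \<alpha> \<and> \<alpha> \<le> hi \<longrightarrow>
        continuous_map
          (prod_topology (subtopology (ntop (X \<alpha>')) (nball (X \<alpha>') x r)) (top_of_set {0..<T}))
          (ntop (X \<alpha>)) (\<lambda>(u, t). B t \<alpha>' \<alpha> u))"

definition cond_B2 ::
    "real \<Rightarrow> real \<Rightarrow> (real \<Rightarrow> 'a::real_vector nspace) \<Rightarrow> real \<Rightarrow> 'a \<Rightarrow> ereal \<Rightarrow>
     (real \<Rightarrow> real \<Rightarrow> real \<Rightarrow> 'a \<Rightarrow> 'a) \<Rightarrow> real \<Rightarrow> bool" where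
  "cond_B2 lo hi X T x r B \<beta> \<longleftrightarrow>
     (\<exists>C\<^sub>2>0. \<forall>\<alpha>' \<alpha>. lo \<le> \<alpha>' \<and> \<alpha>' < \<alpha> \<and> \<alpha> \<le> hi \<longrightarrow>
        (\<forall>t\<in>{0..<T}. \<forall>u\<in>nball (X \<alpha>') x r. \<forall>v\<in>nball (X \<alpha>') x r.
           nrm (X \<alpha>) (B t \<alpha>' \<alpha> u - B t \<alpha>' \<alpha> v)
             \<le> C\<^sub>2 / (\<alpha> - \<alpha>') powr (1 - \<beta>) * nrm (X \<alpha>') (u - v)))"

definition cond_B3 ::
    "real \<Rightarrow> real \<Rightarrow> (real \<Rightarrow> 'a::real_vector nspace) \<Rightarrow> real \<Rightarrow> 'a \<Rightarrow>
     (real \<Rightarrow> real \<Rightarrow> real \<Rightarrow> 'a \<Rightarrow> 'a) \<Rightarrow> bool" where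
  "cond_B3 lo hi X T x B \<longleftrightarrow>
     (\<exists>C\<^sub>3>0. \<forall>t\<in>{0..<T}. \<forall>\<alpha>. lo < \<alpha> \<and> \<alpha> \<le> hi \<longrightarrow>
        nrm (X \<alpha>) (B t lo \<alpha> x) \<le> C\<^sub>3 / (\<alpha> - lo))"


section \<open>The two notions of solution\<close>

definition lifetime :: "real \<Rightarrow> real \<Rightarrow> real \<Rightarrow> real" where
  "lifetime \<alpha>\<^sub>0 lam \<alpha> = (\<alpha> - \<alpha>\<^sub>0) / lam"

definition is_integral_solution ::
    "real \<Rightarrow> real \<Rightarrow> (real \<Rightarrow> 'a::real_vector nspace) \<Rightarrow> 'a \<Rightarrow> ereal \<Rightarrow>
     (real \<Rightarrow> real \<Rightarrow> real \<Rightarrow> real \<Rightarrow> 'a \<Rightarrow> 'a) \<Rightarrow> (real \<Rightarrow> real \<Rightarrow> real \<Rightarrow> 'a \<Rightarrow> 'a) \<Rightarrow>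
     real \<Rightarrow> real \<Rightarrow> (real \<Rightarrow> 'a) \<Rightarrow> bool" where
  "is_integral_solution lo hi X x r U B \<alpha>\<^sub>0 lam u \<longleftrightarrow>
     (\<forall>\<alpha>. \<alpha>\<^sub>0 < \<alpha> \<and> \<alpha> \<le> hi \<longrightarrow>
        continuous_map (top_of_set {0..<lifetime \<alpha>\<^sub>0 lam \<alpha>}) (ntop (X \<alpha>)) u \<and>
        (\<forall>t\<in>{0..<lifetime \<alpha>\<^sub>0 lam \<alpha>}.
           u t \<in> nball (X \<alpha>) x r \<and>
           (\<exists>\<alpha>' \<alpha>'' I. \<alpha>\<^sub>0 \<le> \<alpha>' \<and> \<alpha>' < \<alpha>'' \<and> \<alpha>'' < \<alpha> \<and> t < lifetime \<alpha>\<^sub>0 lam \<alpha>' \<and>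
              has_integral_in (X \<alpha>) (\<lambda>s. U t s \<alpha>'' \<alpha> (B s \<alpha>' \<alpha>'' (u s))) I 0 t \<and>
              u t = U t 0 lo \<alpha> x + I)))"

definition is_classical_solution ::
    "real \<Rightarrow> (real \<Rightarrow> 'a::real_vector nspace) \<Rightarrow> (real \<Rightarrow> 'a nspace) \<Rightarrow> 'a \<Rightarrow> ereal \<Rightarrow>
     (real \<Rightarrow> real \<Rightarrow> real \<Rightarrow> 'a \<Rightarrow> 'a) \<Rightarrow> (real \<Rightarrow> real \<Rightarrow> real \<Rightarrow> 'a \<Rightarrow> 'a) \<Rightarrow>
     real \<Rightarrow> real \<Rightarrow> (real \<Rightarrow> 'a) \<Rightarrow> bool" where
  "is_classical_solution hi X Y x r A B \<alpha>\<^sub>0 lam u \<longleftrightarrow>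
     (\<forall>\<alpha>. \<alpha>\<^sub>0 < \<alpha> \<and> \<alpha> \<le> hi \<longrightarrow>
        continuous_map (top_of_set {0..<lifetime \<alpha>\<^sub>0 lam \<alpha>}) (ntop (X \<alpha>)) u \<and>
        (\<forall>t\<in>{0..<lifetime \<alpha>\<^sub>0 lam \<alpha>}. u t \<in> nball (X \<alpha>) x r) \<and>
        u 0 = x \<and>
        (\<exists>u'. continuous_map (top_of_set {0..<lifetime \<alpha>\<^sub>0 lam \<alpha>}) (ntop (Y \<alpha>)) u' \<and>
              (\<forall>t\<in>{0..<lifetime \<alpha>\<^sub>0 lam \<alpha>}.
                 has_deriv_in (Y \<alpha>) u (u' t) t {0..<lifetime \<alpha>\<^sub>0 lam \<alpha>} \<and>
                 (\<exists>\<alpha>'. \<alpha>\<^sub>0 \<le> \<alpha>' \<and> \<alpha>' < \<alpha> \<and> t < lifetime \<alpha>\<^sub>0 lam \<alpha>' \<and>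
                    u' t = A t \<alpha>' \<alpha> (u t) + B t \<alpha>' \<alpha> (u t)))))"

end

theory Submission
  imports Defs
begin

text \<open>
  Everything rests on Duhamel's formula. For a classical solution, \<open>s \<mapsto> U(t,s) u(s)\<close> has
  the derivative \<open>U(t,s) B(u(s),s)\<close> in the larger scale, because the two terms with
  \<open>A\<close> cancel; integrating over \<open>[0,t]\<close> gives the integral equation. Conversely, an
  integral solution satisfies
  \<open>u(\<tau>) = U(\<tau>,\<sigma>) u(\<sigma>) + \<integral>\<^sub>\<sigma>\<^sup>\<tau> U(\<tau>,s) B(u(s),s) ds\<close>, so for
  \<open>\<sigma> \<le> t \<le> \<tau>\<close> the difference \<open>u(\<tau>) - u(\<sigma>)\<close> is the
  integral over \<open>[\<sigma>,\<tau>]\<close> of \<open>A(q) U(q,\<sigma>) u(\<sigma>)\<close> and of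
  \<open>U(\<tau>,s) B(u(s),s)\<close>. Both integrands are jointly continuous by the uniform boundedness
  principle, so that the difference quotient tends to \<open>A(t) u(t) + B(u(t),t)\<close>. Taking
  \<open>\<sigma> \<le> t \<le> \<tau>\<close> treats both one-sided derivatives with the derivative of
  \<open>U\<close> in its first argument alone; its derivative in the second argument would lead to
  \<open>U(t,t) A(t) u(t)\<close>, and \<open>U(t,t)\<close> is known to be the identity on the smaller
  scale only.
\<close>

section \<open>Calculus in a normed subspace\<close>

text \<open>Two norms are in play. The differential equation lives in the larger scale, whereas the
  integral has to converge in the norm of the smaller one. The gap is closed by a primitive of the
  integrand that exists in the smaller space by completeness. It remains a primitive in the larger
  space, where integrals are unique, and so it identifies the integral computed there.

  Every operator raises the index. A step that applies several operators therefore starts from an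
  index strictly below the final one whose lifetime still exceeds the time in question, and inserts
  intermediate indices; the strict inequality between time and lifetime always leaves this room.

  Each space is a subset of one vector space with a norm of its own, so limits, continuity and
  derivatives are first brought into epsilon-delta form relative to a carrier. Increments are
  estimated through Riemann sums, which yield both the fundamental theorem and the mean value
  inequality without linear functionals.\<close>

definition ncont :: "'a::real_vector nspace \<Rightarrow> 'k::metric_space set \<Rightarrow> ('k \<Rightarrow> 'a) \<Rightarrow> bool" where
  "ncont X S f \<longleftrightarrow> (\<forall>s\<in>S. f s \<in> pts X \<and>
     (\<forall>e>0. \<exists>d>0. \<forall>q\<in>S. dist q s < d \<longrightarrow> nrm X (f q - f s) < e))"

lemma atin_within_euclidean: "atin_within euclidean x S = at x within S"
  unfolding filter_eq_iff eventually_atin_within eventually_at_topological by auto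

lemma ncont_pts: "ncont X S f \<Longrightarrow> s \<in> S \<Longrightarrow> f s \<in> pts X"
  by (simp add: ncont_def)

lemma ncontE:
  assumes "ncont X S f" "s \<in> S" "0 < e"
  obtains d where "0 < d" "\<And>q. q \<in> S \<Longrightarrow> dist q s < d \<Longrightarrow> nrm X (f q - f s) < e"
  using assms unfolding ncont_def by meson

lemma ncont_subset: "ncont X S f \<Longrightarrow> R \<subseteq> S \<Longrightarrow> ncont X R f"
  unfolding ncont_def by (meson subsetD)

lemma ncont_cong: "(\<And>s. s \<in> S \<Longrightarrow> f s = g s) \<Longrightarrow> ncont X S f \<longleftrightarrow> ncont X S g"
  unfolding ncont_def by simp

lemma ncont_larger:
  assumes "ncont X S f" "pts X \<subseteq> pts Y" "\<And>y. y \<in> pts X \<Longrightarrow> nrm Y y \<le> nrm X y" "normed_subspace X"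
  shows "ncont Y S f"
  unfolding ncont_def
proof (intro ballI conjI allI impI)
  fix s assume s: "s \<in> S"
  then show "f s \<in> pts Y" using assms by (auto simp: ncont_def)
  fix e :: real assume "0 < e"
  then obtain d where "0 < d" and d: "\<And>q. q \<in> S \<Longrightarrow> dist q s < d \<Longrightarrow> nrm X (f q - f s) < e"
    by (rule ncontE[OF assms(1) s]) (rule that; blast)
  have "nrm Y (f q - f s) \<le> nrm X (f q - f s)" if "q \<in> S" for q
    using assms(1,4) s that
    by (intro assms(3)) (auto simp: normed_subspace_def ncont_pts intro!: subspace_diff)
  then show "\<exists>d>0. \<forall>q\<in>S. dist q s < d \<longrightarrow> nrm Y (f q - f s) < e"
    using \<open>0 < d\<close> d by (meson le_less_trans)
qed

text \<open>The values of \<open>F\<close> carry no norm here. The increment of \<open>F\<close>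
  over an interval is additive when the interval is cut, and for such interval functions summation
  over a division is purely algebraic.\<close>

lemma tagged_division_telescope:
  fixes F :: "real \<Rightarrow> 'b::real_vector"
  assumes "a \<le> b" and "p tagged_division_of {a..b}"
  shows "(\<Sum>(s,K)\<in>p. F (Sup K) - F (Inf K)) = F b - F a"
proof -
  let ?f = "(\<lambda>K::real set. if K = {} then 0 else F (interval_upperbound K) - F (interval_lowerbound K))"
  interpret operative_real plus 0 ?f
    rewrites "comm_monoid_set.F (+) 0 = sum"
    by standard[1] (auto simp add: sum_def)
  have p_td: "p tagged_division_of cbox a b"
    using assms(2) box_real(2) by presburger
  have "cbox a b \<noteq> {}"
    using assms(1) by auto
  then have "F b - F a = (\<Sum>(x, l)\<in>p. if l = {} then 0 else F (interval_upperbound l) - F (interval_lowerbound l))"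
    using p_td assms(2) tagged_division by force
  then show ?thesis
    using assms by (auto intro!: sum.cong)
qed

text \<open>Splits the error of a Riemann sum into local errors, one for each piece and seen from
  its tag, which is what differentiability at the tag controls.\<close>

lemma tagged_sum_diff:
  fixes f F :: "real \<Rightarrow> 'b::real_vector"
  assumes p: "p tagged_division_of {a..b}" and "a \<le> b"
  shows "(\<Sum>(s,K)\<in>p. measure lborel K *\<^sub>R f s) - (F b - F a) =
    (\<Sum>(s,K)\<in>p. (Sup K - Inf K) *\<^sub>R f s - (F (Sup K) - F (Inf K)))"
proof -
  have "measure lborel K = Sup K - Inf K" if sK: "(s, K) \<in> p" for s K
  proof -
    obtain u v where "K = cbox u v" using tagged_division_ofD(4)[OF p sK] by blast
    moreover have "s \<in> K" using tagged_division_ofD(2)[OF p sK] .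
    ultimately show ?thesis by auto
  qed
  then have "(\<Sum>(s,K)\<in>p. measure lborel K *\<^sub>R f s) = (\<Sum>(s,K)\<in>p. (Sup K - Inf K) *\<^sub>R f s)"
    by (intro sum.cong refl) auto
  then show ?thesis
    using tagged_division_telescope[OF assms(2) p, of F]
    by (simp add: sum_subtractf split_def)
qed

section \<open>Norm estimates, continuity and differentiation in one normed space\<close>

locale normed_nspace =
  fixes X :: "'a::real_vector nspace"
  assumes normed: "normed_subspace X"
begin

lemma sub: "subspace (pts X)"
  using normed by (simp add: normed_subspace_def)

lemmas closed_simps = subspace_0[OF sub] subspace_add[OF sub] subspace_diff[OF sub]
  subspace_scale[OF sub] subspace_neg[OF sub] subspace_sum[OF sub]

lemma nrm_nonneg: "y \<in> pts X \<Longrightarrow> 0 \<le> nrm X y"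
  using normed by (simp add: normed_subspace_def)

lemma nrm_eq_0: "y \<in> pts X \<Longrightarrow> nrm X y = 0 \<longleftrightarrow> y = 0"
  using normed by (simp add: normed_subspace_def)

lemma nrm_0 [simp]: "nrm X 0 = 0"
  using nrm_eq_0 closed_simps(1) by blast

lemma nrm_scale: "y \<in> pts X \<Longrightarrow> nrm X (c *\<^sub>R y) = \<bar>c\<bar> * nrm X y"
  using normed by (simp add: normed_subspace_def)

lemma nrm_add: "y \<in> pts X \<Longrightarrow> z \<in> pts X \<Longrightarrow> nrm X (y + z) \<le> nrm X y + nrm X z"
  using normed by (simp add: normed_subspace_def)

lemma nrm_minus: "y \<in> pts X \<Longrightarrow> nrm X (- y) = nrm X y"
  using nrm_scale[of y "-1"] by simp

lemma nrm_diff: "y \<in> pts X \<Longrightarrow> z \<in> pts X \<Longrightarrow> nrm X (y - z) \<le> nrm X y + nrm X z"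
  using nrm_add[of y "- z"] by (simp add: nrm_minus closed_simps)

lemma nrm_commute: "y \<in> pts X \<Longrightarrow> z \<in> pts X \<Longrightarrow> nrm X (y - z) = nrm X (z - y)"
  using nrm_minus[of "y - z"] by (simp add: closed_simps)

lemma nrm_triangle:
  assumes "y \<in> pts X" "z \<in> pts X" "w \<in> pts X"
  shows "nrm X (y - w) \<le> nrm X (y - z) + nrm X (z - w)"
  using nrm_add[of "y - z" "z - w"] assms by (simp add: closed_simps)

lemma nrm_abs_diff:
  assumes "y \<in> pts X" "z \<in> pts X"
  shows "\<bar>nrm X y - nrm X z\<bar> \<le> nrm X (y - z)"
  using nrm_triangle[of y z 0] nrm_triangle[of z y 0] nrm_commute[of y z] assms
  by (simp add: closed_simps)

lemma nrm_sum:
  assumes "\<And>i. i \<in> I \<Longrightarrow> f i \<in> pts X"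
  shows "nrm X (sum f I) \<le> (\<Sum>i\<in>I. nrm X (f i))"
proof (cases "finite I")
  case True
  then show ?thesis using assms
  proof induction
    case (insert i I)
    have "nrm X (f i + sum f I) \<le> nrm X (f i) + nrm X (sum f I)"
      by (intro nrm_add) (use insert.prems in \<open>auto intro!: closed_simps\<close>)
    with insert show ?case by fastforce
  qed simp
qed simp

lemma limitin_ntop:
  "limitin (ntop X) f l F \<longleftrightarrow>
     l \<in> pts X \<and> (\<forall>e>0. eventually (\<lambda>s. f s \<in> pts X \<and> nrm X (f s - l) < e) F)"
proof -
  interpret Metric_space "pts X" "ndist X"
    using normed by (rule Metric_space_ndist)
  show ?thesis
    unfolding ntop_def limitin_metric
  proof (rule conj_cong[OF refl])
    assume "l \<in> pts X"
    then have "(f s \<in> pts X \<and> ndist X (f s) l < e) = (f s \<in> pts X \<and> nrm X (f s - l) < e)" for s e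
      by (auto simp: ndist_def)
    then show "(\<forall>e>0. \<forall>\<^sub>F s in F. f s \<in> pts X \<and> ndist X (f s) l < e) \<longleftrightarrow>
        (\<forall>e>0. \<forall>\<^sub>F s in F. f s \<in> pts X \<and> nrm X (f s - l) < e)"
      by simp
  qed
qed

lemma limitin_ntop_unique:
  "limitin (ntop X) f l F \<Longrightarrow> limitin (ntop X) f m F \<Longrightarrow> F \<noteq> bot \<Longrightarrow> l = m"
  unfolding ntop_def
  using Metric_space.limitin_metric_unique[OF Metric_space_ndist[OF normed]] by blast

lemma continuous_map_ntop:
  "continuous_map (top_of_set S) (ntop X) f \<longleftrightarrow> ncont X S f" (is "?l \<longleftrightarrow> ?r")
proof -
  have "?l \<longleftrightarrow> (\<forall>s\<in>S. limitin (ntop X) f (f s) (at s within S))"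
    unfolding continuous_map_atin
    by (simp add: atin_subtopology_within atin_within_euclidean)
  also have "\<dots> \<longleftrightarrow> ?r"
  proof
    assume l: "\<forall>s\<in>S. limitin (ntop X) f (f s) (at s within S)"
    show ?r
      unfolding ncont_def
    proof (intro ballI conjI allI impI)
      fix s assume s: "s \<in> S"
      then show "f s \<in> pts X" using l limitin_ntop by blast
      fix e :: real assume "0 < e"
      then have "\<forall>\<^sub>F q in at s within S. nrm X (f q - f s) < e"
        using l s by (auto simp: limitin_ntop elim!: eventually_mono)
      then obtain d where "0 < d" "\<forall>q\<in>S. q \<noteq> s \<and> dist q s < d \<longrightarrow> nrm X (f q - f s) < e"
        by (auto simp: eventually_at)
      then show "\<exists>d>0. \<forall>q\<in>S. dist q s < d \<longrightarrow> nrm X (f q - f s) < e"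
        using \<open>0 < e\<close> by (intro exI[of _ d]) (metis diff_self nrm_0)
    qed
  next
    assume r: ?r
    show "\<forall>s\<in>S. limitin (ntop X) f (f s) (at s within S)"
      unfolding limitin_ntop eventually_at
    proof (intro ballI conjI allI impI)
      fix s assume s: "s \<in> S"
      then show "f s \<in> pts X" using r by (simp add: ncont_def)
      fix e :: real assume "0 < e"
      with r s show "\<exists>d>0. \<forall>q\<in>S. q \<noteq> s \<and> dist q s < d \<longrightarrow> f q \<in> pts X \<and> nrm X (f q - f s) < e"
        unfolding ncont_def by meson
    qed
  qed
  finally show ?thesis .
qed

lemma ncont_diff:
  assumes "ncont X S f" "ncont X S g"
  shows "ncont X S (\<lambda>s. f s - g s)"
  unfolding ncont_def
proof (intro ballI conjI allI impI)
  fix s assume s: "s \<in> S"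
  note pts = ncont_pts[OF assms(1)] ncont_pts[OF assms(2)]
  show "f s - g s \<in> pts X" using pts s by (simp add: closed_simps)
  fix e :: real assume "0 < e"
  then have e: "0 < e/2" by simp
  obtain d1 where d1: "0 < d1" "\<And>q. q \<in> S \<Longrightarrow> dist q s < d1 \<Longrightarrow> nrm X (f q - f s) < e/2"
    by (rule ncontE[OF assms(1) s e]) (rule that; blast)
  obtain d2 where d2: "0 < d2" "\<And>q. q \<in> S \<Longrightarrow> dist q s < d2 \<Longrightarrow> nrm X (g q - g s) < e/2"
    by (rule ncontE[OF assms(2) s e]) (rule that; blast)
  have "nrm X ((f q - g q) - (f s - g s)) < e" if "q \<in> S" "dist q s < min d1 d2" for q
  proof -
    have "nrm X ((f q - f s) - (g q - g s)) \<le> nrm X (f q - f s) + nrm X (g q - g s)"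
      using pts s that by (intro nrm_diff) (simp_all add: closed_simps)
    also have "\<dots> < e" using d1(2)[of q] d2(2)[of q] that by simp
    finally show ?thesis by (simp add: algebra_simps)
  qed
  then show "\<exists>d>0. \<forall>q\<in>S. dist q s < d \<longrightarrow> nrm X ((f q - g q) - (f s - g s)) < e"
    using d1(1) d2(1) by (intro exI[of _ "min d1 d2"]) simp
qed

lemma ncont_minus:
  assumes "ncont X S f"
  shows "ncont X S (\<lambda>s. - f s)"
proof -
  have "ncont X S (\<lambda>_. 0)"
    by (auto simp: ncont_def closed_simps intro: exI[of _ 1])
  from ncont_diff[OF this assms] show ?thesis by simp
qed

lemma ncont_add:
  assumes "ncont X S f" "ncont X S g"
  shows "ncont X S (\<lambda>s. f s + g s)"
  using ncont_diff[OF assms(1) ncont_minus[OF assms(2)]] by simp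

lemma continuous_on_nrm:
  assumes "ncont X S f"
  shows "continuous_on S (\<lambda>s. nrm X (f s))"
  unfolding continuous_on_iff
proof (intro ballI allI impI)
  fix s and e :: real assume s: "s \<in> S" and "0 < e"
  then obtain d where "0 < d" and d: "\<And>q. q \<in> S \<Longrightarrow> dist q s < d \<Longrightarrow> nrm X (f q - f s) < e"
    by (rule ncontE[OF assms]) (rule that; blast)
  have "dist (nrm X (f q)) (nrm X (f s)) < e" if "q \<in> S" "dist q s < d" for q
    using nrm_abs_diff[of "f q" "f s"] d[OF that] that s ncont_pts[OF assms] by (simp add: dist_real_def)
  then show "\<exists>d>0. \<forall>q\<in>S. dist q s < d \<longrightarrow> dist (nrm X (f q)) (nrm X (f s)) < e"
    using \<open>0 < d\<close> by blast
qed

lemma ncont_compose: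
  assumes "ncont X S f" "continuous_on R g" "g ` R \<subseteq> S"
  shows "ncont X R (\<lambda>s. f (g s))"
proof -
  have "continuous_map (top_of_set R) (top_of_set S) g"
    using assms by auto
  then show ?thesis
    using assms(1) continuous_map_compose[of "top_of_set R" "top_of_set S" g "ntop X" f]
    by (simp add: continuous_map_ntop[symmetric] o_def)
qed

text \<open>Heine-Cantor is applied to the real function \<open>?g\<close> on the compact square. It
  vanishes on the diagonal, and the points (s, q) and (s, s) are exactly as far apart as s and
  q.\<close>

lemma ncont_uniform:
  fixes f :: "'k::metric_space \<Rightarrow> 'a"
  assumes f: "ncont X S f" and S: "compact S" and e: "0 < e"
  obtains d where "0 < d" "\<And>s q. s \<in> S \<Longrightarrow> q \<in> S \<Longrightarrow> dist s q < d \<Longrightarrow> nrm X (f s - f q) < e"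
proof -
  let ?g = "\<lambda>p. nrm X (f (fst p) - f (snd p))"
  have "ncont X (S \<times> S) (\<lambda>p. f (fst p))" "ncont X (S \<times> S) (\<lambda>p. f (snd p))"
    by (intro ncont_compose[OF f] continuous_intros; auto)+
  then have "continuous_on (S \<times> S) ?g"
    by (intro continuous_on_nrm ncont_diff)
  then have "uniformly_continuous_on (S \<times> S) ?g"
    by (intro compact_uniformly_continuous compact_Times S)
  then obtain d where "0 < d" and
    d: "\<And>p p'. p \<in> S \<times> S \<Longrightarrow> p' \<in> S \<times> S \<Longrightarrow> dist p' p < d \<Longrightarrow> dist (?g p') (?g p) < e"
    using e unfolding uniformly_continuous_on_def by meson
  have "nrm X (f s - f q) < e" if "s \<in> S" "q \<in> S" "dist s q < d" for s q
  proof -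
    have "dist (s, q) (s, s) < d" using that by (simp add: dist_Pair_Pair dist_commute)
    then have "dist (?g (s, q)) (?g (s, s)) < e" using that by (intro d) auto
    then show ?thesis by (simp add: dist_real_def)
  qed
  with \<open>0 < d\<close> that show ?thesis by blast
qed

text \<open>The remainder estimate also makes sense at s = t and can be added and split without
  dividing. Only differences of \<open>f\<close> have to lie in the carrier; \<open>f\<close> itself
  may leave it.\<close>

lemma has_deriv_in_iff:
  "has_deriv_in X f d t S \<longleftrightarrow> d \<in> pts X \<and>
     (\<forall>e>0. \<exists>\<delta>>0. \<forall>s\<in>S. \<bar>s - t\<bar> < \<delta> \<longrightarrow>
        f s - f t \<in> pts X \<and> nrm X (f s - f t - (s - t) *\<^sub>R d) \<le> e * \<bar>s - t\<bar>)"
  (is "?l \<longleftrightarrow> _ \<and> ?r")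
proof (cases "d \<in> pts X")
  case d: True
  have in_iff: "(f s - f t) /\<^sub>R (s - t) \<in> pts X \<longleftrightarrow> f s - f t \<in> pts X" if "s \<noteq> t" for s
  proof
    assume "(f s - f t) /\<^sub>R (s - t) \<in> pts X"
    then have "(s - t) *\<^sub>R ((f s - f t) /\<^sub>R (s - t)) \<in> pts X" by (rule closed_simps)
    then show "f s - f t \<in> pts X" using that by simp
  qed (simp add: closed_simps)
  have nrm_eq: "nrm X (f s - f t - (s - t) *\<^sub>R d) = \<bar>s - t\<bar> * nrm X ((f s - f t) /\<^sub>R (s - t) - d)"
    if "s \<noteq> t" "f s - f t \<in> pts X" for s
  proof -
    have "f s - f t - (s - t) *\<^sub>R d = (s - t) *\<^sub>R ((f s - f t) /\<^sub>R (s - t) - d)"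
      using that by (simp add: scaleR_diff_right)
    then show ?thesis using that d by (simp only:) (rule nrm_scale, simp add: closed_simps)
  qed
  have "?l \<longleftrightarrow> ?r"
  proof
    assume l: ?l
    show ?r
    proof (intro allI impI)
      fix e :: real assume "0 < e"
      then have "\<forall>\<^sub>F s in at t within S.
         (f s - f t) /\<^sub>R (s - t) \<in> pts X \<and> nrm X ((f s - f t) /\<^sub>R (s - t) - d) < e"
        using l by (simp add: has_deriv_in_def limitin_ntop)
      then obtain \<delta> where "0 < \<delta>" and \<delta>: "\<And>s. s \<in> S \<Longrightarrow> s \<noteq> t \<Longrightarrow> dist s t < \<delta> \<Longrightarrow>
         (f s - f t) /\<^sub>R (s - t) \<in> pts X \<and> nrm X ((f s - f t) /\<^sub>R (s - t) - d) < e"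
        unfolding eventually_at by blast
      have "f s - f t \<in> pts X \<and> nrm X (f s - f t - (s - t) *\<^sub>R d) \<le> e * \<bar>s - t\<bar>"
        if "s \<in> S" "\<bar>s - t\<bar> < \<delta>" for s
      proof (cases "s = t")
        case False
        then show ?thesis
          using \<delta>[of s] that nrm_eq[of s] in_iff[of s]
          by (auto simp: dist_real_def mult.commute intro: mult_right_mono)
      qed (simp add: closed_simps)
      with \<open>0 < \<delta>\<close> show "\<exists>\<delta>>0. \<forall>s\<in>S. \<bar>s - t\<bar> < \<delta> \<longrightarrow>
        f s - f t \<in> pts X \<and> nrm X (f s - f t - (s - t) *\<^sub>R d) \<le> e * \<bar>s - t\<bar>" by blast
    qed
  next
    assume r: ?r
    show ?l
      unfolding has_deriv_in_def limitin_ntop eventually_at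
    proof (intro conjI d allI impI)
      fix e :: real assume "0 < e"
      \<comment> \<open>Halving \<open>e\<close> pays for the passage from a nonstrict remainder
        estimate to a strict inequality.\<close>
      then have "0 < e/2" by simp
      with r obtain \<delta> where "0 < \<delta>" and \<delta>: "\<forall>s\<in>S. \<bar>s - t\<bar> < \<delta> \<longrightarrow>
        f s - f t \<in> pts X \<and> nrm X (f s - f t - (s - t) *\<^sub>R d) \<le> e/2 * \<bar>s - t\<bar>" by meson
      have "(f s - f t) /\<^sub>R (s - t) \<in> pts X \<and> nrm X ((f s - f t) /\<^sub>R (s - t) - d) < e"
        if "s \<in> S" "s \<noteq> t \<and> dist s t < \<delta>" for s
      proof -
        have 1: "f s - f t \<in> pts X" "nrm X (f s - f t - (s - t) *\<^sub>R d) \<le> e/2 * \<bar>s - t\<bar>"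
          using \<delta> that by (auto simp: dist_real_def)
        then have "nrm X ((f s - f t) /\<^sub>R (s - t) - d) \<le> e/2"
          using nrm_eq[of s] that by (simp add: mult.commute)
        then show ?thesis using 1 in_iff[of s] that \<open>0 < e\<close> by auto
      qed
      with \<open>0 < \<delta>\<close> show "\<exists>\<delta>>0. \<forall>s\<in>S. s \<noteq> t \<and> dist s t < \<delta> \<longrightarrow>
          (f s - f t) /\<^sub>R (s - t) \<in> pts X \<and> nrm X ((f s - f t) /\<^sub>R (s - t) - d) < e"
        by blast
    qed
  qed
  then show ?thesis using d by simp
qed (auto simp: has_deriv_in_def limitin_ntop)

lemma has_deriv_inE:
  assumes "has_deriv_in X f d t S" "0 < e"
  obtains \<delta> where "0 < \<delta>" "\<And>s. s \<in> S \<Longrightarrow> \<bar>s - t\<bar> < \<delta> \<Longrightarrow> f s - f t \<in> pts X"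
    "\<And>s. s \<in> S \<Longrightarrow> \<bar>s - t\<bar> < \<delta> \<Longrightarrow> nrm X (f s - f t - (s - t) *\<^sub>R d) \<le> e * \<bar>s - t\<bar>"
  using assms unfolding has_deriv_in_iff by meson

lemma has_deriv_in_pts: "has_deriv_in X f d t S \<Longrightarrow> d \<in> pts X"
  by (simp add: has_deriv_in_iff)

lemma has_deriv_in_subset: "has_deriv_in X f d t S \<Longrightarrow> R \<subseteq> S \<Longrightarrow> has_deriv_in X f d t R"
  unfolding has_deriv_in_iff by (meson subsetD)

lemma has_deriv_in_cong:
  "(\<And>s. s \<in> S \<Longrightarrow> f s = g s) \<Longrightarrow> t \<in> S \<Longrightarrow> has_deriv_in X f d t S \<longleftrightarrow> has_deriv_in X g d t S"
  unfolding has_deriv_in_iff by simp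

lemma has_deriv_in_larger:
  assumes "has_deriv_in X f d t S" "pts X \<subseteq> pts Y" "\<And>y. y \<in> pts X \<Longrightarrow> nrm Y y \<le> nrm X y"
    and "normed_subspace Y"
  shows "has_deriv_in Y f d t S"
proof -
  interpret Y: normed_nspace Y using assms(4) by unfold_locales
  have d: "d \<in> pts X" using has_deriv_in_pts[OF assms(1)] .
  show ?thesis unfolding Y.has_deriv_in_iff
  proof (intro conjI allI impI)
    show "d \<in> pts Y" using d assms by blast
    fix e :: real assume "0 < e"
    then obtain \<delta> where "0 < \<delta>" and
      \<delta>: "\<And>s. s \<in> S \<Longrightarrow> \<bar>s - t\<bar> < \<delta> \<Longrightarrow> f s - f t \<in> pts X"
        "\<And>s. s \<in> S \<Longrightarrow> \<bar>s - t\<bar> < \<delta> \<Longrightarrow> nrm X (f s - f t - (s - t) *\<^sub>R d) \<le> e * \<bar>s - t\<bar>"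
      by (rule has_deriv_inE[OF assms(1)]) (rule that; blast)
    have "nrm Y (f s - f t - (s - t) *\<^sub>R d) \<le> nrm X (f s - f t - (s - t) *\<^sub>R d)"
      if "s \<in> S" "\<bar>s - t\<bar> < \<delta>" for s
      using \<delta>(1) that d by (intro assms(3)) (simp add: closed_simps)
    then show "\<exists>\<delta>>0. \<forall>s\<in>S. \<bar>s - t\<bar> < \<delta> \<longrightarrow>
        f s - f t \<in> pts Y \<and> nrm Y (f s - f t - (s - t) *\<^sub>R d) \<le> e * \<bar>s - t\<bar>"
      using \<open>0 < \<delta>\<close> \<delta> assms(2) by (meson order_trans subsetD)
  qed
qed

text \<open>Differentiability at each tag supplies the gauge: on a fine piece the increment of
  \<open>F\<close> differs from the length times the value of \<open>f\<close> at the tag by at most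
  \<open>e'\<close> times the length. These errors telescope to \<open>e' * (b - a)\<close>.\<close>

lemma fundamental_theorem:
  assumes "a \<le> b" and F: "\<And>s. s \<in> {a..b} \<Longrightarrow> has_deriv_in X F (f s) s {a..b}"
    and Fpts: "\<And>s. s \<in> {a..b} \<Longrightarrow> F s - F a \<in> pts X"
  shows "has_integral_in X f (F b - F a) a b"
  unfolding has_integral_in_def limitin_ntop
proof (intro conjI allI impI)
  show "F b - F a \<in> pts X" using Fpts assms(1) by simp
  fix e :: real assume "0 < e"
  \<comment> \<open>The summand 1 keeps the quotient defined for a = b and makes the total error
    strictly smaller than \<open>e\<close>.\<close>
  define e' where "e' = e / (b - a + 1)"
  have "0 < e'" using \<open>0 < e\<close> assms(1) by (simp add: e'_def)
  have diff_pts: "F s - F q \<in> pts X" if "s \<in> {a..b}" "q \<in> {a..b}" for s q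
    using closed_simps(3)[OF Fpts Fpts, OF that] by simp
  have fpts: "f s \<in> pts X" if "s \<in> {a..b}" for s using F[OF that] by (rule has_deriv_in_pts)
  \<comment> \<open>A gauge must be positive everywhere; with the membership as a premise inside, an
    arbitrary radius serves outside the interval and the choice of \<open>\<delta>\<close> is
    total.\<close>
  have "\<exists>\<delta>>0. s \<in> {a..b} \<longrightarrow> (\<forall>q\<in>{a..b}. \<bar>q - s\<bar> < \<delta> \<longrightarrow>
      nrm X (F q - F s - (q - s) *\<^sub>R f s) \<le> e' * \<bar>q - s\<bar>)" for s
  proof (cases "s \<in> {a..b}")
    case True
    from has_deriv_inE[OF F[OF True] \<open>0 < e'\<close>] show ?thesis by metis
  qed (auto intro: zero_less_one)
  then obtain \<delta> where \<delta>: "\<And>s. 0 < \<delta> s" "\<And>s q. s \<in> {a..b} \<Longrightarrow> q \<in> {a..b} \<Longrightarrow> \<bar>q - s\<bar> < \<delta> s \<Longrightarrow>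
      nrm X (F q - F s - (q - s) *\<^sub>R f s) \<le> e' * \<bar>q - s\<bar>" by metis
  show "\<forall>\<^sub>F p in division_filter (cbox a b). (\<Sum>(s,K)\<in>p. measure lborel K *\<^sub>R f s) \<in> pts X \<and>
      nrm X ((\<Sum>(s,K)\<in>p. measure lborel K *\<^sub>R f s) - (F b - F a)) < e"
    unfolding eventually_division_filter
  proof (intro exI[of _ "\<lambda>s. ball s (\<delta> s)"] conjI allI impI; (elim conjE)?)
    show "gauge (\<lambda>s. ball s (\<delta> s))" using \<delta> by (auto intro: gauge_ball_dependent)
    fix p assume "p tagged_division_of cbox a b" and fine: "(\<lambda>s. ball s (\<delta> s)) fine p"
    then have p: "p tagged_division_of {a..b}" by simp
    have tag: "s \<in> {a..b}" if "(s, K) \<in> p" for s K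
    using tagged_division_ofD(2,3)[OF p that] by blast
    show "(\<Sum>(s,K)\<in>p. measure lborel K *\<^sub>R f s) \<in> pts X"
      by (intro closed_simps) (auto intro!: closed_simps fpts dest: tag)
    have est: "(Sup K - Inf K) *\<^sub>R f s - (F (Sup K) - F (Inf K)) \<in> pts X \<and>
        nrm X ((Sup K - Inf K) *\<^sub>R f s - (F (Sup K) - F (Inf K))) \<le> e' * (Sup K - Inf K)"
      if sK: "(s, K) \<in> p" for s K
    proof -
      obtain u v where K: "K = {u..v}"
        using tagged_division_ofD(4)[OF p sK] by auto
      moreover have s: "s \<in> K" and "K \<subseteq> {a..b}"
        using tagged_division_ofD(2,3)[OF p sK] by blast+
      ultimately have uv: "u \<le> s" "s \<le> v" "u \<in> {a..b}" "v \<in> {a..b}" "s \<in> {a..b}" by auto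
      have "K \<subseteq> ball s (\<delta> s)" using fine sK by blast
      moreover have "u \<in> K" "v \<in> K" using K s by auto
      ultimately have near: "\<bar>u - s\<bar> < \<delta> s" "\<bar>v - s\<bar> < \<delta> s"
        by (auto simp: subset_eq dist_real_def)
      \<comment> \<open>The tag lies between u and v, so the two remainders, both taken from the
        tag, are bounded by multiples of s - u and v - s that add up to v - u.\<close>
      let ?P = "F u - F s - (u - s) *\<^sub>R f s" and ?Q = "F v - F s - (v - s) *\<^sub>R f s"
      have PQ: "?P \<in> pts X" "?Q \<in> pts X"
        using uv fpts by (auto intro!: closed_simps(3)[OF diff_pts closed_simps(4)])
      have eq: "(v - u) *\<^sub>R f s - (F v - F u) = ?P - ?Q"
        by (simp add: algebra_simps)
      have "nrm X (?P - ?Q) \<le> nrm X ?P + nrm X ?Q"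
        using PQ by (rule nrm_diff)
      also have "\<dots> \<le> e' * (s - u) + e' * (v - s)"
        using \<delta>(2)[of s u] \<delta>(2)[of s v] uv near by simp
      finally have "nrm X (?P - ?Q) \<le> e' * (v - u)" by (simp add: algebra_simps)
      moreover have Kuv: "Sup K = v" "Inf K = u" using K uv by auto
      ultimately show ?thesis
        unfolding Kuv eq using closed_simps(3)[OF PQ] by blast
    qed
    have "nrm X ((\<Sum>(s,K)\<in>p. measure lborel K *\<^sub>R f s) - (F b - F a))
        \<le> (\<Sum>i\<in>p. nrm X (case i of (s,K) \<Rightarrow> (Sup K - Inf K) *\<^sub>R f s - (F (Sup K) - F (Inf K))))"
      unfolding tagged_sum_diff[OF p assms(1)] using est by (intro nrm_sum) auto
    also have "\<dots> \<le> (\<Sum>(s,K)\<in>p. e' * (Sup K - Inf K))"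
      using est by (intro sum_mono) auto
    also have "\<dots> = e' * (b - a)"
      using tagged_division_telescope[OF assms(1) p, of "\<lambda>s. s"]
      by (simp add: split_def flip: sum_distrib_left)
    also have "\<dots> < e" using \<open>0 < e\<close> assms(1) by (simp add: e'_def divide_simps)
    finally show "nrm X ((\<Sum>(s,K)\<in>p. measure lborel K *\<^sub>R f s) - (F b - F a)) < e" .
  qed
qed

lemma has_integral_in_unique:
  "has_integral_in X f I a b \<Longrightarrow> has_integral_in X f J a b \<Longrightarrow> I = J"
  unfolding has_integral_in_def
  using limitin_ntop_unique division_filter_not_empty by blast

text \<open>A mean value inequality relative to the fixed slope d. Some Riemann sum is arbitrarily
  close to \<open>F b - F a\<close>, and its weights add up to b - a; subtracting
  \<open>(b - a) *\<^sub>R d\<close> therefore replaces each \<open>f s\<close> in it by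
  \<open>f s - d\<close>.\<close>

lemma has_deriv_in_bound:
  assumes "a \<le> b" and F: "\<And>s. s \<in> {a..b} \<Longrightarrow> has_deriv_in X F (f s) s {a..b}"
    and Fpts: "\<And>s. s \<in> {a..b} \<Longrightarrow> F s - F a \<in> pts X"
    and d: "d \<in> pts X" and bound: "\<And>s. s \<in> {a..b} \<Longrightarrow> nrm X (f s - d) \<le> M"
  shows "nrm X (F b - F a - (b - a) *\<^sub>R d) \<le> M * (b - a)"
proof (rule field_le_epsilon)
  fix e :: real assume "0 < e"
  have fpts: "f s \<in> pts X" if "s \<in> {a..b}" for s using F[OF that] by (rule has_deriv_in_pts)
  from fundamental_theorem[OF assms(1-3)] \<open>0 < e\<close>
  have "\<forall>\<^sub>F p in division_filter (cbox a b). nrm X ((\<Sum>(s,K)\<in>p. measure lborel K *\<^sub>R f s) - (F b - F a)) < e"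
    by (auto simp: has_integral_in_def limitin_ntop elim!: eventually_mono)
  from eventually_happens[OF eventually_conj[OF this eventually_division_filter_tagged_division]]
  obtain p where p: "p tagged_division_of {a..b}"
    and near: "nrm X ((\<Sum>(s,K)\<in>p. measure lborel K *\<^sub>R f s) - (F b - F a)) < e"
    using division_filter_not_empty[of a b] by auto
  let ?S = "\<Sum>(s,K)\<in>p. measure lborel K *\<^sub>R f s"
  have tag: "s \<in> {a..b}" if "(s, K) \<in> p" for s K
    using tagged_division_ofD(2,3)[OF p that] by blast
  have tot: "(\<Sum>(s,K)\<in>p. measure lborel K) = b - a"
    using additive_content_tagged_division[of p a b] p assms(1) by simp
  have Spts: "?S \<in> pts X"
    by (intro closed_simps) (auto intro!: closed_simps fpts dest: tag)
  have "(b - a) *\<^sub>R d = (\<Sum>(s,K)\<in>p. measure lborel K *\<^sub>R d)"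
    unfolding tot[symmetric] by (simp add: scaleR_sum_left split_def)
  then have "?S - (b - a) *\<^sub>R d = (\<Sum>(s,K)\<in>p. measure lborel K *\<^sub>R (f s - d))"
    by (simp add: split_def scaleR_diff_right sum_subtractf)
  also have "nrm X \<dots> \<le> (\<Sum>i\<in>p. nrm X (case i of (s,K) \<Rightarrow> measure lborel K *\<^sub>R (f s - d)))"
    by (intro nrm_sum) (auto intro!: closed_simps fpts d dest: tag)
  also have "\<dots> \<le> (\<Sum>(s,K)\<in>p. measure lborel K * M)"
  proof (intro sum_mono, clarify)
    fix s K assume "(s, K) \<in> p"
    then have "s \<in> {a..b}" by (rule tag)
    then show "nrm X (measure lborel K *\<^sub>R (f s - d)) \<le> measure lborel K * M"
      using bound[of s] fpts[of s] d by (simp add: nrm_scale closed_simps mult_left_mono)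
  qed
  also have "\<dots> = M * (b - a)"
    unfolding tot[symmetric] by (simp add: split_def sum_distrib_left mult.commute)
  finally have "nrm X (?S - (b - a) *\<^sub>R d) \<le> M * (b - a)" .
  moreover have "nrm X (F b - F a - (b - a) *\<^sub>R d) \<le> nrm X (F b - F a - ?S) + nrm X (?S - (b - a) *\<^sub>R d)"
    using Fpts[of b] assms(1) d Spts by (intro nrm_triangle) (auto intro!: closed_simps)
  moreover have "nrm X (F b - F a - ?S) < e"
    using near nrm_commute[of "F b - F a" ?S] Fpts[of b] assms(1) Spts by simp
  ultimately show "nrm X (F b - F a - (b - a) *\<^sub>R d) \<le> M * (b - a) + e" by simp
qed

end

section \<open>Primitives of continuous functions in a Banach space\<close>

locale banach_nspace = normed_nspace +
  assumes complete: "Metric_space.mcomplete (pts X) (ndist X)"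
begin

lemma Cauchy_limit:
  fixes \<sigma> :: "nat \<Rightarrow> 'a"
  assumes pts: "\<And>n. \<sigma> n \<in> pts X"
    and cauchy: "\<And>e. 0 < e \<Longrightarrow> \<exists>N. \<forall>m\<ge>N. \<forall>n\<ge>N. nrm X (\<sigma> m - \<sigma> n) < e"
  shows "\<exists>l\<in>pts X. \<forall>e>0. \<forall>\<^sub>F n in sequentially. nrm X (\<sigma> n - l) < e"
proof -
  interpret Metric_space "pts X" "ndist X"
    using normed by (rule Metric_space_ndist)
  have "MCauchy \<sigma>"
    unfolding MCauchy_def
  proof (intro conjI allI impI)
    fix e :: real assume "0 < e"
    from cauchy[OF this]
    show "\<exists>N. \<forall>m n. N \<le> m \<longrightarrow> N \<le> n \<longrightarrow> ndist X (\<sigma> m) (\<sigma> n) < e"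
      using pts by (simp add: ndist_def)
  qed (use pts in auto)
  then obtain l where "limitin (ntop X) \<sigma> l sequentially"
    using complete unfolding mcomplete_def ntop_def by blast
  then show ?thesis
    unfolding limitin_ntop by (auto elim!: eventually_mono)
qed

text \<open>The interval is cut into equal pieces shorter than \<open>\<delta>\<close>, and the
  bounds, being linear in the length, add up. This is for Euler polygons, which can be compared
  directly only over short intervals.\<close>

lemma local_bound_imp_global:
  assumes "a \<le> b" "0 < \<delta>" and G: "\<And>s. s \<in> {a..b} \<Longrightarrow> G s \<in> pts X"
    and loc: "\<And>p q. a \<le> p \<Longrightarrow> p \<le> q \<Longrightarrow> q \<le> b \<Longrightarrow> q - p < \<delta> \<Longrightarrow> nrm X (G q - G p) \<le> M * (q - p)"
  shows "nrm X (G b - G a) \<le> M * (b - a)"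
proof -
  obtain k :: nat where k: "(b - a) / \<delta> < real k"
    using reals_Archimedean2 by blast
  \<comment> \<open>Holds for a = b as well, because k strictly exceeds a nonnegative
    number.\<close>
  have k0: "0 < real k" using k assms(1,2) by (meson divide_nonneg_pos diff_ge_0_iff_ge le_less_trans)
  define h where "h = (b - a) / real k"
  have h: "0 \<le> h" "h < \<delta>" "h * real k = b - a"
    using k k0 assms(1,2) by (auto simp: h_def field_simps)
  define c where "c i = a + h * real i" for i
  have c: "a \<le> c i" "c (Suc i) \<le> b" "c i \<le> c (Suc i)" "c (Suc i) - c i = h" if "i < k" for i
  proof -
    have "h * real (Suc i) \<le> h * real k" using h that by (intro mult_left_mono) auto
    then show "a \<le> c i" "c (Suc i) \<le> b" "c i \<le> c (Suc i)" "c (Suc i) - c i = h"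
      using h by (auto simp: c_def algebra_simps)
  qed
  have "c 0 = a" "c k = b" using h by (auto simp: c_def)
  then have "G b - G a = (\<Sum>i<k. G (c (Suc i)) - G (c i))"
    by (simp add: sum_lessThan_telescope[of "\<lambda>i. G (c i)"])
  also have "nrm X \<dots> \<le> (\<Sum>i<k. nrm X (G (c (Suc i)) - G (c i)))"
  proof (intro nrm_sum closed_simps(3) G)
    fix i assume "i \<in> {..<k}"
    then show "c (Suc i) \<in> {a..b}" "c i \<in> {a..b}" using c[of i] by auto
  qed
  also have "\<dots> \<le> (\<Sum>i<k. M * h)"
  proof (intro sum_mono)
    fix i assume "i \<in> {..<k}"
    then show "nrm X (G (c (Suc i)) - G (c i)) \<le> M * h"
      using c[of i] loc[of "c i" "c (Suc i)"] h by simp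
  qed
  also have "\<dots> = M * (b - a)" unfolding h(3)[symmetric] by simp
  finally show ?thesis .
qed

text \<open>
  A primitive of \<open>f\<close> is obtained as the limit of the Euler polygons for the equation
  \<open>F' = f\<close>, which have slope \<open>f\<close> of the left node on each subinterval.
\<close>

definition euler_polygon :: "(real \<Rightarrow> 'a) \<Rightarrow> real \<Rightarrow> real \<Rightarrow> nat \<Rightarrow> real \<Rightarrow> 'a" where
  "euler_polygon f a b n s = (let c = (\<lambda>i. a + (b - a) * real i / real n) in
     \<Sum>i<n. (min s (c (Suc i)) - min s (c i)) *\<^sub>R f (c i))"

lemma euler_node:
  assumes "a \<le> b" "i < n"
  shows "a + (b - a) * real i / real n \<in> {a..b}"
proof -
  have "(b - a) * (real i / real n) \<le> (b - a) * 1"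
    using assms by (intro mult_left_mono) auto
  then show ?thesis using assms by simp
qed

lemma euler_polygon_pts:
  assumes "ncont X {a..b} f" "a \<le> b"
  shows "euler_polygon f a b n s \<in> pts X"
  unfolding euler_polygon_def Let_def
  using euler_node[OF assms(2)] ncont_pts[OF assms(1)] by (intro closed_simps(4,6)) auto

lemma euler_polygon_start:
  assumes "a \<le> b"
  shows "euler_polygon f a b n a = 0"
  unfolding euler_polygon_def Let_def
proof (intro sum.neutral ballI)
  fix i
  have "min a (a + (b - a) * real j / real n) = a" for j
    using assms by (simp add: min_def)
  then show "(min a (a + (b - a) * real (Suc i) / real n) - min a (a + (b - a) * real i / real n)) *\<^sub>R
      f (a + (b - a) * real i / real n) = 0" by (simp only: diff_self scaleR_zero_left)
qed

text \<open>A difference of two minima in the polygon is the length of the part of a subinterval to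
  the left of the argument, up to a part outside [a, b]. The increment over [p, q] thus weights the
  node values by the lengths \<open>w i\<close> of the overlaps of the subintervals with [p, q], and
  these weights add up to q - p.\<close>

lemma euler_polygon_increment:
  assumes f: "ncont X {a..b} f" and ord: "a \<le> p" "p \<le> q" "q \<le> b" and n: "0 < n"
    and s: "s \<in> {p..q}"
    and osc: "\<And>\<sigma>. \<sigma> \<in> {a..b} \<Longrightarrow> \<bar>\<sigma> - s\<bar> \<le> q - p + (b - a) / real n \<Longrightarrow> nrm X (f \<sigma> - f s) \<le> e"
  shows "nrm X (euler_polygon f a b n q - euler_polygon f a b n p - (q - p) *\<^sub>R f s) \<le> e * (q - p)"
proof -
  define c where "c i = a + (b - a) * real i / real n" for i
  define w where "w i = (min q (c (Suc i)) - min q (c i)) - (min p (c (Suc i)) - min p (c i))" for i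
  have step: "c (Suc i) = c i + (b - a) / real n" for i
    using n by (simp add: c_def field_simps)
  have step_nonneg: "0 \<le> (b - a) / real n" using ord n by simp
  have mono: "c i \<le> c (Suc i)" for i using step[of i] step_nonneg by simp
  have w0: "0 \<le> w i" for i
    using ord mono[of i] unfolding w_def min_def by auto
  have cn: "c 0 = a" "c n = b" using n by (auto simp: c_def)
  have wsum: "(\<Sum>i<n. w i) = q - p"
  proof -
    have "(\<Sum>i<n. w i) = (min q (c n) - min q (c 0)) - (min p (c n) - min p (c 0))"
      unfolding w_def sum_subtractf
      using sum_lessThan_telescope[of "\<lambda>i. min q (c i)" n] sum_lessThan_telescope[of "\<lambda>i. min p (c i)" n]
      by (simp add: sum_subtractf)
    then show ?thesis using ord cn by (simp add: min_def)
  qed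
  have node: "c i \<in> {a..b}" if "i < n" for i
    using euler_node[of a b i n] that ord by (simp add: c_def)
  have s': "s \<in> {a..b}" using s ord by simp
  have "euler_polygon f a b n q - euler_polygon f a b n p - (q - p) *\<^sub>R f s =
      (\<Sum>i<n. w i *\<^sub>R f (c i)) - (\<Sum>i<n. w i *\<^sub>R f s)"
    unfolding euler_polygon_def Let_def wsum[symmetric] scaleR_sum_left
    by (simp add: w_def c_def sum_subtractf scaleR_diff_left)
  also have "\<dots> = (\<Sum>i<n. w i *\<^sub>R (f (c i) - f s))"
    by (simp add: sum_subtractf scaleR_diff_right)
  also have "nrm X \<dots> \<le> (\<Sum>i<n. nrm X (w i *\<^sub>R (f (c i) - f s)))"
    using node s' ncont_pts[OF f] by (intro nrm_sum closed_simps(3,4)) auto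
  also have "\<dots> \<le> (\<Sum>i<n. e * w i)"
  proof (intro sum_mono)
    fix i assume "i \<in> {..<n}"
    then have i: "i < n" by simp
    have pts: "f (c i) - f s \<in> pts X"
      using node[OF i] s' ncont_pts[OF f] by (intro closed_simps) auto
    show "nrm X (w i *\<^sub>R (f (c i) - f s)) \<le> e * w i"
    proof (cases "w i = 0")
      case False
      \<comment> \<open>Only subintervals that overlap [p, q] contribute. Their left node lies
        before q and at most one step before p, which is the source of the radius in
        \<open>osc\<close>.\<close>
      then have "c i < q" "p < c (Suc i)"
        using ord mono[of i] unfolding w_def min_def by (auto split: if_splits)
      moreover have "p \<le> s" "s \<le> q" using s by auto
      ultimately have "\<bar>c i - s\<bar> \<le> q - p + (b - a) / real n"
        using step[of i] step_nonneg by linarith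
      then have "nrm X (f (c i) - f s) \<le> e" using osc node[OF i] by blast
      then show ?thesis using pts w0[of i] by (simp add: nrm_scale mult.commute[of e] mult_left_mono)
    qed simp
  qed
  also have "\<dots> = e * (q - p)" by (simp add: wsum flip: sum_distrib_left)
  finally show ?thesis .
qed

text \<open>Uniform continuity of \<open>f\<close> gives one estimate, \<open>incr\<close>: over
  short intervals all sufficiently fine polygons have nearly the slope \<open>f s\<close>, uniformly
  in the position. Comparing two polygons through it shows that they form a Cauchy sequence; letting
  the mesh tend to 0 in it gives the derivative of the limit.\<close>

lemma primitive_exists:
  assumes f: "ncont X {a..b} f" and "a \<le> b"
  obtains F where "\<And>s. s \<in> {a..b} \<Longrightarrow> F s \<in> pts X"
    "\<And>s. s \<in> {a..b} \<Longrightarrow> has_deriv_in X F (f s) s {a..b}"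
proof -
  let ?E = "euler_polygon f a b"
  note Epts = euler_polygon_pts[OF f assms(2)]
  have incr: "\<exists>\<delta>>0. \<exists>N. \<forall>n\<ge>N. \<forall>p q s. a \<le> p \<longrightarrow> p \<le> q \<longrightarrow> q \<le> b \<longrightarrow> q - p < \<delta> \<longrightarrow> s \<in> {p..q} \<longrightarrow>
      nrm X (?E n q - ?E n p - (q - p) *\<^sub>R f s) \<le> e * (q - p)" if "0 < e" for e
  proof -
    obtain \<delta> where "0 < \<delta>"
      and \<delta>: "\<And>s q. s \<in> {a..b} \<Longrightarrow> q \<in> {a..b} \<Longrightarrow> dist s q < \<delta> \<Longrightarrow> nrm X (f s - f q) < e"
      by (rule ncont_uniform[OF f compact_Icc \<open>0 < e\<close>]) (rule that; blast)
    \<comment> \<open>The modulus \<open>\<delta>\<close> is shared equally: one half bounds the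
      length q - p, the other the mesh of the polygon.\<close>
    obtain N :: nat where N: "2 * (b - a) / \<delta> < real N"
      using reals_Archimedean2 by blast
    show ?thesis
    proof (intro exI[of _ "\<delta>/2"] conjI exI[of _ N] allI impI)
      fix n p q s assume n: "N \<le> n" and ord: "a \<le> p" "p \<le> q" "q \<le> b" and qp: "q - p < \<delta>/2"
        and s: "s \<in> {p..q}"
      have "2 * (b - a) / \<delta> < real n" using N n by (meson less_le_trans of_nat_mono)
      moreover have "0 \<le> 2 * (b - a) / \<delta>" using \<open>0 < \<delta>\<close> assms(2) by simp
      ultimately have n0: "0 < real n" by linarith
      then have "(b - a) / real n < \<delta>/2" using \<open>2 * (b - a) / \<delta> < real n\<close> \<open>0 < \<delta>\<close>
        by (simp add: field_simps)
      show "nrm X (?E n q - ?E n p - (q - p) *\<^sub>R f s) \<le> e * (q - p)"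
      proof (intro euler_polygon_increment[OF f] ord s)
        fix \<sigma> assume \<sigma>: "\<sigma> \<in> {a..b}" "\<bar>\<sigma> - s\<bar> \<le> q - p + (b - a) / real n"
        then have "dist \<sigma> s < \<delta>"
          using \<open>(b - a) / real n < \<delta>/2\<close> qp by (simp add: dist_real_def del: less_divide_eq_numeral1)
        then show "nrm X (f \<sigma> - f s) \<le> e" using \<delta>[of \<sigma> s] \<sigma>(1) s ord by simp
      qed (use n0 in simp)
    qed (use \<open>0 < \<delta>\<close> in simp)
  qed
  have "\<exists>l\<in>pts X. \<forall>e>0. \<forall>\<^sub>F n in sequentially. nrm X (?E n s - l) < e" if s: "s \<in> {a..b}" for s
  proof (rule Cauchy_limit[OF Epts])
    fix e :: real assume "0 < e"
    \<comment> \<open>The factor 2 accounts for the two polygons that are compared, the summand 1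
      for strictness and for the case a = b.\<close>
    define e' where "e' = e / (2 * (b - a + 1))"
    have e': "0 < e'" using \<open>0 < e\<close> assms(2) by (simp add: e'_def)
    obtain \<delta> N where "0 < \<delta>" and \<delta>: "\<And>n p q s. n \<ge> N \<Longrightarrow> a \<le> p \<Longrightarrow> p \<le> q \<Longrightarrow> q \<le> b \<Longrightarrow> q - p < \<delta> \<Longrightarrow>
        s \<in> {p..q} \<Longrightarrow> nrm X (?E n q - ?E n p - (q - p) *\<^sub>R f s) \<le> e' * (q - p)"
      using incr[OF e'] by blast
    have "nrm X (?E m s - ?E n s) < e" if mn: "N \<le> m" "N \<le> n" for m n
    proof -
      let ?G = "\<lambda>s. ?E m s - ?E n s"
      have "nrm X (?G s - ?G a) \<le> (2 * e') * (s - a)"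
      proof (rule local_bound_imp_global[OF _ \<open>0 < \<delta>\<close>])
        show "?G s \<in> pts X" for s using Epts by (simp add: closed_simps)
        fix p q assume pq: "a \<le> p" "p \<le> q" "q \<le> s" "q - p < \<delta>"
        \<comment> \<open>Both polygons are measured against the same slope \<open>f p\<close>,
          which cancels in their difference.\<close>
        let ?R = "\<lambda>n. ?E n q - ?E n p - (q - p) *\<^sub>R f p"
        have R: "?R n \<in> pts X" for n
          using Epts ncont_pts[OF f, of p] pq s by (simp add: closed_simps)
        have "?G q - ?G p = ?R m - ?R n" by simp
        also have "nrm X \<dots> \<le> nrm X (?R m) + nrm X (?R n)" using R R by (rule nrm_diff)
        also have "\<dots> \<le> e' * (q - p) + e' * (q - p)"
          using pq s mn by (intro add_mono \<delta>) auto
        finally show "nrm X (?G q - ?G p) \<le> 2 * e' * (q - p)" by simp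
      qed (use s in auto)
      also have "\<dots> \<le> 2 * e' * (b - a)" using s e' by (intro mult_left_mono) auto
      also have "\<dots> < e" using \<open>0 < e\<close> assms(2) by (simp add: e'_def divide_simps)
      finally show ?thesis by (simp add: euler_polygon_start assms(2))
    qed
    then show "\<exists>N. \<forall>m\<ge>N. \<forall>n\<ge>N. nrm X (?E m s - ?E n s) < e" by blast
  qed
  then obtain F where F: "\<And>s. s \<in> {a..b} \<Longrightarrow> F s \<in> pts X"
    "\<And>s e. s \<in> {a..b} \<Longrightarrow> 0 < e \<Longrightarrow> \<forall>\<^sub>F n in sequentially. nrm X (?E n s - F s) < e" by metis
  have "has_deriv_in X F (f s) s {a..b}" if s: "s \<in> {a..b}" for s
    unfolding has_deriv_in_iff
  proof (intro conjI allI impI)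
    show fs: "f s \<in> pts X" using ncont_pts[OF f s] .
    fix e :: real assume e: "0 < e"
    obtain \<delta> N where "0 < \<delta>" and \<delta>: "\<And>n p q s. n \<ge> N \<Longrightarrow> a \<le> p \<Longrightarrow> p \<le> q \<Longrightarrow> q \<le> b \<Longrightarrow> q - p < \<delta> \<Longrightarrow>
        s \<in> {p..q} \<Longrightarrow> nrm X (?E n q - ?E n p - (q - p) *\<^sub>R f s) \<le> e * (q - p)"
      using incr[OF e] by blast
    have est: "nrm X (F q - F p - (q - p) *\<^sub>R f s) \<le> e * (q - p)"
      if pq: "a \<le> p" "p \<le> q" "q \<le> b" "q - p < \<delta>" "s \<in> {p..q}" for p q
    proof (rule field_le_epsilon)
      \<comment> \<open>Convergence is only pointwise here, but two points suffice: n is chosen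
        after p, q and \<open>\<eta>\<close>, while \<open>\<delta>\<close> and N come from
        \<open>incr\<close> and do not depend on them.\<close>
      fix \<eta> :: real assume "0 < \<eta>"
      then have "0 < \<eta>/2" by simp
      have "\<forall>\<^sub>F n in sequentially. nrm X (?E n q - F q) < \<eta>/2 \<and> nrm X (?E n p - F p) < \<eta>/2 \<and> N \<le> n"
        using F(2)[OF _ \<open>0 < \<eta>/2\<close>] pq by (intro eventually_conj eventually_ge_at_top) auto
      then obtain n where n: "nrm X (?E n q - F q) < \<eta>/2" "nrm X (?E n p - F p) < \<eta>/2" "N \<le> n"
        by (auto simp: eventually_sequentially)
      let ?R = "?E n q - ?E n p - (q - p) *\<^sub>R f s"
      have pts: "?R \<in> pts X" "?E n q - F q \<in> pts X" "?E n p - F p \<in> pts X"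
        using Epts F(1) pq fs by (auto simp: closed_simps)
      have "F q - F p - (q - p) *\<^sub>R f s = ?R - ((?E n q - F q) - (?E n p - F p))" by simp
      also have "nrm X \<dots> \<le> nrm X ?R + (nrm X (?E n q - F q) + nrm X (?E n p - F p))"
        using pts nrm_diff[of "?E n q - F q" "?E n p - F p"]
          nrm_diff[of ?R "(?E n q - F q) - (?E n p - F p)"] by (simp add: closed_simps)
      also have "\<dots> \<le> e * (q - p) + \<eta>"
        using n \<delta>[of n p q s] pq by simp
      finally show "nrm X (F q - F p - (q - p) *\<^sub>R f s) \<le> e * (q - p) + \<eta>" .
    qed
    have "F q - F s \<in> pts X \<and> nrm X (F q - F s - (q - s) *\<^sub>R f s) \<le> e * \<bar>q - s\<bar>"
      if q: "q \<in> {a..b}" "\<bar>q - s\<bar> < \<delta>" for q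
    proof
      show in_pts: "F q - F s \<in> pts X" using F(1) q s by (simp add: closed_simps)
      show "nrm X (F q - F s - (q - s) *\<^sub>R f s) \<le> e * \<bar>q - s\<bar>"
      proof (cases "s \<le> q")
        case True
        then show ?thesis using est[of s q] q s by simp
      next
        case False
        have "F q - F s - (q - s) *\<^sub>R f s = - (F s - F q - (s - q) *\<^sub>R f s)"
          by (simp add: algebra_simps)
        moreover have "F s - F q - (s - q) *\<^sub>R f s \<in> pts X"
          using F(1) q s fs by (simp add: closed_simps)
        ultimately have "nrm X (F q - F s - (q - s) *\<^sub>R f s) = nrm X (F s - F q - (s - q) *\<^sub>R f s)"
          by (simp only: nrm_minus)
        then show ?thesis using est[of q s] q s False by simp
      qed
    qed
    then show "\<exists>\<delta>>0. \<forall>q\<in>{a..b}. \<bar>q - s\<bar> < \<delta> \<longrightarrow>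
        F q - F s \<in> pts X \<and> nrm X (F q - F s - (q - s) *\<^sub>R f s) \<le> e * \<bar>q - s\<bar>"
      using \<open>0 < \<delta>\<close> by blast
  qed
  with F(1) that show ?thesis by blast
qed

end

section \<open>Bounded operators\<close>

lemma bounded_linear_btw_pts: "bounded_linear_btw P Q L \<Longrightarrow> y \<in> pts P \<Longrightarrow> L y \<in> pts Q"
  by (simp add: bounded_linear_btw_def)

lemma bounded_linear_btw_add:
  "bounded_linear_btw P Q L \<Longrightarrow> y \<in> pts P \<Longrightarrow> z \<in> pts P \<Longrightarrow> L (y + z) = L y + L z"
  by (simp add: bounded_linear_btw_def)

lemma bounded_linear_btw_scale:
  "bounded_linear_btw P Q L \<Longrightarrow> y \<in> pts P \<Longrightarrow> L (c *\<^sub>R y) = c *\<^sub>R L y"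
  by (simp add: bounded_linear_btw_def)

lemma bounded_linear_btw_diff:
  assumes "bounded_linear_btw P Q L" "normed_subspace P" "y \<in> pts P" "z \<in> pts P"
  shows "L (y - z) = L y - L z"
proof -
  interpret P: normed_nspace P using assms(2) by unfold_locales
  have "L (y - z) = L (y + (- 1) *\<^sub>R z)" by simp
  also have "\<dots> = L y - L z"
    using assms P.closed_simps(4)[of z "-1"]
    by (simp only: bounded_linear_btw_add[OF assms(1)] bounded_linear_btw_scale[OF assms(1)]) simp
  finally show ?thesis .
qed

lemma bounded_linear_btw_bound:
  assumes "bounded_linear_btw P Q L" "normed_subspace P"
  obtains K where "0 \<le> K" "\<And>y. y \<in> pts P \<Longrightarrow> nrm Q (L y) \<le> K * nrm P y"
proof -
  obtain K where K: "\<And>y. y \<in> pts P \<Longrightarrow> nrm Q (L y) \<le> K * nrm P y"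
    using assms(1) unfolding bounded_linear_btw_def by blast
  have "nrm Q (L y) \<le> max K 0 * nrm P y" if "y \<in> pts P" for y
  proof -
    have "0 \<le> nrm P y" using assms(2) that by (simp add: normed_subspace_def)
    then have "K * nrm P y \<le> max K 0 * nrm P y" by (intro mult_right_mono) auto
    then show ?thesis using K[OF that] by linarith
  qed
  then show ?thesis using that[of "max K 0"] by simp
qed

text \<open>The increment splits into three terms: the operator varies at the fixed vector
  \<open>F t\<close>; \<open>L s\<close> acts on the remainder of \<open>F\<close>, where the
  uniform bound is used; and \<open>L s d\<close> is compared with \<open>L t d\<close>, where
  strong continuity is used. Differentiability of the operators in operator norm is thus
  avoided.\<close>

lemma has_deriv_in_product:
  assumes P: "normed_subspace P" and Q: "normed_subspace Q"
    and L: "\<And>s. s \<in> S \<Longrightarrow> bounded_linear_btw P Q (L s)"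
    and M: "\<And>s y. s \<in> S \<Longrightarrow> y \<in> pts P \<Longrightarrow> nrm Q (L s y) \<le> M * nrm P y"
    and F: "has_deriv_in P F d t S" and Fpts: "\<And>s. s \<in> S \<Longrightarrow> F s \<in> pts P"
    and c: "has_deriv_in Q (\<lambda>s. L s (F t)) c t S" and cont: "ncont Q S (\<lambda>s. L s d)"
    and t: "t \<in> S"
  shows "has_deriv_in Q (\<lambda>s. L s (F s)) (c + L t d) t S"
proof -
  interpret P: normed_nspace P using P by unfold_locales
  interpret Q: normed_nspace Q using Q by unfold_locales
  have d: "d \<in> pts P" and cpts: "c \<in> pts Q"
    using F c P.has_deriv_in_pts Q.has_deriv_in_pts by blast+
  note Lpts = bounded_linear_btw_pts[OF L]
  show ?thesis
    unfolding Q.has_deriv_in_iff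
  proof (intro conjI allI impI)
    show "c + L t d \<in> pts Q" using cpts Lpts[OF t d] by (simp add: Q.closed_simps)
    fix e :: real assume "0 < e"
    \<comment> \<open>M is not known to be positive, and the next constant divides by the
      bound.\<close>
    define m where "m = \<bar>M\<bar> + 1"
    have m: "0 < m" "M \<le> m" by (auto simp: m_def)
    define e' where "e' = e / (3 * m)"
    have e': "0 < e'" using \<open>0 < e\<close> m by (simp add: e'_def)
    have e3: "0 < e/3" using \<open>0 < e\<close> by simp
    obtain \<delta>1 where "0 < \<delta>1" and \<delta>1: "\<And>s. s \<in> S \<Longrightarrow> \<bar>s - t\<bar> < \<delta>1 \<Longrightarrow> F s - F t \<in> pts P"
      "\<And>s. s \<in> S \<Longrightarrow> \<bar>s - t\<bar> < \<delta>1 \<Longrightarrow> nrm P (F s - F t - (s - t) *\<^sub>R d) \<le> e' * \<bar>s - t\<bar>"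
      by (rule P.has_deriv_inE[OF F e']) (rule that; blast)
    obtain \<delta>2 where "0 < \<delta>2" and \<delta>2: "\<And>s. s \<in> S \<Longrightarrow> \<bar>s - t\<bar> < \<delta>2 \<Longrightarrow> L s (F t) - L t (F t) \<in> pts Q"
      "\<And>s. s \<in> S \<Longrightarrow> \<bar>s - t\<bar> < \<delta>2 \<Longrightarrow> nrm Q (L s (F t) - L t (F t) - (s - t) *\<^sub>R c) \<le> e/3 * \<bar>s - t\<bar>"
      by (rule Q.has_deriv_inE[OF c e3]) (rule that; blast)
    obtain \<delta>3 where "0 < \<delta>3" and \<delta>3: "\<And>s. s \<in> S \<Longrightarrow> dist s t < \<delta>3 \<Longrightarrow> nrm Q (L s d - L t d) < e/3"
      by (rule ncontE[OF cont t e3]) (rule that; blast)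
    have "L s (F s) - L t (F t) \<in> pts Q \<and>
        nrm Q (L s (F s) - L t (F t) - (s - t) *\<^sub>R (c + L t d)) \<le> e * \<bar>s - t\<bar>"
      if s: "s \<in> S" "\<bar>s - t\<bar> < min \<delta>1 (min \<delta>2 \<delta>3)" for s
    proof
      show "L s (F s) - L t (F t) \<in> pts Q"
        using Lpts Fpts s(1) t by (intro Q.closed_simps(3)) auto
      let ?A = "L s (F t) - L t (F t) - (s - t) *\<^sub>R c"
      let ?z = "F s - F t - (s - t) *\<^sub>R d"
      let ?C = "(s - t) *\<^sub>R (L s d - L t d)"
      have z: "?z \<in> pts P" using Fpts s(1) t d by (simp add: P.closed_simps)
      have pts: "?A \<in> pts Q" "L s ?z \<in> pts Q" "L s d - L t d \<in> pts Q" "?C \<in> pts Q"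
        using Lpts[OF s(1)] Lpts[OF t] Fpts s(1) t d cpts z by (auto intro!: Q.closed_simps)
      have "L s ?z = L s (F s - F t) - (s - t) *\<^sub>R L s d"
        using bounded_linear_btw_diff[OF L[OF s(1)] P, of "F s - F t" "(s - t) *\<^sub>R d"]
          bounded_linear_btw_scale[OF L[OF s(1)], of d] Fpts s(1) t d by (simp add: P.closed_simps)
      also have "\<dots> = L s (F s) - L s (F t) - (s - t) *\<^sub>R L s d"
        using bounded_linear_btw_diff[OF L[OF s(1)] P, of "F s" "F t"] Fpts s(1) t by simp
      finally have "L s (F s) - L t (F t) - (s - t) *\<^sub>R (c + L t d) = ?A + (L s ?z + ?C)"
        by (simp add: algebra_simps)
      moreover have "nrm Q (?A + (L s ?z + ?C)) \<le> nrm Q ?A + (nrm Q (L s ?z) + nrm Q ?C)"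
        using Q.nrm_add[OF pts(1) Q.closed_simps(2)[OF pts(2,4)]] Q.nrm_add[OF pts(2,4)] by linarith
      ultimately have "nrm Q (L s (F s) - L t (F t) - (s - t) *\<^sub>R (c + L t d)) \<le>
          nrm Q ?A + (nrm Q (L s ?z) + nrm Q ?C)" by (simp only:)
      moreover have "nrm Q ?A \<le> e/3 * \<bar>s - t\<bar>" using \<delta>2(2)[of s] s by simp
      moreover have "nrm Q (L s ?z) \<le> e/3 * \<bar>s - t\<bar>"
      proof -
        have "nrm Q (L s ?z) \<le> M * nrm P ?z" using M s(1) z by blast
        also have "\<dots> \<le> m * nrm P ?z"
          using P.nrm_nonneg[OF z] m by (intro mult_right_mono) auto
        also have "\<dots> \<le> m * (e' * \<bar>s - t\<bar>)"
          using \<delta>1(2)[of s] s m by (intro mult_left_mono) auto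
        also have "\<dots> = e/3 * \<bar>s - t\<bar>" using m by (simp add: e'_def)
        finally show ?thesis .
      qed
      moreover have "nrm Q ?C \<le> e/3 * \<bar>s - t\<bar>"
        using mult_left_mono[of "nrm Q (L s d - L t d)" "e/3" "\<bar>s - t\<bar>"] \<delta>3[of s] s pts(3)
        by (simp add: Q.nrm_scale dist_real_def mult.commute)
      ultimately show "nrm Q (L s (F s) - L t (F t) - (s - t) *\<^sub>R (c + L t d)) \<le> e * \<bar>s - t\<bar>"
        by (simp add: field_simps)
    qed
    then show "\<exists>\<delta>>0. \<forall>s\<in>S. \<bar>s - t\<bar> < \<delta> \<longrightarrow> L s (F s) - L t (F t) \<in> pts Q \<and>
        nrm Q (L s (F s) - L t (F t) - (s - t) *\<^sub>R (c + L t d)) \<le> e * \<bar>s - t\<bar>"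
      using \<open>0 < \<delta>1\<close> \<open>0 < \<delta>2\<close> \<open>0 < \<delta>3\<close> by (intro exI[of _ "min \<delta>1 (min \<delta>2 \<delta>3)"]) auto
  qed
qed

lemma has_deriv_in_linear:
  assumes P: "normed_subspace P" and Q: "normed_subspace Q"
    and L: "bounded_linear_btw P Q L" and F: "has_deriv_in P F d t S"
    and Fpts: "\<And>s. s \<in> S \<Longrightarrow> F s \<in> pts P" and t: "t \<in> S"
  shows "has_deriv_in Q (\<lambda>s. L (F s)) (L d) t S"
proof -
  interpret P: normed_nspace P using P by unfold_locales
  interpret Q: normed_nspace Q using Q by unfold_locales
  obtain K where K: "\<And>y. y \<in> pts P \<Longrightarrow> nrm Q (L y) \<le> K * nrm P y"
    using bounded_linear_btw_bound[OF L P] by blast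
  have "has_deriv_in Q (\<lambda>s. L (F t)) 0 t S"
    unfolding Q.has_deriv_in_iff by (auto simp: Q.closed_simps intro: exI[of _ 1])
  moreover have "L d \<in> pts Q"
    using bounded_linear_btw_pts[OF L] P.has_deriv_in_pts[OF F] .
  then have "ncont Q S (\<lambda>s. L d)"
    by (auto simp: ncont_def intro: exI[of _ 1])
  ultimately show ?thesis
    using has_deriv_in_product[OF P Q L K F Fpts _ _ t, of 0] by simp
qed

text \<open>The Banach-Steinhaus theorem by Baire category: the carrier is the union of the closed
  sets \<open>C n\<close> of vectors on which the whole family is bounded by n, so one of them
  contains a ball, and linearity carries the bound from that ball to all vectors.\<close>

lemma uniform_boundedness:
  assumes P: "normed_subspace P" and complete: "Metric_space.mcomplete (pts P) (ndist P)"
    and Q: "normed_subspace Q"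
    and L: "\<And>k. k \<in> K \<Longrightarrow> bounded_linear_btw P Q (L k)"
    and bounded: "\<And>y. y \<in> pts P \<Longrightarrow> \<exists>m. \<forall>k\<in>K. nrm Q (L k y) \<le> m"
  obtains M where "0 \<le> M" "\<And>k y. k \<in> K \<Longrightarrow> y \<in> pts P \<Longrightarrow> nrm Q (L k y) \<le> M * nrm P y"
proof -
  interpret P: normed_nspace P using P by unfold_locales
  interpret Q: normed_nspace Q using Q by unfold_locales
  interpret Metric_space "pts P" "ndist P" using P by (rule Metric_space_ndist)
  define C where "C n = {y \<in> pts P. \<forall>k\<in>K. nrm Q (L k y) \<le> real n}" for n :: nat
  have closed: "closedin mtopology (C n)" for n
    unfolding closedin_metric
  proof (intro conjI allI impI)
    fix y assume "y \<in> pts P - C n"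
    then obtain k where y: "y \<in> pts P" and k: "k \<in> K" "real n < nrm Q (L k y)"
      by (auto simp: C_def not_le)
    obtain c where c: "0 \<le> c" "\<And>y. y \<in> pts P \<Longrightarrow> nrm Q (L k y) \<le> c * nrm P y"
      using bounded_linear_btw_bound[OF L[OF k(1)] P] by metis
    \<comment> \<open>Within this radius \<open>L k\<close> changes the vector by less than its
      excess over n; the summand 1 covers c = 0.\<close>
    define \<rho> where "\<rho> = (nrm Q (L k y) - real n) / (c + 1)"
    have \<rho>: "0 < \<rho>" "c * \<rho> < nrm Q (L k y) - real n"
      using k(2) c(1) by (auto simp: \<rho>_def divide_simps algebra_simps)
    have "z \<notin> C n" if z: "z \<in> mball y \<rho>" for z
    proof -
      have zP: "z \<in> pts P" and zy: "nrm P (y - z) < \<rho>" using z by (auto simp: in_mball ndist_def)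
      have "nrm Q (L k y) - nrm Q (L k z) \<le> nrm Q (L k y - L k z)"
        using Q.nrm_abs_diff[of "L k y" "L k z"] bounded_linear_btw_pts[OF L[OF k(1)]] y zP by force
      also have "L k y - L k z = L k (y - z)"
        using bounded_linear_btw_diff[OF L[OF k(1)] P y zP] by simp
      also have "nrm Q (L k (y - z)) \<le> c * nrm P (y - z)"
        using c(2) P.closed_simps(3)[OF y zP] by blast
      also have "\<dots> \<le> c * \<rho>" using zy c(1) by (intro mult_left_mono) auto
      finally have "real n < nrm Q (L k z)" using \<rho>(2) by linarith
      then show ?thesis using k(1) by (fastforce simp: C_def)
    qed
    then show "\<exists>r>0. disjnt (C n) (mball y r)"
      using \<rho>(1) by (auto simp: disjnt_iff)
  qed (auto simp: C_def)
  have cover: "\<Union>(range C) = pts P"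
  proof (intro equalityI subsetI)
    fix y assume y: "y \<in> pts P"
    then obtain m where "\<forall>k\<in>K. nrm Q (L k y) \<le> m" using bounded by blast
    moreover obtain n where "m \<le> real n" using real_arch_simple by blast
    ultimately have "y \<in> C n" using y by (fastforce simp: C_def)
    then show "y \<in> \<Union>(range C)" by blast
  qed (auto simp: C_def)
  have "\<exists>n. mtopology interior_of C n \<noteq> {}"
  proof (rule ccontr)
    assume "\<not> ?thesis"
    then have "mtopology interior_of \<Union>(range C) = {}"
      using closed by (intro metric_Baire_category_alt complete) auto
    \<comment> \<open>The union is the whole carrier, which is its own interior and contains
      0.\<close>
    then have "pts P = {}" unfolding cover using interior_of_topspace[of mtopology] by simp
    then show False using P.closed_simps(1) by simp
  qed
  then obtain n y where "y \<in> mtopology interior_of C n" by blast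
  then obtain \<rho> where "0 < \<rho>" "mball y \<rho> \<subseteq> C n" and yC: "y \<in> C n"
    by (metis in_interior_of_mball interior_of_subset subsetD)
  have y: "y \<in> pts P" using yC by (simp add: C_def)
  have "nrm Q (L k z) \<le> (4 * real n / \<rho>) * nrm P z" if k: "k \<in> K" and z: "z \<in> pts P" for k z
  proof (cases "z = 0")
    case True
    have "L k 0 = 0" using bounded_linear_btw_diff[OF L[OF k] P y y] by simp
    then show ?thesis using True by simp
  next
    case False
    then have nz: "0 < nrm P z" using P.nrm_nonneg[OF z] P.nrm_eq_0[OF z] by linarith
    \<comment> \<open>This scaling makes the displacement of norm \<open>\<rho>\<close>/2, strictly
      inside the open ball. As y and w both lie in \<open>C n\<close>, the image of the displacement
      has norm at most 2 n; undoing the scaling gives the constant 4 n /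
      \<open>\<rho>\<close>.\<close>
    define c where "c = \<rho> / (2 * nrm P z)"
    have c: "0 < c" using nz \<open>0 < \<rho>\<close> by (simp add: c_def)
    have cz: "c *\<^sub>R z \<in> pts P" using z by (rule P.closed_simps)
    define w where "w = y + c *\<^sub>R z"
    have wP: "w \<in> pts P" using y cz by (simp add: w_def P.closed_simps)
    have "nrm P (y - w) = c * nrm P z"
      using P.nrm_minus[OF cz] P.nrm_scale[OF z, of c] c by (simp add: w_def)
    also have "\<dots> < \<rho>" using nz \<open>0 < \<rho>\<close> by (simp add: c_def)
    finally have "w \<in> mball y \<rho>" using y wP by (simp add: in_mball ndist_def)
    then have "w \<in> C n" using \<open>mball y \<rho> \<subseteq> C n\<close> by blast
    then have "nrm Q (L k w) \<le> real n" "nrm Q (L k y) \<le> real n" using yC k by (auto simp: C_def)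
    moreover have "c *\<^sub>R L k z = L k w - L k y"
      using bounded_linear_btw_diff[OF L[OF k] P wP y] bounded_linear_btw_scale[OF L[OF k] z, of c]
      by (simp add: w_def)
    ultimately have "nrm Q (c *\<^sub>R L k z) \<le> 2 * real n"
      using Q.nrm_diff[of "L k w" "L k y"] bounded_linear_btw_pts[OF L[OF k]] wP y by fastforce
    then have "c * nrm Q (L k z) \<le> 2 * real n"
      using Q.nrm_scale[of "L k z" c] bounded_linear_btw_pts[OF L[OF k] z] c by simp
    then show ?thesis using nz \<open>0 < \<rho>\<close> by (simp add: c_def field_simps)
  qed
  then show ?thesis using that[of "4 * real n / \<rho>"] \<open>0 < \<rho>\<close> by simp
qed

text \<open>Continuous functions on a compact set are bounded, so strong continuity gives a bound
  for each vector, and uniform boundedness turns these into one operator bound.\<close>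

lemma strongly_continuous_bound:
  fixes L :: "'k::metric_space \<Rightarrow> 'a::real_vector \<Rightarrow> 'a"
  assumes "normed_subspace P" "Metric_space.mcomplete (pts P) (ndist P)" "normed_subspace Q" "compact K"
    and "\<And>k. k \<in> K \<Longrightarrow> bounded_linear_btw P Q (L k)"
    and cont: "\<And>y. y \<in> pts P \<Longrightarrow> ncont Q K (\<lambda>k. L k y)"
  obtains M where "0 \<le> M" "\<And>k y. k \<in> K \<Longrightarrow> y \<in> pts P \<Longrightarrow> nrm Q (L k y) \<le> M * nrm P y"
proof (rule uniform_boundedness[OF assms(1,2,3,5)])
  fix y assume "y \<in> pts P"
  then have "compact ((\<lambda>k. nrm Q (L k y)) ` K)"
    using normed_nspace.continuous_on_nrm[OF normed_nspace.intro[OF assms(3)] cont] assms(4)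
    by (intro compact_continuous_image)
  then have "bdd_above ((\<lambda>k. nrm Q (L k y)) ` K)"
    by (intro bounded_imp_bdd_above compact_imp_bounded)
  then show "\<exists>m. \<forall>k\<in>K. nrm Q (L k y) \<le> m"
    by (auto simp: bdd_above_def)
qed (use that in auto)

text \<open>Upgrades strong continuity to joint continuity. A change of the vector is absorbed by
  the uniform bound over the compact set, a change of the operator by strong continuity at a fixed
  vector.\<close>

lemma ncont_apply:
  fixes L :: "'k::metric_space \<Rightarrow> 'a::real_vector \<Rightarrow> 'a"
  assumes P: "normed_subspace P" and "Metric_space.mcomplete (pts P) (ndist P)"
    and Q: "normed_subspace Q" and K: "compact K"
    and L: "\<And>k. k \<in> K \<Longrightarrow> bounded_linear_btw P Q (L k)"
    and cont: "\<And>y. y \<in> pts P \<Longrightarrow> ncont Q K (\<lambda>k. L k y)"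
    and g: "ncont P K g"
  shows "ncont Q K (\<lambda>k. L k (g k))"
proof -
  interpret P: normed_nspace P using P by unfold_locales
  interpret Q: normed_nspace Q using Q by unfold_locales
  obtain M' where M': "0 \<le> M'" "\<And>k y. k \<in> K \<Longrightarrow> y \<in> pts P \<Longrightarrow> nrm Q (L k y) \<le> M' * nrm P y"
    using strongly_continuous_bound[OF assms(1-6)] by metis
  define M where "M = M' + 1"
  have "0 < M" using M'(1) by (simp add: M_def)
  have M: "nrm Q (L k y) \<le> M * nrm P y" if "k \<in> K" "y \<in> pts P" for k y
    using M'(2)[OF that] P.nrm_nonneg[OF that(2)] by (simp add: M_def algebra_simps)
  note Lpts = bounded_linear_btw_pts[OF L]
  show ?thesis
    unfolding ncont_def
  proof (intro ballI conjI allI impI)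
    fix k assume k: "k \<in> K"
    have gk: "g k \<in> pts P" using ncont_pts[OF g k] .
    show "L k (g k) \<in> pts Q" using Lpts[OF k gk] .
    fix e :: real assume "0 < e"
    then have e: "0 < e/2" "0 < e / (2 * M)" using \<open>0 < M\<close> by auto
    obtain \<delta>1 where "0 < \<delta>1" and \<delta>1: "\<And>j. j \<in> K \<Longrightarrow> dist j k < \<delta>1 \<Longrightarrow> nrm Q (L j (g k) - L k (g k)) < e/2"
      by (rule ncontE[OF cont[OF gk] k e(1)]) (rule that; blast)
    obtain \<delta>2 where "0 < \<delta>2" and \<delta>2: "\<And>j. j \<in> K \<Longrightarrow> dist j k < \<delta>2 \<Longrightarrow> nrm P (g j - g k) < e / (2 * M)"
      by (rule ncontE[OF g k e(2)]) (rule that; blast)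
    have "nrm Q (L j (g j) - L k (g k)) < e" if j: "j \<in> K" "dist j k < min \<delta>1 \<delta>2" for j
    proof -
      have gj: "g j \<in> pts P" using ncont_pts[OF g j(1)] .
      have d: "g j - g k \<in> pts P" using gj gk by (rule P.closed_simps)
      have "nrm Q (L j (g j) - L j (g k)) = nrm Q (L j (g j - g k))"
        using bounded_linear_btw_diff[OF L[OF j(1)] P gj gk] by simp
      also have "\<dots> \<le> M * nrm P (g j - g k)" using M[OF j(1) d] .
      also have "\<dots> < M * (e / (2 * M))"
        using \<delta>2[of j] j \<open>0 < M\<close> by (intro mult_strict_left_mono) auto
      also have "\<dots> = e/2" using \<open>0 < M\<close> by simp
      finally have "nrm Q (L j (g j) - L j (g k)) < e/2" .
      moreover have "nrm Q (L j (g k) - L k (g k)) < e/2" using \<delta>1 j by simp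
      moreover have "nrm Q (L j (g j) - L k (g k)) \<le>
          nrm Q (L j (g j) - L j (g k)) + nrm Q (L j (g k) - L k (g k))"
        using Lpts j(1) k gj gk by (intro Q.nrm_triangle) auto
      ultimately show ?thesis by linarith
    qed
    then show "\<exists>d>0. \<forall>j\<in>K. dist j k < d \<longrightarrow> nrm Q (L j (g j) - L k (g k)) < e"
      using \<open>0 < \<delta>1\<close> \<open>0 < \<delta>2\<close> by (intro exI[of _ "min \<delta>1 \<delta>2"]) auto
  qed
qed

section \<open>Trajectories in a scale\<close>

text \<open>\<open>time_triangle T\<close> excludes the time T and is in general not compact. These
  compact pieces are the sets on which uniform boundedness yields joint continuity.\<close>

definition triangle_upto :: "real \<Rightarrow> (real \<times> real) set" where
  "triangle_upto \<tau> = ({0..\<tau>} \<times> {0..\<tau>}) \<inter> {p. snd p \<le> fst p}"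

lemma compact_triangle_upto: "compact (triangle_upto \<tau>)"
  unfolding triangle_upto_def
  by (intro compact_Int_closed compact_Times compact_Icc closed_Collect_le continuous_intros)

lemma mem_triangle_upto [simp]: "(q, s) \<in> triangle_upto \<tau> \<longleftrightarrow> 0 \<le> s \<and> s \<le> q \<and> q \<le> \<tau>"
  by (auto simp: triangle_upto_def)

lemma triangle_upto_subset: "\<tau> < T \<Longrightarrow> triangle_upto \<tau> \<subseteq> time_triangle T"
  by (auto simp: triangle_upto_def time_triangle_def)

text \<open>The operators appear without indices, as single maps whose domain and target are chosen
  afterwards; in particular one \<open>V\<close> acts on both scales. In \<open>V_refl\<close> and
  \<open>V_comp\<close> the index of the vector is strictly below \<open>hi\<close>, since operators
  are available only from an index to a larger one. B occurs only along continuous curves, so its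
  joint continuity is stated for such compositions.\<close>

locale scale_evolution =
  fixes X Y :: "real \<Rightarrow> 'a::real_vector nspace" and lo hi T :: real
    and V :: "real \<Rightarrow> real \<Rightarrow> 'a \<Rightarrow> 'a" and A B :: "real \<Rightarrow> 'a \<Rightarrow> 'a" and x :: 'a and r :: ereal
  assumes scale_X: "banach_scale lo hi X" and scale_Y: "banach_scale lo hi Y"
    and embedded: "scale_embedded lo hi X Y" and x: "x \<in> pts (X lo)"
    and V_X: "\<And>t s a b. (t, s) \<in> time_triangle T \<Longrightarrow> lo \<le> a \<Longrightarrow> a < b \<Longrightarrow> b \<le> hi \<Longrightarrow>
      bounded_linear_btw (X a) (X b) (V t s)"
    and V_Y: "\<And>t s a b. (t, s) \<in> time_triangle T \<Longrightarrow> lo \<le> a \<Longrightarrow> a < b \<Longrightarrow> b \<le> hi \<Longrightarrow>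
      bounded_linear_btw (Y a) (Y b) (V t s)"
    and V_cont_X: "\<And>a b y. lo \<le> a \<Longrightarrow> a < b \<Longrightarrow> b \<le> hi \<Longrightarrow> y \<in> pts (X a) \<Longrightarrow>
      ncont (X b) (time_triangle T) (\<lambda>p. V (fst p) (snd p) y)"
    and V_cont_Y: "\<And>a b y. lo \<le> a \<Longrightarrow> a < b \<Longrightarrow> b \<le> hi \<Longrightarrow> y \<in> pts (Y a) \<Longrightarrow>
      ncont (Y b) (time_triangle T) (\<lambda>p. V (fst p) (snd p) y)"
    and V_refl: "\<And>t a y. 0 \<le> t \<Longrightarrow> t < T \<Longrightarrow> lo \<le> a \<Longrightarrow> a < hi \<Longrightarrow> y \<in> pts (X a) \<Longrightarrow> V t t y = y"
    and V_comp: "\<And>t q s a y. 0 \<le> s \<Longrightarrow> s \<le> q \<Longrightarrow> q \<le> t \<Longrightarrow> t < T \<Longrightarrow> lo \<le> a \<Longrightarrow> a < hi \<Longrightarrow>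
      y \<in> pts (X a) \<Longrightarrow> V t q (V q s y) = V t s y"
    and A_linear: "\<And>t a b. t \<in> {0..<T} \<Longrightarrow> lo \<le> a \<Longrightarrow> a < b \<Longrightarrow> b \<le> hi \<Longrightarrow>
      bounded_linear_btw (X a) (Y b) (A t)"
    and A_cont: "\<And>a b y. lo \<le> a \<Longrightarrow> a < b \<Longrightarrow> b \<le> hi \<Longrightarrow> y \<in> pts (X a) \<Longrightarrow>
      ncont (Y b) {0..<T} (\<lambda>t. A t y)"
    and V_deriv_t: "\<And>t s a b y. (t, s) \<in> time_triangle T \<Longrightarrow> lo \<le> a \<Longrightarrow> a < b \<Longrightarrow> b \<le> hi \<Longrightarrow>
      y \<in> pts (X a) \<Longrightarrow> has_deriv_in (Y b) (\<lambda>t. V t s y) (A t (V t s y)) t {s..<T}"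
    and V_deriv_s: "\<And>t s a b y. (t, s) \<in> time_triangle T \<Longrightarrow> lo \<le> a \<Longrightarrow> a < b \<Longrightarrow> b \<le> hi \<Longrightarrow>
      y \<in> pts (X a) \<Longrightarrow> has_deriv_in (Y b) (\<lambda>s. V t s y) (- V t s (A s y)) s {0..t}"
    and B_cont: "\<And>a b S v. lo \<le> a \<Longrightarrow> a < b \<Longrightarrow> b \<le> hi \<Longrightarrow> S \<subseteq> {0..<T} \<Longrightarrow> ncont (X a) S v \<Longrightarrow>
      (\<And>s. s \<in> S \<Longrightarrow> v s \<in> nball (X a) x r) \<Longrightarrow> ncont (X b) S (\<lambda>s. B s (v s))"
begin

lemma banach_X: "lo \<le> a \<Longrightarrow> a \<le> hi \<Longrightarrow> banach_nspace (X a)"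
  using scale_X unfolding banach_scale_def banach_subspace_def
  by (auto intro!: banach_nspace.intro normed_nspace.intro banach_nspace_axioms.intro)

lemma banach_Y: "lo \<le> a \<Longrightarrow> a \<le> hi \<Longrightarrow> banach_nspace (Y a)"
  using scale_Y unfolding banach_scale_def banach_subspace_def
  by (auto intro!: banach_nspace.intro normed_nspace.intro banach_nspace_axioms.intro)

lemma normed_X: "lo \<le> a \<Longrightarrow> a \<le> hi \<Longrightarrow> normed_subspace (X a)"
  using banach_X by (simp add: banach_nspace_def normed_nspace_def)

lemma normed_Y: "lo \<le> a \<Longrightarrow> a \<le> hi \<Longrightarrow> normed_subspace (Y a)"
  using banach_Y by (simp add: banach_nspace_def normed_nspace_def)

lemma X_mono:
  assumes "lo \<le> a" "a \<le> b" "b \<le> hi" "y \<in> pts (X a)"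
  shows "y \<in> pts (X b)" "nrm (X b) y \<le> nrm (X a) y"
  using scale_X assms unfolding banach_scale_def by (cases "a = b"; force)+

lemma X_Y:
  assumes "lo \<le> a" "a \<le> hi" "y \<in> pts (X a)"
  shows "y \<in> pts (Y a)" "nrm (Y a) y \<le> nrm (X a) y"
  using embedded assms unfolding scale_embedded_def by auto

lemma ncont_X_Y: "lo \<le> a \<Longrightarrow> a \<le> hi \<Longrightarrow> ncont (X a) S f \<Longrightarrow> ncont (Y a) S f"
  by (rule ncont_larger[of "X a"]) (auto intro: X_Y normed_X)

lemma has_deriv_in_X_Y:
  "lo \<le> a \<Longrightarrow> a \<le> hi \<Longrightarrow> has_deriv_in (X a) f d t S \<Longrightarrow> has_deriv_in (Y a) f d t S"
  by (rule normed_nspace.has_deriv_in_larger[of "X a"])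
    (auto intro: X_Y normed_X normed_Y normed_nspace.intro)

lemma V_apply_cont:
  assumes "lo \<le> a" "a < b" "b \<le> hi" "\<tau> < T" "ncont (X a) {0..\<tau>} g"
  shows "ncont (X b) (triangle_upto \<tau>) (\<lambda>p. V (fst p) (snd p) (g (snd p)))"
proof -
  interpret P: banach_nspace "X a" using assms by (intro banach_X) auto
  show ?thesis
  proof (rule ncont_apply[where L = "\<lambda>p. V (fst p) (snd p)" and g = "\<lambda>p. g (snd p)",
        OF P.normed P.complete _ compact_triangle_upto])
    show "normed_subspace (X b)" using assms by (intro normed_X) auto
    show "bounded_linear_btw (X a) (X b) (V (fst k) (snd k))" if "k \<in> triangle_upto \<tau>" for k
      using V_X[of "fst k" "snd k" a b] that triangle_upto_subset[OF assms(4)] assms by auto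
    show "ncont (X b) (triangle_upto \<tau>) (\<lambda>p. V (fst p) (snd p) y)" if "y \<in> pts (X a)" for y
      using ncont_subset[OF V_cont_X triangle_upto_subset] that assms by auto
    show "ncont (X a) (triangle_upto \<tau>) (\<lambda>p. g (snd p))"
      by (rule P.ncont_compose[OF assms(5)]) (intro continuous_intros | auto)+
  qed
qed

lemma A_apply_cont:
  assumes "lo \<le> a" "a < b" "b \<le> hi" "\<tau> < T" "ncont (X a) (triangle_upto \<tau>) g"
  shows "ncont (Y b) (triangle_upto \<tau>) (\<lambda>p. A (fst p) (g p))"
proof -
  interpret P: banach_nspace "X a" using assms by (intro banach_X) auto
  interpret Q: banach_nspace "Y b" using assms by (intro banach_Y) auto
  show ?thesis
  proof (rule ncont_apply[where L = "\<lambda>p. A (fst p)" and g = g,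
        OF P.normed P.complete Q.normed compact_triangle_upto])
    show "bounded_linear_btw (X a) (Y b) (A (fst k))" if "k \<in> triangle_upto \<tau>" for k
      using A_linear[of "fst k" a b] that assms by (cases k) auto
    show "ncont (Y b) (triangle_upto \<tau>) (\<lambda>p. A (fst p) y)" if "y \<in> pts (X a)" for y
      by (rule Q.ncont_compose[OF A_cont[OF assms(1-3) that]])
        (use assms in \<open>(intro continuous_intros | auto)+\<close>)
  qed (rule assms(5))
qed

end

text \<open>Collects what both notions of solution have in common: continuity in each space up to
  its lifetime, and membership in the ball. What remains of either notion is the equation, and for
  the classical one also the initial value and a continuous derivative.\<close>

locale scale_trajectory = scale_evolution X Y lo hi T V A B x r
  for X Y :: "real \<Rightarrow> 'a::real_vector nspace" and lo hi T V A B x r +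
  fixes \<alpha>\<^sub>0 lam :: real and u :: "real \<Rightarrow> 'a"
  assumes \<alpha>\<^sub>0: "lo \<le> \<alpha>\<^sub>0" "\<alpha>\<^sub>0 < hi" and lam: "0 < lam" and lifetime_hi: "lifetime \<alpha>\<^sub>0 lam hi \<le> T"
    and u_cont: "\<And>\<alpha>. \<alpha>\<^sub>0 < \<alpha> \<Longrightarrow> \<alpha> \<le> hi \<Longrightarrow> ncont (X \<alpha>) {0..<lifetime \<alpha>\<^sub>0 lam \<alpha>} u"
    and u_ball: "\<And>\<alpha> t. \<alpha>\<^sub>0 < \<alpha> \<Longrightarrow> \<alpha> \<le> hi \<Longrightarrow> t \<in> {0..<lifetime \<alpha>\<^sub>0 lam \<alpha>} \<Longrightarrow> u t \<in> nball (X \<alpha>) x r"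
begin

abbreviation L where "L \<equiv> lifetime \<alpha>\<^sub>0 lam"

abbreviation f where "f s \<equiv> B s (u s)"

section \<open>Indices, lifetimes and continuity of the integrands\<close>

lemma L_mono: "a \<le> b \<Longrightarrow> L a \<le> L b"
  using lam by (simp add: lifetime_def divide_right_mono)

lemma L_le_T: "a \<le> hi \<Longrightarrow> L a \<le> T"
  using L_mono[of a hi] lifetime_hi by simp

text \<open>The index whose lifetime is exactly t is \<open>\<alpha>\<^sub>0 + t * lam\<close>; the
  witness is the midpoint between it and \<alpha>. Each use provides the room that one more operator
  consumes.\<close>

lemma index_below:
  assumes "\<alpha>\<^sub>0 < \<alpha>" "0 \<le> t" "t < L \<alpha>"
  obtains a where "\<alpha>\<^sub>0 < a" "a < \<alpha>" "t < L a"
proof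
  have t: "t * lam < \<alpha> - \<alpha>\<^sub>0" using assms(3) lam by (simp add: lifetime_def field_simps)
  have "0 \<le> t * lam" using assms(2) lam by simp
  then show "\<alpha>\<^sub>0 < \<alpha>\<^sub>0 + (t * lam + (\<alpha> - \<alpha>\<^sub>0)) / 2" using assms(1) by simp
  show "\<alpha>\<^sub>0 + (t * lam + (\<alpha> - \<alpha>\<^sub>0)) / 2 < \<alpha>" using t by (simp add: field_simps)
  show "t < L (\<alpha>\<^sub>0 + (t * lam + (\<alpha> - \<alpha>\<^sub>0)) / 2)" using t lam by (simp add: lifetime_def field_simps)
qed

lemma u_pts: "\<alpha>\<^sub>0 < a \<Longrightarrow> a \<le> hi \<Longrightarrow> 0 \<le> t \<Longrightarrow> t < L a \<Longrightarrow> u t \<in> pts (X a)"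
  using u_cont[of a] ncont_pts by fastforce

lemma f_cont:
  assumes "\<alpha>\<^sub>0 < a" "a < b" "b \<le> hi"
  shows "ncont (X b) {0..<L a} (\<lambda>s. f s)"
  using assms \<alpha>\<^sub>0 L_le_T[of a] u_cont[of a] u_ball[of a] by (intro B_cont[of a]) auto

lemma f_pts: "\<alpha>\<^sub>0 < a \<Longrightarrow> a < b \<Longrightarrow> b \<le> hi \<Longrightarrow> 0 \<le> t \<Longrightarrow> t < L a \<Longrightarrow> f t \<in> pts (X b)"
  using f_cont[of a b] ncont_pts by fastforce

lemma Vf_cont:
  assumes "\<alpha>\<^sub>0 < a" "a < b" "b \<le> hi" "\<tau> < L a"
  shows "ncont (X b) (triangle_upto \<tau>) (\<lambda>p. V (fst p) (snd p) (f (snd p)))"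
proof -
  \<comment> \<open>B raises the index from a to c, and V raises it from c to b.\<close>
  obtain c where c: "a < c" "c < b" using assms(2) dense by blast
  show ?thesis
    using assms c \<alpha>\<^sub>0 L_le_T[of a]
    by (intro V_apply_cont[of c b \<tau> "\<lambda>s. f s"] ncont_subset[OF f_cont[of a c]]) auto
qed

text \<open>V has to land in \<open>X c\<close> for some c < b, a member of the smaller scale,
  because A acts from there and only its values lie in the larger scale.\<close>

lemma AVu_cont:
  assumes "\<alpha>\<^sub>0 < a" "a < b" "b \<le> hi" "\<tau> < L a"
  shows "ncont (Y b) (triangle_upto \<tau>) (\<lambda>p. A (fst p) (V (fst p) (snd p) (u (snd p))))"
proof -
  obtain c where c: "a < c" "c < b" using assms(2) dense by blast
  show ?thesis
    using assms c \<alpha>\<^sub>0 L_le_T[of a]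
    by (intro A_apply_cont[of c b] V_apply_cont[of a c] ncont_subset[OF u_cont[of a]]) auto
qed

lemma integrand_cont:
  assumes "\<alpha>\<^sub>0 < \<alpha>" "\<alpha> \<le> hi" "0 \<le> t" "t < L \<alpha>"
  shows "ncont (X \<alpha>) {0..t} (\<lambda>s. V t s (f s))"
proof -
  obtain a where a: "\<alpha>\<^sub>0 < a" "a < \<alpha>" "t < L a" using index_below[OF assms(1,3,4)] .
  interpret Q: banach_nspace "X \<alpha>" using assms \<alpha>\<^sub>0 by (intro banach_X) auto
  have "continuous_on {0..t} (\<lambda>s. (t, s))" by (intro continuous_intros)
  from Q.ncont_compose[OF Vf_cont[OF a(1,2) assms(2) a(3)] this]
  show ?thesis using assms(3) by (simp add: image_subset_iff)
qed

text \<open>The fundamental theorem applied to \<open>V t s (u s)\<close> computes the integral only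
  in the norm of \<open>Y \<alpha>\<close>. The primitive G lives in \<open>X \<alpha>\<close>, so
  its increment is the integral in both norms, and uniqueness in \<open>Y \<alpha>\<close> equates
  it with the computed value.\<close>

lemma classical_imp_integral:
  assumes u0: "u 0 = x"
    and deriv: "\<And>\<alpha> t. \<alpha>\<^sub>0 < \<alpha> \<Longrightarrow> \<alpha> \<le> hi \<Longrightarrow> t \<in> {0..<L \<alpha>} \<Longrightarrow>
      has_deriv_in (Y \<alpha>) u (A t (u t) + f t) t {0..<L \<alpha>}"
    and \<alpha>: "\<alpha>\<^sub>0 < \<alpha>" "\<alpha> \<le> hi" and t: "0 \<le> t" "t < L \<alpha>"
  shows "\<exists>I. has_integral_in (X \<alpha>) (\<lambda>s. V t s (f s)) I 0 t \<and> u t = V t 0 x + I"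
proof -
  obtain b where b: "\<alpha>\<^sub>0 < b" "b < \<alpha>" "t < L b" using index_below[OF \<alpha>(1) t] .
  obtain a where a: "\<alpha>\<^sub>0 < a" "a < b" "t < L a" using index_below[OF b(1) t(1) b(3)] .
  interpret Q: banach_nspace "X \<alpha>" using \<alpha> \<alpha>\<^sub>0 by (intro banach_X) auto
  interpret QY: banach_nspace "Y \<alpha>" using \<alpha> \<alpha>\<^sub>0 by (intro banach_Y) auto
  interpret PY: banach_nspace "Y b" using \<alpha> b \<alpha>\<^sub>0 by (intro banach_Y) auto
  have T: "t < T" using b L_le_T[of b] \<alpha> by simp
  have ord: "lo \<le> a" "lo \<le> b" "b \<le> hi" "a \<le> hi" "a < \<alpha>" "a < hi" using a b \<alpha> \<alpha>\<^sub>0 by auto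
  have tri: "(t, s) \<in> time_triangle T" if "s \<in> {0..t}" for s
    using that T by (auto simp: time_triangle_def)
  have us: "u s \<in> pts (X a)" "u s \<in> pts (X b)" "u s \<in> pts (Y b)" if "s \<in> {0..t}" for s
    using u_pts[of a s] X_mono(1)[of a b "u s"] X_Y(1)[of b "u s"] that a b ord by auto
  have As: "A s (u s) \<in> pts (Y b)" if "s \<in> {0..t}" for s
    using bounded_linear_btw_pts[OF A_linear[of s a b]] us(1)[OF that] that T a ord by auto
  have fs: "f s \<in> pts (Y b)" if "s \<in> {0..t}" for s
    using f_pts[of a b s] X_Y(1)[of b "f s"] that a ord by auto
  have VY: "bounded_linear_btw (Y b) (Y \<alpha>) (V t s)" if "s \<in> {0..t}" for s
    using V_Y[OF tri[OF that], of b \<alpha>] b \<alpha> ord by auto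
  have VY_cont: "ncont (Y \<alpha>) {0..t} (\<lambda>s. V t s y)" if "y \<in> pts (Y b)" for y
  proof -
    have "continuous_on {0..t} (\<lambda>s. (t, s))" by (intro continuous_intros)
    from QY.ncont_compose[OF V_cont_Y[OF ord(2) b(2) \<alpha>(2) that] this]
    show ?thesis using tri by (simp add: image_subset_iff)
  qed
  \<comment> \<open>The product rule needs a bound for V on the larger scale, as the derivative of u
    exists only there; compactness of [0, t] provides it.\<close>
  obtain M where M: "\<And>s y. s \<in> {0..t} \<Longrightarrow> y \<in> pts (Y b) \<Longrightarrow> nrm (Y \<alpha>) (V t s y) \<le> M * nrm (Y b) y"
    by (rule strongly_continuous_bound[OF PY.normed PY.complete QY.normed compact_Icc VY VY_cont])
      (auto intro: that)
  obtain G where G: "\<And>s. s \<in> {0..t} \<Longrightarrow> G s \<in> pts (X \<alpha>)"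
    "\<And>s. s \<in> {0..t} \<Longrightarrow> has_deriv_in (X \<alpha>) G (V t s (f s)) s {0..t}"
    by (rule Q.primitive_exists[OF integrand_cont[OF \<alpha> t] t(1)]) (rule that; blast)
  have "has_integral_in (X \<alpha>) (\<lambda>s. V t s (f s)) (G t - G 0) 0 t"
    using G t by (intro Q.fundamental_theorem[where F = G]) (auto simp: Q.closed_simps(3))
  moreover have "has_integral_in (Y \<alpha>) (\<lambda>s. V t s (f s)) (G t - G 0) 0 t"
  proof (rule QY.fundamental_theorem[where F = G, OF t(1)])
    fix s assume s: "s \<in> {0..t}"
    show "has_deriv_in (Y \<alpha>) G (V t s (f s)) s {0..t}"
      using G(2)[OF s] \<alpha> \<alpha>\<^sub>0 by (intro has_deriv_in_X_Y) auto
    show "G s - G 0 \<in> pts (Y \<alpha>)"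
      using G(1) s t(1) \<alpha> \<alpha>\<^sub>0 by (intro X_Y(1) Q.closed_simps(3)) auto
  qed
  moreover have "has_integral_in (Y \<alpha>) (\<lambda>s. V t s (f s)) (V t t (u t) - V t 0 (u 0)) 0 t"
  proof (rule QY.fundamental_theorem[where F = "\<lambda>s. V t s (u s)" and f = "\<lambda>s. V t s (f s)", OF t(1)])
    fix s assume s: "s \<in> {0..t}"
    \<comment> \<open>The derivative is taken at the index b below \<alpha>, so that V can map it
      from \<open>Y b\<close> to \<open>Y \<alpha>\<close>.\<close>
    have du: "has_deriv_in (Y b) u (A s (u s) + f s) s {0..t}"
    proof (rule PY.has_deriv_in_subset)
      show "has_deriv_in (Y b) u (A s (u s) + f s) s {0..<L b}"
        using s b ord by (intro deriv) auto
    qed (use b in auto)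
    have "has_deriv_in (Y \<alpha>) (\<lambda>s. V t s (u s)) (- V t s (A s (u s)) + V t s (A s (u s) + f s)) s {0..t}"
    proof (rule has_deriv_in_product[where L = "V t" and F = u and M = M,
          OF PY.normed QY.normed VY M du us(3)])
      show "has_deriv_in (Y \<alpha>) (\<lambda>q. V t q (u s)) (- V t s (A s (u s))) s {0..t}"
        by (rule V_deriv_s[OF tri[OF s] ord(2) b(2) \<alpha>(2) us(2)[OF s]])
      show "ncont (Y \<alpha>) {0..t} (\<lambda>q. V t q (A s (u s) + f s))"
        by (intro VY_cont PY.closed_simps(2) As fs s)
    qed (use s in auto)
    then show "has_deriv_in (Y \<alpha>) (\<lambda>s. V t s (u s)) (V t s (f s)) s {0..t}"
      by (simp add: bounded_linear_btw_add[OF VY[OF s] As[OF s] fs[OF s]])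
    show "V t s (u s) - V t 0 (u 0) \<in> pts (Y \<alpha>)"
      using bounded_linear_btw_pts[OF VY us(3)] s t by (intro QY.closed_simps) auto
  qed
  ultimately have "has_integral_in (X \<alpha>) (\<lambda>s. V t s (f s)) (V t t (u t) - V t 0 (u 0)) 0 t"
    using QY.has_integral_in_unique by metis
  moreover have "V t t (u t) = u t"
    using V_refl[OF t(1) T ord(1,6)] us(1)[of t] t by simp
  ultimately show ?thesis using u0 by (intro exI[of _ "u t - V t 0 x"]) simp
qed

section \<open>From the integral equation to the differential equation\<close>

context
  assumes integral: "\<And>\<alpha> t. \<alpha>\<^sub>0 < \<alpha> \<Longrightarrow> \<alpha> \<le> hi \<Longrightarrow> 0 \<le> t \<Longrightarrow> t < L \<alpha> \<Longrightarrow>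
    \<exists>I. has_integral_in (X \<alpha>) (\<lambda>s. V t s (f s)) I 0 t \<and> u t = V t 0 x + I"
begin

text \<open>Trades the integral for the increment of a primitive, so that restriction to a
  subinterval becomes restriction of the primitive and no additivity of integrals has to be
  proved.\<close>

lemma integral_solution_primitive:
  assumes \<alpha>: "\<alpha>\<^sub>0 < \<alpha>" "\<alpha> \<le> hi" and t: "0 \<le> t" "t < L \<alpha>"
  obtains H where "\<And>s. s \<in> {0..t} \<Longrightarrow> H s \<in> pts (X \<alpha>)"
    "\<And>s. s \<in> {0..t} \<Longrightarrow> has_deriv_in (X \<alpha>) H (V t s (f s)) s {0..t}"
    "u t = V t 0 x + (H t - H 0)"
proof -
  interpret Q: banach_nspace "X \<alpha>" using \<alpha> \<alpha>\<^sub>0 by (intro banach_X) auto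
  obtain H where H: "\<And>s. s \<in> {0..t} \<Longrightarrow> H s \<in> pts (X \<alpha>)"
    "\<And>s. s \<in> {0..t} \<Longrightarrow> has_deriv_in (X \<alpha>) H (V t s (f s)) s {0..t}"
    by (rule Q.primitive_exists[OF integrand_cont[OF \<alpha> t] t(1)]) (rule that; blast)
  have "has_integral_in (X \<alpha>) (\<lambda>s. V t s (f s)) (H t - H 0) 0 t"
    using H t by (intro Q.fundamental_theorem[where F = H]) (auto simp: Q.closed_simps(3))
  then have "u t = V t 0 x + (H t - H 0)"
    using integral[OF \<alpha> t] Q.has_integral_in_unique by blast
  with H that show ?thesis by blast
qed

text \<open>At time 0 the increment of the primitive vanishes, and \<open>V 0 0\<close> fixes x,
  which lies in \<open>X lo\<close> with \<open>lo\<close> below \<open>hi\<close>.\<close>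

lemma integral_solution_initial: "u 0 = x"
proof -
  have "0 < L hi" using \<alpha>\<^sub>0 lam by (simp add: lifetime_def)
  obtain H :: "real \<Rightarrow> 'a" where "u 0 = V 0 0 x + (H 0 - H 0)"
    by (rule integral_solution_primitive[OF \<alpha>\<^sub>0(2) order_refl order_refl \<open>0 < L hi\<close>])
  then have "u 0 = V 0 0 x" by simp
  also have "\<dots> = x"
    using x \<alpha>\<^sub>0 \<open>0 < L hi\<close> lifetime_hi by (intro V_refl[of 0 lo]) auto
  finally show ?thesis .
qed

text \<open>Applying \<open>V \<tau> \<sigma>\<close> to the equation at time \<sigma> and using the
  evolution law turns its integral into the part of the integral at time \<tau> over [0, \<sigma>].
  Subtracting leaves the part over [\<sigma>, \<tau>]. The equation at \<sigma> is read at the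
  smaller index b, from which \<open>V \<tau> \<sigma>\<close> leads to \<alpha>.\<close>

lemma variation_of_constants:
  assumes \<alpha>: "\<alpha>\<^sub>0 < \<alpha>" "\<alpha> \<le> hi" and \<sigma>\<tau>: "0 \<le> \<sigma>" "\<sigma> \<le> \<tau>" "\<tau> < L \<alpha>"
  obtains H where "\<And>s. s \<in> {\<sigma>..\<tau>} \<Longrightarrow> H s \<in> pts (X \<alpha>)"
    "\<And>s. s \<in> {\<sigma>..\<tau>} \<Longrightarrow> has_deriv_in (X \<alpha>) H (V \<tau> s (f s)) s {\<sigma>..\<tau>}"
    "u \<tau> = V \<tau> \<sigma> (u \<sigma>) + (H \<tau> - H \<sigma>)"
proof -
  have \<tau>0: "0 \<le> \<tau>" using \<sigma>\<tau> by simp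
  obtain b where b: "\<alpha>\<^sub>0 < b" "b < \<alpha>" "\<tau> < L b" using index_below[OF \<alpha>(1) \<tau>0 \<sigma>\<tau>(3)] .
  obtain a where a: "\<alpha>\<^sub>0 < a" "a < b" "\<tau> < L a" using index_below[OF b(1) \<tau>0 b(3)] .
  have ord: "lo < b" "b \<le> hi" "b < hi" "lo \<le> b" "lo < hi" using b \<alpha> \<alpha>\<^sub>0 by auto
  have T: "\<tau> < T" using b L_le_T[of b] \<alpha> by simp
  interpret Q: banach_nspace "X \<alpha>" using \<alpha> \<alpha>\<^sub>0 by (intro banach_X) auto
  interpret P: banach_nspace "X b" using ord by (intro banach_X) auto
  have V: "bounded_linear_btw (X b) (X \<alpha>) (V \<tau> \<sigma>)"
    using V_X[of \<tau> \<sigma> b \<alpha>] ord b \<alpha> \<sigma>\<tau> T by (auto simp: time_triangle_def)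
  obtain H where H: "\<And>s. s \<in> {0..\<tau>} \<Longrightarrow> H s \<in> pts (X \<alpha>)"
    "\<And>s. s \<in> {0..\<tau>} \<Longrightarrow> has_deriv_in (X \<alpha>) H (V \<tau> s (f s)) s {0..\<tau>}"
    "u \<tau> = V \<tau> 0 x + (H \<tau> - H 0)"
    by (rule integral_solution_primitive[OF \<alpha> \<tau>0 \<sigma>\<tau>(3)]) (rule that; simp)
  have \<sigma>b: "\<sigma> < L b" using \<sigma>\<tau> b by simp
  obtain G where G: "\<And>s. s \<in> {0..\<sigma>} \<Longrightarrow> G s \<in> pts (X b)"
    "\<And>s. s \<in> {0..\<sigma>} \<Longrightarrow> has_deriv_in (X b) G (V \<sigma> s (f s)) s {0..\<sigma>}"
    "u \<sigma> = V \<sigma> 0 x + (G \<sigma> - G 0)"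
    by (rule integral_solution_primitive[OF b(1) ord(2) \<sigma>\<tau>(1) \<sigma>b]) (rule that; simp)
  \<comment> \<open>A bounded operator maps a primitive to a primitive, so
    \<open>V \<tau> \<sigma> (G s)\<close> and H have the same derivative on [0, \<sigma>] and hence
    the same increment.\<close>
  have "has_integral_in (X \<alpha>) (\<lambda>s. V \<tau> s (f s)) (V \<tau> \<sigma> (G \<sigma>) - V \<tau> \<sigma> (G 0)) 0 \<sigma>"
  proof (rule Q.fundamental_theorem[of 0 \<sigma> "\<lambda>s. V \<tau> \<sigma> (G s)", OF \<sigma>\<tau>(1)])
    fix s assume s: "s \<in> {0..\<sigma>}"
    have "V \<tau> \<sigma> (V \<sigma> s (f s)) = V \<tau> s (f s)"
      using s \<sigma>\<tau> T ord f_pts[OF a(1,2) ord(2), of s] a by (intro V_comp[of s \<sigma> \<tau> b]) auto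
    then show "has_deriv_in (X \<alpha>) (\<lambda>s. V \<tau> \<sigma> (G s)) (V \<tau> s (f s)) s {0..\<sigma>}"
      using has_deriv_in_linear[OF P.normed Q.normed V G(2,1) s] s by simp
    show "V \<tau> \<sigma> (G s) - V \<tau> \<sigma> (G 0) \<in> pts (X \<alpha>)"
      using bounded_linear_btw_pts[OF V G(1)] s by (intro Q.closed_simps) auto
  qed
  moreover have "has_integral_in (X \<alpha>) (\<lambda>s. V \<tau> s (f s)) (H \<sigma> - H 0) 0 \<sigma>"
    using H(1) \<sigma>\<tau>
    by (intro Q.fundamental_theorem[where F = H] Q.has_deriv_in_subset[OF H(2)])
      (auto simp: Q.closed_simps(3))
  ultimately have "V \<tau> \<sigma> (G \<sigma>) - V \<tau> \<sigma> (G 0) = H \<sigma> - H 0"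
    by (rule Q.has_integral_in_unique)
  moreover have "V \<tau> \<sigma> (G \<sigma> - G 0) = V \<tau> \<sigma> (G \<sigma>) - V \<tau> \<sigma> (G 0)"
    using G(1) \<sigma>\<tau> by (intro bounded_linear_btw_diff[OF V P.normed]) auto
  moreover have "V \<sigma> 0 x \<in> pts (X b)"
    using bounded_linear_btw_pts[OF V_X[of \<sigma> 0 lo b] x] ord \<sigma>\<tau> T by (auto simp: time_triangle_def)
  then have "V \<tau> \<sigma> (u \<sigma>) = V \<tau> \<sigma> (V \<sigma> 0 x) + V \<tau> \<sigma> (G \<sigma> - G 0)"
    unfolding G(3) using G(1) \<sigma>\<tau> by (intro bounded_linear_btw_add[OF V]) (auto simp: P.closed_simps)
  moreover have "V \<tau> \<sigma> (V \<sigma> 0 x) = V \<tau> 0 x"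
    using x \<sigma>\<tau> T ord by (intro V_comp[of 0 \<sigma> \<tau> lo]) auto
  ultimately have "u \<tau> = V \<tau> \<sigma> (u \<sigma>) + (H \<tau> - H \<sigma>)"
    using H(3) by simp
  moreover have "has_deriv_in (X \<alpha>) H (V \<tau> s (f s)) s {\<sigma>..\<tau>}" if "s \<in> {\<sigma>..\<tau>}" for s
    using \<sigma>\<tau> that by (intro Q.has_deriv_in_subset[OF H(2)]) auto
  ultimately show ?thesis using that[of H] H(1) \<sigma>\<tau>(1) by auto
qed

lemma integral_solution_deriv:
  assumes \<alpha>: "\<alpha>\<^sub>0 < \<alpha>" "\<alpha> \<le> hi" and t: "t \<in> {0..<L \<alpha>}"
  shows "has_deriv_in (Y \<alpha>) u (A t (u t) + f t) t {0..<L \<alpha>}"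
proof -
  have t': "0 \<le> t" "t < L \<alpha>" using t by auto
  obtain b where b: "\<alpha>\<^sub>0 < b" "b < \<alpha>" "t < L b" using index_below[OF \<alpha>(1) t'] .
  obtain a where a: "\<alpha>\<^sub>0 < a" "a < b" "t < L a" using index_below[OF b(1) t'(1) b(3)] .
  \<comment> \<open>The bound lies strictly beyond t, so the compact triangle also contains the
    pairs with times shortly after t.\<close>
  obtain \<theta> where \<theta>: "t < \<theta>" "\<theta> < L a" using dense[OF a(3)] by blast
  have ord: "lo \<le> a" "a < hi" "a \<le> hi" "lo \<le> b" "b \<le> hi" "b < hi" "a < \<alpha>" "L a \<le> L \<alpha>"
    using a b \<alpha> \<alpha>\<^sub>0 L_mono[of a \<alpha>] by auto
  have T: "L \<alpha> \<le> T" using L_le_T \<alpha> by simp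
  interpret QY: banach_nspace "Y \<alpha>" using \<alpha> \<alpha>\<^sub>0 by (intro banach_Y) auto
  interpret Q: banach_nspace "X \<alpha>" using \<alpha> \<alpha>\<^sub>0 by (intro banach_X) auto
  let ?\<Phi> = "\<lambda>p. A (fst p) (V (fst p) (snd p) (u (snd p)))"
  let ?\<Psi> = "\<lambda>p. V (fst p) (snd p) (f (snd p))"
  have \<Phi>: "ncont (Y \<alpha>) (triangle_upto \<theta>) ?\<Phi>"
    using AVu_cont[of a \<alpha> \<theta>] a \<alpha> ord \<theta> by auto
  have \<Psi>: "ncont (Y \<alpha>) (triangle_upto \<theta>) ?\<Psi>"
    using Vf_cont[of a \<alpha> \<theta>] a \<alpha> ord \<theta> \<alpha>\<^sub>0 by (intro ncont_X_Y) auto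
  have tt: "(t, t) \<in> triangle_upto \<theta>" using t' \<theta> by simp
  have \<Phi>t: "?\<Phi> (t, t) = A t (u t)"
    using V_refl[of t a "u t"] u_pts[of a t] a ord t' T by simp
  have \<Psi>t: "?\<Psi> (t, t) = f t"
    using V_refl[of t b "f t"] f_pts[of a b t] a ord t' T by simp
  have d: "A t (u t) \<in> pts (Y \<alpha>)" "f t \<in> pts (Y \<alpha>)"
    using ncont_pts[OF \<Phi> tt] ncont_pts[OF \<Psi> tt] by (simp_all only: \<Phi>t \<Psi>t)
  have uY: "u s \<in> pts (Y \<alpha>)" if "0 \<le> s" "s < L \<alpha>" for s
    using u_pts[OF \<alpha> that] X_Y(1)[of \<alpha> "u s"] \<alpha> \<alpha>\<^sub>0 by simp
  show ?thesis
    unfolding QY.has_deriv_in_iff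
  proof (intro conjI allI impI)
    show "A t (u t) + f t \<in> pts (Y \<alpha>)" using d by (rule QY.closed_simps)
    fix e :: real assume "0 < e"
    then have e2: "0 < e/2" by simp
    obtain \<delta>1 where "0 < \<delta>1" and \<delta>1: "\<And>p. p \<in> triangle_upto \<theta> \<Longrightarrow> dist p (t, t) < \<delta>1 \<Longrightarrow>
        nrm (Y \<alpha>) (?\<Phi> p - ?\<Phi> (t, t)) < e/2"
      by (rule ncontE[OF \<Phi> tt e2]) (rule that; simp)
    obtain \<delta>2 where "0 < \<delta>2" and \<delta>2: "\<And>p. p \<in> triangle_upto \<theta> \<Longrightarrow> dist p (t, t) < \<delta>2 \<Longrightarrow>
        nrm (Y \<alpha>) (?\<Psi> p - ?\<Psi> (t, t)) < e/2"
      by (rule ncontE[OF \<Psi> tt e2]) (rule that; simp)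
    \<comment> \<open>The first entry keeps \<tau> below \<theta>. The half is there because a point
      (q, s) may be off from (t, t) by nearly \<open>\<delta>\<close> in each coordinate.\<close>
    define \<delta> where "\<delta> = min (\<theta> - t) (min \<delta>1 \<delta>2 / 2)"
    have \<delta>: "0 < \<delta>" "\<delta> \<le> \<theta> - t" "2 * \<delta> \<le> \<delta>1" "2 * \<delta> \<le> \<delta>2"
      using \<open>0 < \<delta>1\<close> \<open>0 < \<delta>2\<close> \<theta> by (auto simp: \<delta>_def min_def)
    have est: "nrm (Y \<alpha>) (u \<tau> - u \<sigma> - (\<tau> - \<sigma>) *\<^sub>R (A t (u t) + f t)) \<le> e * (\<tau> - \<sigma>)"
      if st: "0 \<le> \<sigma>" "\<sigma> \<le> t" "t \<le> \<tau>" "t - \<sigma> < \<delta>" "\<tau> - t < \<delta>" for \<sigma> \<tau>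
    proof -
      have \<tau>: "\<tau> \<le> \<theta>" "\<tau> < L a" "\<tau> < L \<alpha>" "\<tau> < T" "\<sigma> \<le> \<tau>" "\<sigma> < L a"
        using st \<delta>(2) \<theta> ord T by auto
      have near: "(q, s) \<in> triangle_upto \<theta>" "dist (q, s) (t, t) < \<delta>1" "dist (q, s) (t, t) < \<delta>2"
        if "q \<in> {\<sigma>..\<tau>}" "s \<in> {\<sigma>..\<tau>}" "s \<le> q" for q s
      proof -
        show "(q, s) \<in> triangle_upto \<theta>" using that st \<tau> by auto
        have "dist (q, s) (t, t) \<le> \<bar>q - t\<bar> + \<bar>s - t\<bar>"
          using sqrt_sum_squares_le_sum_abs[of "q - t" "s - t"] by (simp add: dist_Pair_Pair dist_real_def)
        also have "\<dots> < \<delta> + \<delta>" using that st by (intro add_strict_mono) auto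
        finally show "dist (q, s) (t, t) < \<delta>1" "dist (q, s) (t, t) < \<delta>2" using \<delta> by auto
      qed
      obtain H where H: "\<And>s. s \<in> {\<sigma>..\<tau>} \<Longrightarrow> H s \<in> pts (X \<alpha>)"
        "\<And>s. s \<in> {\<sigma>..\<tau>} \<Longrightarrow> has_deriv_in (X \<alpha>) H (V \<tau> s (f s)) s {\<sigma>..\<tau>}"
        "u \<tau> = V \<tau> \<sigma> (u \<sigma>) + (H \<tau> - H \<sigma>)"
        by (rule variation_of_constants[OF \<alpha> st(1) \<tau>(5,3)]) (rule that; simp)
      have H_pts: "H s - H \<sigma> \<in> pts (Y \<alpha>)" if "s \<in> {\<sigma>..\<tau>}" for s
        using X_Y(1)[of \<alpha> "H s - H \<sigma>"] H(1) that \<alpha> \<alpha>\<^sub>0 \<tau>(5) by (auto simp: Q.closed_simps)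
      \<comment> \<open>The mean value inequality freezes the slope at \<open>f t\<close>. Here the
        points (\<tau>, s) run through the side of the small triangle with first coordinate
        \<tau>.\<close>
      have H_est: "nrm (Y \<alpha>) (H \<tau> - H \<sigma> - (\<tau> - \<sigma>) *\<^sub>R f t) \<le> e/2 * (\<tau> - \<sigma>)"
      proof (rule QY.has_deriv_in_bound[where F = H and f = "\<lambda>s. V \<tau> s (f s)", OF \<tau>(5) _ H_pts d(2)])
        fix s assume s: "s \<in> {\<sigma>..\<tau>}"
        show "has_deriv_in (Y \<alpha>) H (V \<tau> s (f s)) s {\<sigma>..\<tau>}"
          using H(2)[OF s] \<alpha> \<alpha>\<^sub>0 by (intro has_deriv_in_X_Y) auto
        show "nrm (Y \<alpha>) (V \<tau> s (f s) - f t) \<le> e/2"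
          using \<delta>2[OF near(1,3)[of \<tau> s]] s \<tau>(5) unfolding \<Psi>t by simp
      qed
      let ?J = "\<lambda>q. V q \<sigma> (u \<sigma>)"
      have u\<sigma>: "u \<sigma> \<in> pts (X a)" using u_pts[of a \<sigma>] a ord st \<tau> by auto
      have tri: "(q, \<sigma>) \<in> time_triangle T" if "q \<in> {\<sigma>..\<tau>}" for q
        using that st \<tau> by (auto simp: time_triangle_def)
      have J: "?J q \<in> pts (Y \<alpha>)" if "q \<in> {\<sigma>..\<tau>}" for q
        using bounded_linear_btw_pts[OF V_X[OF tri[OF that] ord(1,7) \<alpha>(2)] u\<sigma>] X_Y(1)[of \<alpha>] \<alpha> \<alpha>\<^sub>0
        by auto
      \<comment> \<open>The other side of the triangle: the second time stays at \<sigma>, only the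
        first one moves, and the slope is frozen at \<open>A t (u t)\<close>.\<close>
      have J_est: "nrm (Y \<alpha>) (?J \<tau> - ?J \<sigma> - (\<tau> - \<sigma>) *\<^sub>R A t (u t)) \<le> e/2 * (\<tau> - \<sigma>)"
      proof (rule QY.has_deriv_in_bound[where F = ?J and f = "\<lambda>q. A q (?J q)", OF \<tau>(5) _ _ d(1)])
        fix q assume q: "q \<in> {\<sigma>..\<tau>}"
        show "has_deriv_in (Y \<alpha>) ?J (A q (?J q)) q {\<sigma>..\<tau>}"
          using V_deriv_t[OF tri[OF q] ord(1,7) \<alpha>(2) u\<sigma>]
          by (rule QY.has_deriv_in_subset) (use \<tau> in auto)
        show "?J q - ?J \<sigma> \<in> pts (Y \<alpha>)" using J q \<tau>(5) by (intro QY.closed_simps) auto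
        show "nrm (Y \<alpha>) (A q (?J q) - A t (u t)) \<le> e/2"
          using \<delta>1[OF near(1,2)[of q \<sigma>]] q unfolding \<Phi>t by simp
      qed
      have "?J \<sigma> = u \<sigma>" using V_refl[OF st(1) _ ord(1,2) u\<sigma>] \<tau> by simp
      then have "u \<tau> - u \<sigma> - (\<tau> - \<sigma>) *\<^sub>R (A t (u t) + f t) =
          (?J \<tau> - ?J \<sigma> - (\<tau> - \<sigma>) *\<^sub>R A t (u t)) + (H \<tau> - H \<sigma> - (\<tau> - \<sigma>) *\<^sub>R f t)"
        unfolding H(3) by (simp add: algebra_simps)
      also have "nrm (Y \<alpha>) \<dots> \<le> nrm (Y \<alpha>) (?J \<tau> - ?J \<sigma> - (\<tau> - \<sigma>) *\<^sub>R A t (u t)) +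
          nrm (Y \<alpha>) (H \<tau> - H \<sigma> - (\<tau> - \<sigma>) *\<^sub>R f t)"
        using J d \<tau>(5)
        by (intro QY.nrm_add QY.closed_simps(3)[OF H_pts QY.closed_simps(4)] QY.closed_simps(3,4)) auto
      also have "\<dots> \<le> e * (\<tau> - \<sigma>)" using J_est H_est by (simp add: field_simps)
      finally show ?thesis .
    qed
    have "u s - u t \<in> pts (Y \<alpha>) \<and>
        nrm (Y \<alpha>) (u s - u t - (s - t) *\<^sub>R (A t (u t) + f t)) \<le> e * \<bar>s - t\<bar>"
      if s: "s \<in> {0..<L \<alpha>}" "\<bar>s - t\<bar> < \<delta>" for s
    proof
      show st: "u s - u t \<in> pts (Y \<alpha>)" using uY s t' by (intro QY.closed_simps) auto
      show "nrm (Y \<alpha>) (u s - u t - (s - t) *\<^sub>R (A t (u t) + f t)) \<le> e * \<bar>s - t\<bar>"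
      \<comment> \<open>The two one-sided quotients are the cases \<sigma> = t and \<tau> = t of
        \<open>est\<close>; the second needs a change of sign.\<close>
      proof (cases "t \<le> s")
        case True
        then show ?thesis using est[of t s] s t' \<delta> by simp
      next
        case False
        let ?R = "u t - u s - (t - s) *\<^sub>R (A t (u t) + f t)"
        have "u s - u t - (s - t) *\<^sub>R (A t (u t) + f t) = - ?R" by (simp add: algebra_simps)
        moreover have "?R \<in> pts (Y \<alpha>)"
          using uY[of t] uY[of s] s t' d by (simp add: QY.closed_simps)
        ultimately have "nrm (Y \<alpha>) (u s - u t - (s - t) *\<^sub>R (A t (u t) + f t)) = nrm (Y \<alpha>) ?R"
          by (simp only: QY.nrm_minus)
        then show ?thesis using est[of s t] s False \<delta> by simp
      qed
    qed
    then show "\<exists>\<delta>>0. \<forall>s\<in>{0..<L \<alpha>}. \<bar>s - t\<bar> < \<delta> \<longrightarrow> u s - u t \<in> pts (Y \<alpha>) \<and>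
        nrm (Y \<alpha>) (u s - u t - (s - t) *\<^sub>R (A t (u t) + f t)) \<le> e * \<bar>s - t\<bar>"
      using \<delta>(1) by blast
  qed
qed

end

text \<open>The right-hand side is the restriction of a jointly continuous function to the diagonal
  of the triangle, where V disappears. Joint continuity is available on compact triangles only,
  hence the passage through [0, \<theta>] with \<theta> beyond the time considered.\<close>

lemma rhs_cont:
  assumes \<alpha>: "\<alpha>\<^sub>0 < \<alpha>" "\<alpha> \<le> hi"
  shows "ncont (Y \<alpha>) {0..<L \<alpha>} (\<lambda>t. A t (u t) + f t)"
proof -
  interpret QY: banach_nspace "Y \<alpha>" using \<alpha> \<alpha>\<^sub>0 by (intro banach_Y) auto
  have loc: "\<exists>\<theta>>t. ncont (Y \<alpha>) {0..\<theta>} (\<lambda>t. A t (u t) + f t)" if t: "t \<in> {0..<L \<alpha>}" for t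
  proof -
    have t': "0 \<le> t" "t < L \<alpha>" using t by auto
    obtain b where b: "\<alpha>\<^sub>0 < b" "b < \<alpha>" "t < L b" using index_below[OF \<alpha>(1) t'] .
    obtain a where a: "\<alpha>\<^sub>0 < a" "a < b" "t < L a" using index_below[OF b(1) t'(1) b(3)] .
    obtain \<theta> where \<theta>: "t < \<theta>" "\<theta> < L a" using dense[OF a(3)] by blast
    have ord: "lo \<le> a" "a < \<alpha>" "a \<le> hi" "a < hi" "b < hi" "lo \<le> b" "b \<le> hi" "L a \<le> T"
      using a b \<alpha> \<alpha>\<^sub>0 L_le_T[of a] by auto
    let ?g = "\<lambda>p. A (fst p) (V (fst p) (snd p) (u (snd p))) + V (fst p) (snd p) (f (snd p))"
    have "ncont (Y \<alpha>) (triangle_upto \<theta>) ?g"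
      using ncont_X_Y[OF _ \<alpha>(2) Vf_cont[of a \<alpha> \<theta>]] a \<alpha> ord \<theta> \<alpha>\<^sub>0
      by (intro QY.ncont_add AVu_cont[of a \<alpha> \<theta>]) auto
    moreover have "continuous_on {0..\<theta>} (\<lambda>s. (s, s))" by (intro continuous_intros)
    ultimately have "ncont (Y \<alpha>) {0..\<theta>} (\<lambda>s. ?g (s, s))"
      by (rule QY.ncont_compose) auto
    moreover have "?g (s, s) = A s (u s) + f s" if "s \<in> {0..\<theta>}" for s
      using V_refl[of s a "u s"] V_refl[of s b "f s"] u_pts[of a s] f_pts[of a b s] a ord \<theta> that by simp
    ultimately have "ncont (Y \<alpha>) {0..\<theta>} (\<lambda>s. A s (u s) + f s)"
      using ncont_cong[of "{0..\<theta>}" "\<lambda>s. ?g (s, s)" "\<lambda>s. A s (u s) + f s" "Y \<alpha>"] by blast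
    with \<theta>(1) show ?thesis by blast
  qed
  show ?thesis
    unfolding ncont_def
  proof (intro ballI conjI allI impI)
    fix t assume t: "t \<in> {0..<L \<alpha>}"
    obtain \<theta> where \<theta>: "t < \<theta>" and cont: "ncont (Y \<alpha>) {0..\<theta>} (\<lambda>t. A t (u t) + f t)"
      using loc[OF t] by blast
    have t\<theta>: "t \<in> {0..\<theta>}" using t \<theta> by simp
    show "A t (u t) + f t \<in> pts (Y \<alpha>)" using ncont_pts[OF cont t\<theta>] .
    fix e :: real assume "0 < e"
    obtain \<delta> where "0 < \<delta>" and \<delta>: "\<And>q. q \<in> {0..\<theta>} \<Longrightarrow> dist q t < \<delta> \<Longrightarrow>
        nrm (Y \<alpha>) ((A q (u q) + f q) - (A t (u t) + f t)) < e"
      by (rule ncontE[OF cont t\<theta> \<open>0 < e\<close>]) (rule that; blast)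
    then show "\<exists>d>0. \<forall>q\<in>{0..<L \<alpha>}. dist q t < d \<longrightarrow>
        nrm (Y \<alpha>) ((A q (u q) + f q) - (A t (u t) + f t)) < e"
      using \<theta> by (intro exI[of _ "min \<delta> (\<theta> - t)"]) (auto simp: dist_real_def)
  qed
qed

end

section \<open>Operators with indices\<close>

text \<open>
  An operator in a scale takes the same values for all choices of its two indices. \<open>glue\<close>
  picks them, so that the indices disappear from the argument.
\<close>

definition glue :: "real \<Rightarrow> real \<Rightarrow> (real \<Rightarrow> 'a set) \<Rightarrow> (real \<Rightarrow> real \<Rightarrow> 'a \<Rightarrow> 'a) \<Rightarrow> 'a \<Rightarrow> 'a" where
  "glue lo hi D L y = L (SOME a. lo \<le> a \<and> a < hi \<and> y \<in> D a) hi y"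

text \<open>First the target index is raised to \<open>hi\<close>; then two source indices are
  compared, where compatibility lets the smaller one be replaced by the larger one.\<close>

lemma glue_eq:
  assumes compat: "\<And>a b c y. lo \<le> a \<Longrightarrow> a < b \<Longrightarrow> b < c \<Longrightarrow> c \<le> hi \<Longrightarrow> y \<in> D a \<Longrightarrow>
      L a c y = L a b y \<and> L a b y = L b c y"
    and a: "lo \<le> a" "a < b" "b \<le> hi" "y \<in> D a"
  shows "L a b y = glue lo hi D L y"
proof -
  let ?c = "SOME a. lo \<le> a \<and> a < hi \<and> y \<in> D a"
  have "lo \<le> a \<and> a < hi \<and> y \<in> D a" using a by simp
  then have c: "lo \<le> ?c \<and> ?c < hi \<and> y \<in> D ?c" by (rule someI)
  have "L a b y = L a hi y" using compat[of a b hi y] a by (cases "b = hi") auto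
  also have "\<dots> = L ?c hi y"
    using compat[of a ?c hi y] compat[of ?c a hi y] a c by (cases a ?c rule: linorder_cases) auto
  finally show ?thesis by (simp add: glue_def)
qed

lemma nball_infinity [simp]: "nball X c \<infinity> = pts X"
  by (auto simp: nball_def)

lemma bounded_linear_btw_cong:
  assumes "bounded_linear_btw P Q L" "normed_subspace P" "\<And>y. y \<in> pts P \<Longrightarrow> L y = L' y"
  shows "bounded_linear_btw P Q L'"
proof -
  interpret P: normed_nspace P using assms(2) by unfold_locales
  show ?thesis
    using assms(1) unfolding bounded_linear_btw_def
    by (simp add: assms(3)[symmetric] P.closed_simps)
qed

text \<open>The filter eventually contains only tagged divisions, whose tags lie in the interval, so
  values elsewhere cannot influence the limit.\<close>

lemma has_integral_in_cong:
  assumes "\<And>s. s \<in> {a..b} \<Longrightarrow> f s = g s"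
  shows "has_integral_in X f I a b \<longleftrightarrow> has_integral_in X g I a b"
proof -
  have "has_integral_in X h I a b"
    if "has_integral_in X k I a b" "\<And>s. s \<in> {a..b} \<Longrightarrow> k s = h s" for h k
  proof -
    have "\<forall>\<^sub>F p in division_filter (cbox a b).
        (\<Sum>(s,K)\<in>p. measure lborel K *\<^sub>R k s) = (\<Sum>(s,K)\<in>p. measure lborel K *\<^sub>R h s)"
      using eventually_division_filter_tagged_division
    proof eventually_elim
      case (elim p)
      then have "s \<in> {a..b}" if "(s, K) \<in> p" for s K
        using tagged_division_ofD(2,3)[OF elim that] by auto
      then show ?case using that(2) by (intro sum.cong refl) auto
    qed
    then show ?thesis
      using that(1) unfolding has_integral_in_def by (rule limitin_transform_eventually)
  qed
  from this[of f g] this[of g f] show ?thesis using assms by metis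
qed

section \<open>From the conditions to operators without indices\<close>

lemma cond_A1D:
  assumes "cond_A1 lo hi X T U" and "lo \<le> a" "a < b" "b \<le> hi"
  shows "(t, s) \<in> time_triangle T \<Longrightarrow> bounded_linear_btw (X a) (X b) (U t s a b)"
    and "0 \<le> t \<Longrightarrow> t < T \<Longrightarrow> y \<in> pts (X a) \<Longrightarrow> U t t a b y = y"
    and "0 \<le> s \<Longrightarrow> s \<le> q \<Longrightarrow> q \<le> t \<Longrightarrow> t < T \<Longrightarrow> a < d \<Longrightarrow> d < b \<Longrightarrow> y \<in> pts (X a) \<Longrightarrow>
      U t q d b (U q s a d y) = U t s a b y"
    and "y \<in> pts (X a) \<Longrightarrow>
      continuous_map (top_of_set (time_triangle T)) (ntop (X b)) (\<lambda>p. U (fst p) (snd p) a b y)"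
  using assms unfolding cond_A1_def bounded_linear_op_in_scale_def split_def by fastforce+

lemma cond_A4D:
  assumes "cond_A4 lo hi X Y T U A" and "lo \<le> a" "a < b" "b \<le> hi"
  shows "t \<in> {0..<T} \<Longrightarrow> bounded_linear_btw (X a) (Y b) (A t a b)"
    and "y \<in> pts (X a) \<Longrightarrow> continuous_map (top_of_set {0..<T}) (ntop (Y b)) (\<lambda>t. A t a b y)"
    and "b < c \<Longrightarrow> c \<le> hi \<Longrightarrow> t \<in> {0..<T} \<Longrightarrow> y \<in> pts (X a) \<Longrightarrow>
      A t a c y = A t a b y \<and> A t a b y = A t b c y"
    and "(t, s) \<in> time_triangle T \<Longrightarrow> nonlinear_op_in_scale lo hi Y \<infinity> 0 (U t s)"
    and "(t, s) \<in> time_triangle T \<Longrightarrow> bounded_linear_btw (Y a) (Y b) (U t s a b)"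
    and "y \<in> pts (Y a) \<Longrightarrow>
      continuous_map (top_of_set (time_triangle T)) (ntop (Y b)) (\<lambda>p. U (fst p) (snd p) a b y)"
    and "(t, s) \<in> time_triangle T \<Longrightarrow> a < d \<Longrightarrow> d < b \<Longrightarrow> y \<in> pts (X a) \<Longrightarrow>
      has_deriv_in (Y b) (\<lambda>t. U t s a b y) (A t d b (U t s a d y)) t {s..<T}"
    and "(t, s) \<in> time_triangle T \<Longrightarrow> a < d \<Longrightarrow> d < b \<Longrightarrow> y \<in> pts (X a) \<Longrightarrow>
      has_deriv_in (Y b) (\<lambda>s. U t s a b y) (- U t s d b (A s a d y)) s {0..t}"
  using assms unfolding cond_A4_def bounded_linear_op_in_scale_def split_def by fastforce+

text \<open>The agreement with \<open>V\<close> is assumed on the larger scale and passes to the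
  smaller one by the embedding, so a single map inherits the properties of U on both.\<close>

lemma scale_evolution_glue:
  fixes \<BB> \<EE> :: "real \<Rightarrow> 'a::real_vector nspace"
  assumes scales: "banach_scale lo hi \<BB>" "banach_scale lo hi \<EE>" "scale_embedded lo hi \<BB> \<EE>"
    and x: "x \<in> pts (\<BB> lo)"
    and A1: "cond_A1 lo hi \<BB> T U" and A4: "cond_A4 lo hi \<BB> \<EE> T U A"
    and B1: "cond_B1 lo hi \<BB> T x r B"
    and V_eq: "\<And>t s a b y. (t, s) \<in> time_triangle T \<Longrightarrow> lo \<le> a \<Longrightarrow> a < b \<Longrightarrow> b \<le> hi \<Longrightarrow>
      y \<in> pts (\<EE> a) \<Longrightarrow> U t s a b y = V t s y"
    and A_eq: "\<And>t a b y. t \<in> {0..<T} \<Longrightarrow> lo \<le> a \<Longrightarrow> a < b \<Longrightarrow> b \<le> hi \<Longrightarrow>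
      y \<in> pts (\<BB> a) \<Longrightarrow> A t a b y = A' t y"
    and B_eq: "\<And>t a b y. t \<in> {0..<T} \<Longrightarrow> lo \<le> a \<Longrightarrow> a < b \<Longrightarrow> b \<le> hi \<Longrightarrow>
      y \<in> nball (\<BB> a) x r \<Longrightarrow> B t a b y = B' t y"
  shows "scale_evolution \<BB> \<EE> lo hi T V A' B' x r"
proof -
  have norm: "normed_subspace (\<BB> a)" "normed_subspace (\<EE> a)" if "lo \<le> a" "a \<le> hi" for a
    using scales(1,2) that by (auto simp: banach_scale_def banach_subspace_def)
  note cont_B = normed_nspace.continuous_map_ntop[OF normed_nspace.intro, OF norm(1)]
  note cont_E = normed_nspace.continuous_map_ntop[OF normed_nspace.intro, OF norm(2)]
  have BE: "y \<in> pts (\<EE> a)" if "y \<in> pts (\<BB> a)" "lo \<le> a" "a \<le> hi" for y a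
    using scales(3) that by (auto simp: scale_embedded_def)
  have U_B: "bounded_linear_btw (\<BB> a) (\<BB> b) (U t s a b)"
    if "(t, s) \<in> time_triangle T" "lo \<le> a" "a < b" "b \<le> hi" for t s a b
    using cond_A1D(1)[OF A1 that(2-4,1)] .
  have U_E: "bounded_linear_btw (\<EE> a) (\<EE> b) (U t s a b)"
    if "(t, s) \<in> time_triangle T" "lo \<le> a" "a < b" "b \<le> hi" for t s a b
    using cond_A4D(5)[OF A4 that(2-4,1)] .
  have A_BE: "bounded_linear_btw (\<BB> a) (\<EE> b) (A t a b)"
    if "t \<in> {0..<T}" "lo \<le> a" "a < b" "b \<le> hi" for t a b
    using cond_A4D(1)[OF A4 that(2-4,1)] .
  have V_eq_B: "U t s a b y = V t s y"
    if "(t, s) \<in> time_triangle T" "lo \<le> a" "a < b" "b \<le> hi" "y \<in> pts (\<BB> a)" for t s a b y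
    using V_eq[OF that(1-4) BE] that by auto
  show ?thesis
  proof
    show "bounded_linear_btw (\<BB> a) (\<BB> b) (V t s)"
      if "(t, s) \<in> time_triangle T" "lo \<le> a" "a < b" "b \<le> hi" for t s a b
      using that V_eq_B[OF that] by (intro bounded_linear_btw_cong[OF U_B[OF that]] norm) auto
    show "bounded_linear_btw (\<EE> a) (\<EE> b) (V t s)"
      if "(t, s) \<in> time_triangle T" "lo \<le> a" "a < b" "b \<le> hi" for t s a b
      using that V_eq[OF that] by (intro bounded_linear_btw_cong[OF U_E[OF that]] norm) auto
    show "bounded_linear_btw (\<BB> a) (\<EE> b) (A' t)"
      if "t \<in> {0..<T}" "lo \<le> a" "a < b" "b \<le> hi" for t a b
      using that A_eq[OF that] by (intro bounded_linear_btw_cong[OF A_BE[OF that]] norm) auto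
    show "ncont (\<BB> b) (time_triangle T) (\<lambda>p. V (fst p) (snd p) y)"
      if ab: "lo \<le> a" "a < b" "b \<le> hi" and y: "y \<in> pts (\<BB> a)" for a b y
    proof -
      have "ncont (\<BB> b) (time_triangle T) (\<lambda>p. U (fst p) (snd p) a b y)"
        using cond_A1D(4)[OF A1 ab y] cont_B[of b] ab by auto
      then show ?thesis
        by (subst ncont_cong[OF V_eq_B[symmetric]]) (use ab y in auto)
    qed
    show "ncont (\<EE> b) (time_triangle T) (\<lambda>p. V (fst p) (snd p) y)"
      if ab: "lo \<le> a" "a < b" "b \<le> hi" and y: "y \<in> pts (\<EE> a)" for a b y
    proof -
      have "ncont (\<EE> b) (time_triangle T) (\<lambda>p. U (fst p) (snd p) a b y)"
        using cond_A4D(6)[OF A4 ab y] cont_E[of b] ab by auto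
      then show ?thesis
        by (subst ncont_cong[OF V_eq[symmetric]]) (use ab y in auto)
    qed
    show "ncont (\<EE> b) {0..<T} (\<lambda>t. A' t y)"
      if ab: "lo \<le> a" "a < b" "b \<le> hi" and y: "y \<in> pts (\<BB> a)" for a b y
    proof -
      have "ncont (\<EE> b) {0..<T} (\<lambda>t. A t a b y)"
        using cond_A4D(2)[OF A4 ab y] cont_E[of b] ab by auto
      then show ?thesis
        by (subst ncont_cong[OF A_eq[symmetric]]) (use ab y in auto)
    qed
    show "V t t y = y" if "0 \<le> t" "t < T" "lo \<le> a" "a < hi" "y \<in> pts (\<BB> a)" for t a y
    proof -
      have "U t t a hi y = y" using cond_A1D(2)[OF A1] that by blast
      then show ?thesis using V_eq_B[of t t a hi y] that by (simp add: time_triangle_def)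
    qed
    show "V t q (V q s y) = V t s y"
      if sqt: "0 \<le> s" "s \<le> q" "q \<le> t" "t < T" and a: "lo \<le> a" "a < hi" and y: "y \<in> pts (\<BB> a)"
      for t q s a y
    proof -
      obtain d where d: "a < d" "d < hi" using dense[OF a(2)] by blast
      have tri: "(t, s) \<in> time_triangle T" "(q, s) \<in> time_triangle T" "(t, q) \<in> time_triangle T"
        using sqt by (auto simp: time_triangle_def)
      have "U t q d hi (U q s a d y) = U t s a hi y"
        by (rule cond_A1D(3)[OF A1 a order_refl sqt d y])
      moreover have "U q s a d y = V q s y" "U t s a hi y = V t s y"
        using V_eq_B tri a d y by auto
      moreover have "V q s y \<in> pts (\<BB> d)"
        using bounded_linear_btw_pts[OF U_B[OF tri(2) a(1) d(1)] y] V_eq_B[OF tri(2) a(1) d(1)] d y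
        by simp
      ultimately show ?thesis using V_eq_B[OF tri(3), of d hi "V q s y"] a d by simp
    qed
    fix t s a b y
    assume ts: "(t, s) \<in> time_triangle T" and ab: "lo \<le> a" "a < b" "b \<le> hi" and y: "y \<in> pts (\<BB> a)"
    \<comment> \<open>The intermediate index of the compositions in the derivative formulas; any
      value in between will do, since the glued operators do not see it.\<close>
    obtain d where d: "a < d" "d < b" using dense[OF ab(2)] by blast
    have ord: "lo \<le> d" "d \<le> hi" using ab d by auto
    have ts': "t \<in> {0..<T}" "s \<in> {0..<T}" "t \<in> {s..<T}" "s \<in> {0..t}"
      using ts by (auto simp: time_triangle_def)
    note deriv = cond_A4D(7,8)[OF A4 ab ts d y]
    interpret E: normed_nspace "\<EE> b" using norm(2)[of b] ab by unfold_locales auto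
    have "U t s a d y \<in> pts (\<BB> d)" using bounded_linear_btw_pts[OF U_B[OF ts ab(1) d(1)] y] ord by simp
    then have "A t d b (U t s a d y) = A' t (V t s y)"
      using A_eq[OF ts'(1) ord(1) d(2) ab(3)] V_eq_B[OF ts ab(1) d(1) ord(2) y] by simp
    moreover have "U q s a b y = V q s y" if "q \<in> {s..<T}" for q
      using V_eq_B[OF _ ab y] that ts by (auto simp: time_triangle_def)
    ultimately show "has_deriv_in (\<EE> b) (\<lambda>t. V t s y) (A' t (V t s y)) t {s..<T}"
      using deriv E.has_deriv_in_cong[OF _ ts'(3), of "\<lambda>t. U t s a b y" "\<lambda>t. V t s y"] by simp
    have "A s a d y \<in> pts (\<EE> d)" using bounded_linear_btw_pts[OF A_BE[OF ts'(2) ab(1) d(1)] y] ord by simp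
    then have "U t s d b (A s a d y) = V t s (A' s y)"
      using V_eq[OF ts ord(1) d(2) ab(3)] A_eq[OF ts'(2) ab(1) d(1) ord(2) y] by simp
    moreover have "U t q a b y = V t q y" if "q \<in> {0..t}" for q
      using V_eq_B[OF _ ab y] that ts by (auto simp: time_triangle_def)
    ultimately show "has_deriv_in (\<EE> b) (\<lambda>s. V t s y) (- V t s (A' s y)) s {0..t}"
      using deriv E.has_deriv_in_cong[OF _ ts'(4), of "\<lambda>s. U t s a b y" "\<lambda>s. V t s y"] by simp
  next
    fix a b S v
    assume ab: "lo \<le> a" "a < b" "b \<le> hi" and S: "S \<subseteq> {0..<T}" and v: "ncont (\<BB> a) S v"
      and ball: "\<And>s. s \<in> S \<Longrightarrow> v s \<in> nball (\<BB> a) x r"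
    have "continuous_map (top_of_set S) (ntop (\<BB> a)) v" using v cont_B[of a] ab by auto
    \<comment> \<open>A curve in the ball, paired with time, maps continuously into the product on
      which B is jointly continuous.\<close>
    then have "continuous_map (top_of_set S)
        (prod_topology (subtopology (ntop (\<BB> a)) (nball (\<BB> a) x r)) (top_of_set {0..<T})) (\<lambda>s. (v s, s))"
      using ball S by (intro continuous_map_pairedI continuous_map_into_subtopology) auto
    moreover have "continuous_map
          (prod_topology (subtopology (ntop (\<BB> a)) (nball (\<BB> a) x r)) (top_of_set {0..<T}))
          (ntop (\<BB> b)) (\<lambda>(u, t). B t a b u)"
      using B1 ab unfolding cond_B1_def by blast
    ultimately have "continuous_map (top_of_set S) (ntop (\<BB> b)) ((\<lambda>(u, t). B t a b u) \<circ> (\<lambda>s. (v s, s)))"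
      by (rule continuous_map_compose)
    then have "ncont (\<BB> b) S (\<lambda>s. B s a b (v s))"
      using cont_B[of b] ab by (auto simp: o_def)
    then show "ncont (\<BB> b) S (\<lambda>s. B' s (v s))"
      using ncont_cong[of S "\<lambda>s. B s a b (v s)" "\<lambda>s. B' s (v s)"] B_eq[OF _ ab ball] S by blast
  qed (use scales x in auto)
qed

theorem lemma2p14:
  fixes \<BB> \<EE> :: "real \<Rightarrow> 'a::real_vector nspace"
    and lo hi T \<beta> \<alpha>\<^sub>0 lam :: real
    and r :: ereal
    and x :: 'a
    and U :: "real \<Rightarrow> real \<Rightarrow> real \<Rightarrow> real \<Rightarrow> 'a \<Rightarrow> 'a"
    and A B :: "real \<Rightarrow> real \<Rightarrow> real \<Rightarrow> 'a \<Rightarrow> 'a"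
    and u :: "real \<Rightarrow> 'a"
  assumes "banach_scale lo hi \<BB>" and "banach_scale lo hi \<EE>"
    and "scale_embedded lo hi \<BB> \<EE>"
    and "T > 0" and "x \<in> pts (\<BB> lo)"
    and "cond_A1 lo hi \<BB> T U"
    and "cond_A2 lo hi \<BB> T U \<beta>"
    and "cond_A3 lo hi \<BB> T x U"
    and "cond_A4 lo hi \<BB> \<EE> T U A"
    and "cond_B1 lo hi \<BB> T x r B"
    and "cond_B2 lo hi \<BB> T x r B \<beta>"
    and "cond_B3 lo hi \<BB> T x B"
    and "(\<beta> = 0 \<and> 0 < r) \<or> (0 < \<beta> \<and> \<beta> < 1/2 \<and> 0 < r)"
    and "\<alpha>\<^sub>0 \<in> {lo..<hi}"
    and "lam > 0" and "(hi - \<alpha>\<^sub>0) / lam \<le> T"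
    and "\<And>t. t \<in> {0..<(hi - \<alpha>\<^sub>0) / lam} \<Longrightarrow> u t \<in> pts (\<BB> hi)"
  shows "is_classical_solution hi \<BB> \<EE> x r A B \<alpha>\<^sub>0 lam u \<longleftrightarrow>
         is_integral_solution lo hi \<BB> x r U B \<alpha>\<^sub>0 lam u"
proof -
  \<comment> \<open>U is glued over the larger scale, because it is also applied to values of A,
    which lie only there; A and B are glued over their domains in the smaller scale.\<close>
  define V where "V t s = glue lo hi (\<lambda>a. pts (\<EE> a)) (U t s)" for t s
  define A' where "A' t = glue lo hi (\<lambda>a. pts (\<BB> a)) (A t)" for t
  define B' where "B' t = glue lo hi (\<lambda>a. nball (\<BB> a) x r) (B t)" for t
  have V_eq: "U t s a b y = V t s y"
    if "(t, s) \<in> time_triangle T" "lo \<le> a" "a < b" "b \<le> hi" "y \<in> pts (\<EE> a)" for t s a b y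
  proof -
    have "nonlinear_op_in_scale lo hi \<EE> \<infinity> 0 (U t s)"
      using cond_A4D(4)[OF assms(9) that(2-4,1)] .
    then show ?thesis
      unfolding V_def using that(2-) by (intro glue_eq) (auto simp: nonlinear_op_in_scale_def)
  qed
  have A_eq: "A t a b y = A' t y"
    if "t \<in> {0..<T}" "lo \<le> a" "a < b" "b \<le> hi" "y \<in> pts (\<BB> a)" for t a b y
    unfolding A'_def by (rule glue_eq[where D = "\<lambda>a. pts (\<BB> a)", OF _ that(2-5)]) (rule cond_A4D(3)[OF assms(9)]; use that(1) in simp)
  have B_eq: "B t a b y = B' t y"
    if "t \<in> {0..<T}" "lo \<le> a" "a < b" "b \<le> hi" "y \<in> nball (\<BB> a) x r" for t a b y
  proof -
    have "nonlinear_op_in_scale lo hi \<BB> r x (B t)"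
      using assms(10) that(1) unfolding cond_B1_def by blast
    then show ?thesis
      unfolding B'_def using that(2-) by (intro glue_eq) (auto simp: nonlinear_op_in_scale_def)
  qed
  interpret scale_evolution \<BB> \<EE> lo hi T V A' B' x r
    using scale_evolution_glue[OF assms(1-3,5,6,9,10) V_eq A_eq B_eq] .
  let ?L = "lifetime \<alpha>\<^sub>0 lam"
  \<comment> \<open>Implied by either notion of solution, so the equivalence only has to be proved
    for u with this property.\<close>
  define traj where "traj \<longleftrightarrow> (\<forall>\<alpha>. \<alpha>\<^sub>0 < \<alpha> \<and> \<alpha> \<le> hi \<longrightarrow>
    ncont (\<BB> \<alpha>) {0..<?L \<alpha>} u \<and> (\<forall>t\<in>{0..<?L \<alpha>}. u t \<in> nball (\<BB> \<alpha>) x r))"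
  have \<alpha>\<^sub>0: "lo \<le> \<alpha>\<^sub>0" "\<alpha>\<^sub>0 < hi" using assms(14) by auto
  have cont_B: "continuous_map (top_of_set S) (ntop (\<BB> \<alpha>)) g \<longleftrightarrow> ncont (\<BB> \<alpha>) S g"
    if "\<alpha>\<^sub>0 < \<alpha>" "\<alpha> \<le> hi" for \<alpha> g and S :: "real set"
    by (rule normed_nspace.continuous_map_ntop[OF normed_nspace.intro[OF normed_X]]) (use that \<alpha>\<^sub>0 in auto)
  have cont_E: "continuous_map (top_of_set S) (ntop (\<EE> \<alpha>)) g \<longleftrightarrow> ncont (\<EE> \<alpha>) S g"
    if "\<alpha>\<^sub>0 < \<alpha>" "\<alpha> \<le> hi" for \<alpha> g and S :: "real set"
    by (rule normed_nspace.continuous_map_ntop[OF normed_nspace.intro[OF normed_Y]]) (use that \<alpha>\<^sub>0 in auto)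
  have "is_classical_solution hi \<BB> \<EE> x r A B \<alpha>\<^sub>0 lam u \<Longrightarrow> traj"
    unfolding is_classical_solution_def traj_def using cont_B by blast
  moreover have "is_integral_solution lo hi \<BB> x r U B \<alpha>\<^sub>0 lam u \<Longrightarrow> traj"
    unfolding is_integral_solution_def traj_def using cont_B by blast
  moreover have ?thesis if traj
  proof -
    interpret scale_trajectory \<BB> \<EE> lo hi T V A' B' x r \<alpha>\<^sub>0 lam u
      using \<open>traj\<close> \<alpha>\<^sub>0 assms(15,16) by unfold_locales (auto simp: traj_def lifetime_def)
    \<comment> \<open>Both notions admit the index \<open>\<alpha>\<^sub>0\<close> itself, but its
      lifetime is 0, so no time t can select it. This matters because nothing is known about u in
      the space with that index.\<close>
    have index_pos: "\<alpha>\<^sub>0 < a" if "0 \<le> t" "t < ?L a" for t a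
      using that lam by (simp add: lifetime_def field_simps) (smt (verit) mult_nonneg_nonneg)
    have rhs_eq: "A t a \<alpha> (u t) + B t a \<alpha> (u t) = A' t (u t) + B' t (u t)"
      if "\<alpha> \<le> hi" "a < \<alpha>" "0 \<le> t" "t < ?L a" for a \<alpha> t
    proof -
      have "\<alpha>\<^sub>0 < a" using index_pos that by blast
      then show ?thesis
        using A_eq[of t a \<alpha> "u t"] B_eq[of t a \<alpha> "u t"] u_pts[of a t] u_ball[of a t]
          L_le_T[of a] that \<alpha>\<^sub>0 by simp
    qed
    have integrand_eq: "U t s b \<alpha> (B s a b (u s)) = V t s (B' s (u s))"
      if "\<alpha> \<le> hi" "a < b" "b < \<alpha>" "t < ?L a" "s \<in> {0..t}" for a b \<alpha> t s
    proof -
      have a: "\<alpha>\<^sub>0 < a" using index_pos[of t a] that by simp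
      have "B s a b (u s) = B' s (u s)"
        using B_eq[of s a b "u s"] u_ball[of a s] L_le_T[of a] that a \<alpha>\<^sub>0 by simp
      moreover have "B' s (u s) \<in> pts (\<EE> b)"
        using f_pts[of a b s] X_Y(1)[of b] that a \<alpha>\<^sub>0 by simp
      ultimately show ?thesis
        using V_eq[of t s b \<alpha>] L_le_T[of a] that a \<alpha>\<^sub>0 by (simp add: time_triangle_def)
    qed
    have start_eq: "U t 0 lo \<alpha> x = V t 0 x" if "\<alpha>\<^sub>0 < \<alpha>" "\<alpha> \<le> hi" "0 \<le> t" "t < ?L \<alpha>" for \<alpha> t
      using V_eq[of t 0 lo \<alpha> x] X_Y(1)[of lo x] x L_le_T[of \<alpha>] that \<alpha>\<^sub>0
      by (simp add: time_triangle_def)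
    \<comment> \<open>The index in the definition may vary with t; the glued right-hand side does
      not depend on it. Continuity of the derivative then follows from
      \<open>rhs_cont\<close>.\<close>
    have classical: "is_classical_solution hi \<BB> \<EE> x r A B \<alpha>\<^sub>0 lam u \<longleftrightarrow>
      u 0 = x \<and> (\<forall>\<alpha> t. \<alpha>\<^sub>0 < \<alpha> \<longrightarrow> \<alpha> \<le> hi \<longrightarrow> t \<in> {0..<?L \<alpha>} \<longrightarrow>
        has_deriv_in (\<EE> \<alpha>) u (A' t (u t) + B' t (u t)) t {0..<?L \<alpha>})" (is "?c \<longleftrightarrow> ?d")
    proof
      assume c: ?c
      show ?d
      proof (intro conjI allI impI)
        show "u 0 = x" using c \<alpha>\<^sub>0 unfolding is_classical_solution_def by blast
        fix \<alpha> t assume \<alpha>: "\<alpha>\<^sub>0 < \<alpha>" "\<alpha> \<le> hi" and t: "t \<in> {0..<?L \<alpha>}"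
        then obtain u' a where "has_deriv_in (\<EE> \<alpha>) u (u' t) t {0..<?L \<alpha>}" "a < \<alpha>" "t < ?L a"
          "u' t = A t a \<alpha> (u t) + B t a \<alpha> (u t)"
          using c unfolding is_classical_solution_def by meson
        then show "has_deriv_in (\<EE> \<alpha>) u (A' t (u t) + B' t (u t)) t {0..<?L \<alpha>}"
          using rhs_eq[OF \<alpha>(2), of a t] t by simp
      qed
    next
      assume d: ?d
      show ?c
        unfolding is_classical_solution_def
      proof (intro allI impI conjI ballI exI[of _ "\<lambda>t. A' t (u t) + B' t (u t)"]; (elim conjE)?)
        fix \<alpha> t assume \<alpha>: "\<alpha>\<^sub>0 < \<alpha>" "\<alpha> \<le> hi"
        show "continuous_map (top_of_set {0..<?L \<alpha>}) (ntop (\<BB> \<alpha>)) u"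
          using cont_B u_cont \<alpha> by simp
        show "continuous_map (top_of_set {0..<?L \<alpha>}) (ntop (\<EE> \<alpha>)) (\<lambda>t. A' t (u t) + B' t (u t))"
          using cont_E rhs_cont \<alpha> by simp
        assume t: "t \<in> {0..<?L \<alpha>}"
        show "u t \<in> nball (\<BB> \<alpha>) x r" using u_ball \<alpha> t by simp
        show "has_deriv_in (\<EE> \<alpha>) u (A' t (u t) + B' t (u t)) t {0..<?L \<alpha>}" using d \<alpha> t by blast
        obtain a where "\<alpha>\<^sub>0 < a" "a < \<alpha>" "t < ?L a" by (rule index_below[of \<alpha> t]) (use \<alpha> t in auto)
        then show "\<exists>a\<ge>\<alpha>\<^sub>0. a < \<alpha> \<and> t < ?L a \<and>
            A' t (u t) + B' t (u t) = A t a \<alpha> (u t) + B t a \<alpha> (u t)"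
          using rhs_eq[OF \<alpha>(2), of a t] t by (intro exI[of _ a]) auto
      qed (use d in blast)
    qed
    \<comment> \<open>Gluing removes the two indices under the integral, so one choice of them is as
      good as any other.\<close>
    have integral: "is_integral_solution lo hi \<BB> x r U B \<alpha>\<^sub>0 lam u \<longleftrightarrow>
      (\<forall>\<alpha> t. \<alpha>\<^sub>0 < \<alpha> \<longrightarrow> \<alpha> \<le> hi \<longrightarrow> 0 \<le> t \<longrightarrow> t < ?L \<alpha> \<longrightarrow>
        (\<exists>I. has_integral_in (\<BB> \<alpha>) (\<lambda>s. V t s (B' s (u s))) I 0 t \<and> u t = V t 0 x + I))" (is "?c \<longleftrightarrow> ?d")
    proof
      assume c: ?c
      show ?d
      proof (intro allI impI)
        fix \<alpha> t assume \<alpha>: "\<alpha>\<^sub>0 < \<alpha>" "\<alpha> \<le> hi" and t: "0 \<le> t" "t < ?L \<alpha>"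
        then obtain a b I where ab: "a < b" "b < \<alpha>" "t < ?L a"
          and I: "has_integral_in (\<BB> \<alpha>) (\<lambda>s. U t s b \<alpha> (B s a b (u s))) I 0 t" "u t = U t 0 lo \<alpha> x + I"
          using c unfolding is_integral_solution_def by (meson atLeastLessThan_iff)
        show "\<exists>I. has_integral_in (\<BB> \<alpha>) (\<lambda>s. V t s (B' s (u s))) I 0 t \<and> u t = V t 0 x + I"
          using I has_integral_in_cong[OF integrand_eq[OF \<alpha>(2) ab]] start_eq[OF \<alpha> t] by auto
      qed
    next
      assume d: ?d
      show ?c
        unfolding is_integral_solution_def
      proof (intro allI impI conjI ballI; (elim conjE)?)
        fix \<alpha> t assume \<alpha>: "\<alpha>\<^sub>0 < \<alpha>" "\<alpha> \<le> hi"
        show "continuous_map (top_of_set {0..<?L \<alpha>}) (ntop (\<BB> \<alpha>)) u"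
          using cont_B u_cont \<alpha> by simp
        assume t: "t \<in> {0..<?L \<alpha>}"
        show "u t \<in> nball (\<BB> \<alpha>) x r" using u_ball \<alpha> t by simp
        have t': "0 \<le> t" "t < ?L \<alpha>" using t by auto
        obtain a where a: "\<alpha>\<^sub>0 < a" "a < \<alpha>" "t < ?L a" using index_below[OF \<alpha>(1) t'] .
        obtain b where b: "a < b" "b < \<alpha>" using dense[OF a(2)] by blast
        obtain I where I: "has_integral_in (\<BB> \<alpha>) (\<lambda>s. V t s (B' s (u s))) I 0 t" "u t = V t 0 x + I"
          using d \<alpha> t' by blast
        have "has_integral_in (\<BB> \<alpha>) (\<lambda>s. U t s b \<alpha> (B s a b (u s))) I 0 t"
          using I(1) has_integral_in_cong[OF integrand_eq[OF \<alpha>(2) b a(3)]] by simp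
        then show "\<exists>a b I. \<alpha>\<^sub>0 \<le> a \<and> a < b \<and> b < \<alpha> \<and> t < ?L a \<and>
            has_integral_in (\<BB> \<alpha>) (\<lambda>s. U t s b \<alpha> (B s a b (u s))) I 0 t \<and> u t = U t 0 lo \<alpha> x + I"
          using I(2) start_eq[OF \<alpha> t'] a b by (intro exI[of _ a] exI[of _ b] exI[of _ I]) simp
      qed
    qed
    show ?thesis
      unfolding classical integral
      using classical_imp_integral integral_solution_initial integral_solution_deriv by blast
  qed
  ultimately show ?thesis by blast
qed

end
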